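(* Let $d,m\in\{1,2,\dots\}$, let $\mathbb{C}=(\mathbb{C}_{i\alpha}^{j\beta})_{i,j=1,\dots,m}^{\alpha,\beta=1,\dots,d}\in (L^\infty)^{m^2d^2}$ be a tensor field on $\mathbb{R}^d$, and define the symmetric bilinear form $a:\dot{H}^1\times\dot{H}^1\to\mathbb{R}$ by $$a(u,v):=\int_{\mathbb{R}^d}\mathbb{C}_{i\alpha}^{j\beta}\,\partial_\alpha u_i\,\partial_\beta v_j\,dx$$ (summation over repeated indices). Let $f\in L^1_{\rm loc}$ be of the form $f=\mathrm{div}\,g$ with $g\in L^2$, and let $\ell$ be the bounded linear functional on $\dot{H}^1$ obtained by extending $$\ell([v]):=\int_{\mathbb{R}^d}f\cdot v^*\,dx,\qquad v^*\in[v],\ v^*\in\mathscr{D},\qquad [v]\in\dot{\mathscr{D}}.$$ Suppose that $a$ is coercive: there is a constant $c_0>0$ such that $a(u,u)\ge c_0\|\partial u\|_{L^2}^2$ for all $u\in\dot{H}^1$. Let $u\in\dot{H}^1$ denote the unique solution of $$a(u,v)=\ell(v)\qquad\text{for all }v\in\mathscr{D},$$ and let $c_2$ be a constant with $\|\partial u\|_{L^2}\le c_2$. Then the following hold, where $C$ denotes a constant. (i) Suppose, in addition, that $\mathbb{C}\in C^1$ and $f\in L^2$. Then $u\in\dot{H}^2$ and $$\|\partial^2u\|_{L^2}\le C\bigl(\|f\|_{L^2}+c_2\|\partial\mathbb{C}\|_{L^\infty}\bigr).$$ (ii) Suppose, in addition, that $\mathbb{C}\in C^2$, $\partial\mathbb{C}\in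 L^2$, and $f\in H^1$. Then $u\in\dot{H}^3$ and $$\|\partial^3u\|_{L^2}\le C\bigl(\|\partial f\|_{L^2}+\|\partial\mathbb{C}\|_{L^2}\|\partial^2u\|_{L^2}+c_2\|\partial^2\mathbb{C}\|_{L^\infty}\bigr).$$
   Context: All function spaces are over $\mathbb{R}^d$. The functions $u,v,f$ take values in $\mathbb{R}^m$, and $g$ takes values in $\mathbb{R}^{m\times d}$ with row-wise divergence $(\mathrm{div}\,g)_i=\partial_\alpha g_{i\alpha}$. $\mathscr{D}=\mathscr{D}(\mathbb{R}^d;\mathbb{R}^m)$ is the space of $C^\infty$ functions with compact support. For a measurable $u:\mathbb{R}^d\to\mathbb{R}^m$, $[u]:=\{u+c\mid c\in\mathbb{R}^m\}$ is the equivalence class modulo additive constants, and $\dot{\mathscr{D}}:=\{[u]\mid u\in\mathscr{D}\}$. $\partial$, $\partial^2$, $\partial^3$ denote the tensors of (distributional) partial derivatives of order one, two and three. $\dot{H}^1:=\{[u]\mid u\in W^{1,2}_{\rm loc},\ \partial u\in L^2\}$, a Hilbert space with inner product $(\partial\cdot,\partial\cdot)_{L^2}$; for $s\in\{2,3,\dots\}$, $\dot{H}^s:=\{u\in\dot{H}^1\mid\partial u\in H^{s-1}\}$, where $H^{s-1}$ is the usual $L^2$-based Sobolev space. Brackets are dropped: $u\in\dot{H}^1$ means an arbitrary representative of a class $[u]$; $a$ and $\ell$ depend only on the classes, and $\ell(v)$ means $\ell([v])$. Under the stated coercivity assumption the weak problem has a unique solution in $\dot{H}^1$, i.e. unique up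 to additive constants.
   Formalization: The derivative of the coefficient tensor is assumed bounded in (i), and its second derivative is assumed bounded in (ii); if C^1 and C^2 do not include this, the claimed regularity of u fails already for d=m=1. *)

theory Defs
  imports "HOL-Analysis.Analysis" "HOL-Probability.Essential_Supremum"
begin

text \<open>
  Fields on $d$-dimensional Euclidean space are functions on \<open>real ^ 'd\<close> with values in a
  Euclidean space; on \<open>real ^ 'd ^ 'm\<close> and further iterations \<open>norm\<close> is the Frobenius norm.
  Elements of the spaces below are representatives: functions equal almost everywhere
  are not identified, and neither are functions that differ by a constant.
\<close>

definition pdiff :: "'d::finite \<Rightarrow> (real ^ 'd \<Rightarrow> 'b::real_normed_vector) \<Rightarrow> real ^ 'd \<Rightarrow> 'b"
  where "pdiff \<alpha> F x = frechet_derivative F (at x) (axis \<alpha> 1)"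

text \<open>No boundedness of the function or its derivatives is included in \<open>C_k\<close>.\<close>

primrec C_k :: "nat \<Rightarrow> (real ^ 'd::finite \<Rightarrow> 'b::real_normed_vector) set"
  where
    "C_k 0 = {F. continuous_on UNIV F}"
  | "C_k (Suc k) = {F. (\<forall>x. F differentiable (at x)) \<and> (\<forall>\<alpha>. pdiff \<alpha> F \<in> C_k k)}"

definition test_functions :: "(real ^ 'd::finite \<Rightarrow> 'b::real_normed_vector) set"
  where "test_functions = {\<phi>. (\<forall>k. \<phi> \<in> C_k k) \<and> compact (closure {x. \<phi> x \<noteq> 0})}"

definition L1_loc :: "(real ^ 'd::finite \<Rightarrow> 'b::euclidean_space) set"
  where "L1_loc = {F \<in> borel_measurable lebesgue. \<forall>K. compact K \<longrightarrow> set_integrable lebesgue K F}"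

definition L2_loc :: "(real ^ 'd::finite \<Rightarrow> 'b::euclidean_space) set"
  where "L2_loc = {F \<in> borel_measurable lebesgue.
           \<forall>K. compact K \<longrightarrow> set_integrable lebesgue K (\<lambda>x. (norm (F x))\<^sup>2)}"

definition L2 :: "(real ^ 'd::finite \<Rightarrow> 'b::euclidean_space) set"
  where "L2 = {F \<in> borel_measurable lebesgue. integrable lebesgue (\<lambda>x. (norm (F x))\<^sup>2)}"

definition norm_L2 :: "(real ^ 'd::finite \<Rightarrow> 'b::euclidean_space) \<Rightarrow> real"
  where "norm_L2 F = sqrt (\<integral>x. (norm (F x))\<^sup>2 \<partial>lebesgue)"

definition L_inf :: "(real ^ 'd::finite \<Rightarrow> 'b::euclidean_space) set"
  where "L_inf = {F \<in> borel_measurable lebesgue. esssup lebesgue (\<lambda>x. ereal (norm (F x))) < \<infinity>}"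

text \<open>Meaningful only on \<open>L_inf\<close>, since \<open>real_of_ereal\<close> sends infinity to 0.\<close>

definition norm_Linf :: "(real ^ 'd::finite \<Rightarrow> 'b::euclidean_space) \<Rightarrow> real"
  where "norm_Linf F = real_of_ereal (esssup lebesgue (\<lambda>x. ereal (norm (F x))))"

definition is_weak_pdiff ::
    "'d::finite \<Rightarrow> (real ^ 'd \<Rightarrow> 'b::euclidean_space) \<Rightarrow> (real ^ 'd \<Rightarrow> 'b) \<Rightarrow> bool"
  where "is_weak_pdiff \<alpha> F G \<longleftrightarrow> F \<in> L1_loc \<and> G \<in> L1_loc \<and>
           (\<forall>\<phi> \<in> test_functions.
              (\<integral>x. pdiff \<alpha> \<phi> x *\<^sub>R F x \<partial>lebesgue) = - (\<integral>x. \<phi> x *\<^sub>R G x \<partial>lebesgue))"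

text \<open>The differentiation index is the outermost one: \<open>wgrad u x $ \<alpha> $ i\<close> is the weak
  derivative in direction \<open>\<alpha>\<close> of the component \<open>i\<close> of \<open>u\<close>. Weak gradients are unique only up
  to null sets, and \<open>wgrad\<close> is meaningful only on weakly differentiable functions.\<close>

definition is_weak_grad ::
    "(real ^ 'd::finite \<Rightarrow> 'b::euclidean_space) \<Rightarrow> (real ^ 'd \<Rightarrow> 'b ^ 'd) \<Rightarrow> bool"
  where "is_weak_grad F G \<longleftrightarrow> (\<forall>\<alpha>. is_weak_pdiff \<alpha> F (\<lambda>x. G x $ \<alpha>))"

definition weakly_differentiable :: "(real ^ 'd::finite \<Rightarrow> 'b::euclidean_space) \<Rightarrow> bool"
  where "weakly_differentiable F \<longleftrightarrow> (\<exists>G. is_weak_grad F G)"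

definition wgrad :: "(real ^ 'd::finite \<Rightarrow> 'b::euclidean_space) \<Rightarrow> real ^ 'd \<Rightarrow> 'b ^ 'd"
  where "wgrad F = (SOME G. is_weak_grad F G)"

definition is_weak_div ::
    "(real ^ 'd::finite \<Rightarrow> real ^ 'd ^ 'm::finite) \<Rightarrow> (real ^ 'd \<Rightarrow> real ^ 'm) \<Rightarrow> bool"
  where "is_weak_div g f \<longleftrightarrow> g \<in> L1_loc \<and> f \<in> L1_loc \<and>
           (\<forall>\<phi> \<in> test_functions. \<forall>i.
              (\<integral>x. (\<Sum>\<alpha>\<in>UNIV. g x $ i $ \<alpha> * pdiff \<alpha> \<phi> x) \<partial>lebesgue) =
                - (\<integral>x. f x $ i * \<phi> x \<partial>lebesgue))"

primrec sobolev :: "nat \<Rightarrow> (real ^ 'd::finite \<Rightarrow> 'b::euclidean_space) set"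
  where
    "sobolev 0 = L2"
  | "sobolev (Suc k) = {F \<in> L2. \<forall>\<alpha>. \<exists>G \<in> sobolev k. is_weak_pdiff \<alpha> F G}"

definition W12_loc :: "(real ^ 'd::finite \<Rightarrow> 'b::euclidean_space) set"
  where "W12_loc = {u \<in> L2_loc. weakly_differentiable u \<and> wgrad u \<in> L2_loc}"

definition Hdot1 :: "(real ^ 'd::finite \<Rightarrow> 'b::euclidean_space) set"
  where "Hdot1 = {u \<in> W12_loc. wgrad u \<in> L2}"

definition Hdot :: "nat \<Rightarrow> (real ^ 'd::finite \<Rightarrow> 'b::euclidean_space) set"
  where "Hdot s = {u \<in> Hdot1. wgrad u \<in> sobolev (s - 1)}"

text \<open>\<open>A x $ i $ \<alpha> $ j $ \<beta>\<close> is the coefficient with lower indices \<open>i\<close>, \<open>\<alpha>\<close> and upper indices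
  \<open>j\<close>, \<open>\<beta>\<close>.\<close>

definition elliptic_form ::
    "(real ^ 'd \<Rightarrow> real ^ 'd ^ 'm ^ 'd ^ 'm) \<Rightarrow>
     (real ^ 'd::finite \<Rightarrow> real ^ 'm::finite) \<Rightarrow> (real ^ 'd \<Rightarrow> real ^ 'm) \<Rightarrow> real"
  where "elliptic_form A u v =
           (\<integral>x. (\<Sum>i\<in>UNIV. \<Sum>\<alpha>\<in>UNIV. \<Sum>j\<in>UNIV. \<Sum>\<beta>\<in>UNIV.
                   A x $ i $ \<alpha> $ j $ \<beta> * wgrad u x $ \<alpha> $ i * wgrad v x $ \<beta> $ j) \<partial>lebesgue)"

definition symmetric_form ::
    "((real ^ 'd::finite \<Rightarrow> real ^ 'm::finite) \<Rightarrow> (real ^ 'd \<Rightarrow> real ^ 'm) \<Rightarrow> real) \<Rightarrow> bool"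
  where "symmetric_form a \<longleftrightarrow> (\<forall>u \<in> Hdot1. \<forall>v \<in> Hdot1. a u v = a v u)"

definition coercive_form ::
    "real \<Rightarrow> ((real ^ 'd::finite \<Rightarrow> real ^ 'm::finite) \<Rightarrow> (real ^ 'd \<Rightarrow> real ^ 'm) \<Rightarrow> real) \<Rightarrow> bool"
  where "coercive_form c\<^sub>0 a \<longleftrightarrow> (\<forall>u \<in> Hdot1. a u u \<ge> c\<^sub>0 * (norm_L2 (wgrad u))\<^sup>2)"

text \<open>Linearity and boundedness with respect to the seminorm \<open>norm_L2 (wgrad v)\<close> make the
  functional invariant under addition of constants, so that it acts on the classes.\<close>

definition bounded_functional_Hdot1 ::
    "((real ^ 'd::finite \<Rightarrow> 'b::euclidean_space) \<Rightarrow> real) \<Rightarrow> bool"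
  where "bounded_functional_Hdot1 l \<longleftrightarrow>
           (\<forall>v \<in> Hdot1. \<forall>w \<in> Hdot1. l (\<lambda>x. v x + w x) = l v + l w) \<and>
           (\<forall>v \<in> Hdot1. \<forall>r. l (\<lambda>x. r *\<^sub>R v x) = r * l v) \<and>
           (\<exists>B. \<forall>v \<in> Hdot1. \<bar>l v\<bar> \<le> B * norm_L2 (wgrad v))"

definition load_functional ::
    "(real ^ 'd::finite \<Rightarrow> real ^ 'm::finite) \<Rightarrow> ((real ^ 'd \<Rightarrow> real ^ 'm) \<Rightarrow> real) \<Rightarrow> bool"
  where "load_functional f l \<longleftrightarrow> bounded_functional_Hdot1 l \<and>
           (\<forall>v \<in> test_functions. l v = (\<integral>x. f x \<bullet> v x \<partial>lebesgue))"

end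

theory Submission
  imports Defs
begin

text \<open>
  Everything is done by mollification. For a weak solution \<open>w\<close> with gradient \<open>W\<close> the smooth
  function \<open>z = \<partial>\<^sub>\<gamma> (\<eta>\<^sub>n * w)\<close> satisfies the equation up to the commutator of the coefficient with
  convolution by \<open>\<partial>\<^sub>\<gamma> \<eta>\<^sub>n\<close>, whose \<open>L\<^sup>2\<close> norm Young's inequality bounds by \<open>\<parallel>\<partial>A\<parallel>\<^sub>\<infinity> \<parallel>W\<parallel>\<close> uniformly
  in \<open>n\<close>. Since both \<open>z\<close> and its gradient \<open>(\<partial>\<^sub>\<gamma> \<eta>\<^sub>n) * W\<close> are square integrable, \<open>z\<close> may be tested
  against itself, and coercivity bounds \<open>(\<partial>\<^sub>\<gamma> \<eta>\<^sub>n) * W\<close> in \<open>L\<^sup>2\<close>. Hence \<open>\<partial>\<^sub>\<gamma> W\<close> is a bounded functional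
  on test functions for the \<open>L\<^sup>2\<close> norm, and the Riesz theorem makes it an \<open>L\<^sup>2\<close> function. This gives (i).

  For (ii), \<open>\<partial>\<^sub>\<gamma> u\<close> solves an equation of the same kind, so the argument repeats. The remaining
  product of \<open>\<partial>A\<close> and \<open>\<partial>\<^sup>2 u\<close> is absorbed by \<open>\<parallel>\<partial>A\<parallel>\<^sub>\<infinity>\<^sup>2 \<le> C \<parallel>A\<parallel>\<^sub>\<infinity> \<parallel>\<partial>\<^sup>2A\<parallel>\<^sub>\<infinity>\<close> (Landau) and
  \<open>\<parallel>\<partial>\<^sup>2u\<parallel>\<^sup>2 \<le> \<parallel>\<partial>u\<parallel> \<parallel>\<partial>\<^sup>3u\<parallel>\<close>; the summand \<open>\<parallel>\<partial>A\<parallel> \<parallel>\<partial>\<^sup>2u\<parallel>\<close> of the estimate is simply discarded.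
\<close>

section \<open>Smooth functions and a bump function\<close>

text \<open>Coercivity is assumed for the integrated form, not pointwise, so the estimate has to
  come from inserting one function on the whole space. The solution is not suited for this, since
  only its gradient is square integrable; its mollified derivative is, because the derivative may be
  placed on either factor of the convolution. Replacing it by compactly supported functions costs an
  error made of the function times a derivative of the cutoff, which vanishes in the limit. The
  commutator stays bounded because only the first moment of \<open>\<partial>\<eta>\<^sub>n\<close>
  enters, and dilation does not change that moment. Weak limits are taken with the mollifier on the
  test function, where pointwise convergence and a common majorant are available. In (ii) Landau's
  inequality also yields the boundedness of \<open>\<partial>A\<close> on which the commutator
  estimate rests, and the absorption is legitimate because the third derivatives are by then known
  to be square integrable, with a bound that still contains the second ones.\<close>

lemma pdiff_eqI:
  assumes "(F has_derivative D) (at x)"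
  shows "pdiff \<alpha> F x = D (axis \<alpha> 1)"
  using frechet_derivative_at[OF assms] by (simp add: pdiff_def)

lemma has_derivative_pdiff:
  fixes F :: "real ^ 'd::finite \<Rightarrow> 'b::real_normed_vector"
  assumes "F differentiable (at x)"
  shows "(F has_derivative (\<lambda>h. \<Sum>\<alpha>\<in>UNIV. h $ \<alpha> *\<^sub>R pdiff \<alpha> F x)) (at x)"
proof -
  let ?D = "frechet_derivative F (at x)"
  have D: "(F has_derivative ?D) (at x)"
    using assms frechet_derivative_works by blast
  interpret bounded_linear ?D using D has_derivative_bounded_linear by blast
  have "?D h = (\<Sum>\<alpha>\<in>UNIV. h $ \<alpha> *\<^sub>R pdiff \<alpha> F x)" for h
  proof -
    have "?D h = ?D (\<Sum>\<alpha>\<in>UNIV. h $ \<alpha> *\<^sub>R axis \<alpha> 1)"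
      by (simp flip: scalar_mult_eq_scaleR add: basis_expansion)
    also have "\<dots> = (\<Sum>\<alpha>\<in>UNIV. h $ \<alpha> *\<^sub>R pdiff \<alpha> F x)"
      by (simp add: sum scaleR pdiff_def)
    finally show ?thesis .
  qed
  then have "?D = (\<lambda>h. \<Sum>\<alpha>\<in>UNIV. h $ \<alpha> *\<^sub>R pdiff \<alpha> F x)" by (rule ext)
  then show ?thesis using D by simp
qed

lemma C_k_0 [simp]: "F \<in> C_k 0 \<longleftrightarrow> continuous_on UNIV F"
  by simp

lemma C_k_SucI:
  assumes "\<And>x. F differentiable (at x)" "\<And>\<alpha>. pdiff \<alpha> F \<in> C_k k"
  shows "F \<in> C_k (Suc k)"
  using assms by simp

lemma C_k_SucD:
  assumes "F \<in> C_k (Suc k)"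
  shows "F differentiable (at x)" "pdiff \<alpha> F \<in> C_k k"
  using assms by auto

lemma C_k_Suc_subset: "F \<in> C_k (Suc k) \<Longrightarrow> F \<in> C_k k"
proof (induction k arbitrary: F)
  case 0
  then show ?case
    by (auto simp: continuous_on_eq_continuous_at intro: differentiable_imp_continuous_within)
next
  case (Suc k)
  show ?case
    by (rule C_k_SucI) (use Suc in \<open>auto simp del: C_k.simps dest: C_k_SucD\<close>)
qed

lemma C_k_mono: "F \<in> C_k n \<Longrightarrow> k \<le> n \<Longrightarrow> F \<in> C_k k"
  by (induction n) (auto simp del: C_k.simps simp: le_Suc_eq intro: C_k_Suc_subset)

lemma C_k_continuous: "F \<in> C_k k \<Longrightarrow> continuous_on UNIV F"
  using C_k_mono[of F k 0] by simp

lemma C_k_const: "(\<lambda>x. c) \<in> C_k k"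
proof (induction k arbitrary: c)
  case (Suc k)
  have "pdiff \<alpha> (\<lambda>x::real^'a. c) = (\<lambda>x. 0)" for \<alpha>
    by (auto simp: pdiff_def)
  then show ?case using Suc[of 0] by simp
qed auto

lemma pdiff_add:
  assumes "F differentiable (at x)" "G differentiable (at x)"
  shows "pdiff \<alpha> (\<lambda>x. F x + G x) x = pdiff \<alpha> F x + pdiff \<alpha> G x"
  using pdiff_eqI[OF has_derivative_add] assms unfolding frechet_derivative_works pdiff_def by blast

lemma C_k_add:
  assumes "F \<in> C_k k" "G \<in> C_k k"
  shows "(\<lambda>x. F x + G x) \<in> C_k k"
  using assms
proof (induction k arbitrary: F G)
  case (Suc k)
  show ?case
  proof (rule C_k_SucI)
    show "(\<lambda>x. F x + G x) differentiable (at x)" for x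
      using Suc.prems by (auto intro!: differentiable_add)
    have "pdiff \<alpha> (\<lambda>x. F x + G x) = (\<lambda>x. pdiff \<alpha> F x + pdiff \<alpha> G x)" for \<alpha>
      using Suc.prems by (intro ext pdiff_add) auto
    then show "pdiff \<alpha> (\<lambda>x. F x + G x) \<in> C_k k" for \<alpha>
      using Suc by auto
  qed
qed (auto intro: continuous_intros)

text \<open>One product rule for every product in use; multiplication of scalars and scaling of
  vectors are instances.\<close>

lemma (in bounded_bilinear) pdiff_bilinear:
  assumes "F differentiable (at x)" "G differentiable (at x)"
  shows "pdiff \<alpha> (\<lambda>x. prod (F x) (G x)) x = prod (F x) (pdiff \<alpha> G x) + prod (pdiff \<alpha> F x) (G x)"
  using pdiff_eqI[OF FDERIV] assms unfolding frechet_derivative_works pdiff_def by blast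

text \<open>The product rule leaves one factor undifferentiated, and this factor is first lowered to
  the smaller class so that the induction hypothesis fits both summands.\<close>

lemma (in bounded_bilinear) C_k_bilinear:
  assumes "F \<in> C_k k" "G \<in> C_k k"
  shows "(\<lambda>x. prod (F x) (G x)) \<in> C_k k"
  using assms
proof (induction k arbitrary: F G)
  case 0
  then show ?case by (auto intro: continuous_on)
next
  case (Suc k)
  show ?case
  proof (rule C_k_SucI)
    show "(\<lambda>x. prod (F x) (G x)) differentiable (at x)" for x
      by (rule differentiableI[OF FDERIV[OF frechet_derivative_works[THEN iffD1]
            frechet_derivative_works[THEN iffD1]]]) (use Suc.prems in auto)
    have "pdiff \<alpha> (\<lambda>x. prod (F x) (G x)) = (\<lambda>x. prod (F x) (pdiff \<alpha> G x) + prod (pdiff \<alpha> F x) (G x))" for \<alpha>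
      using Suc.prems by (intro ext pdiff_bilinear) auto
    moreover have "(\<lambda>x. prod (F x) (pdiff \<alpha> G x) + prod (pdiff \<alpha> F x) (G x)) \<in> C_k k" for \<alpha>
      using C_k_Suc_subset[OF Suc.prems(1)] C_k_Suc_subset[OF Suc.prems(2)] C_k_SucD(2)[OF Suc.prems(1)]
        C_k_SucD(2)[OF Suc.prems(2)] by (intro C_k_add Suc.IH)
    ultimately show "pdiff \<alpha> (\<lambda>x. prod (F x) (G x)) \<in> C_k k" for \<alpha>
      by simp
  qed
qed

lemmas C_k_scaleR = bounded_bilinear.C_k_bilinear[OF bounded_bilinear_scaleR]
lemmas pdiff_scaleR = bounded_bilinear.pdiff_bilinear[OF bounded_bilinear_scaleR]

lemma (in bounded_linear) pdiff_linear:
  assumes "F differentiable (at x)"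
  shows "pdiff \<alpha> (\<lambda>x. f (F x)) x = f (pdiff \<alpha> F x)"
  using pdiff_eqI[OF has_derivative] assms unfolding frechet_derivative_works pdiff_def by blast

lemma (in bounded_linear) C_k_linear:
  assumes "F \<in> C_k k"
  shows "(\<lambda>x. f (F x)) \<in> C_k k"
  using assms
proof (induction k arbitrary: F)
  case 0
  then show ?case by (auto intro: continuous_on)
next
  case (Suc k)
  show ?case
  proof (rule C_k_SucI)
    show "(\<lambda>x. f (F x)) differentiable (at x)" for x
      by (rule differentiableI[OF has_derivative[OF frechet_derivative_works[THEN iffD1]]])
         (use Suc.prems in auto)
    have "pdiff \<alpha> (\<lambda>x. f (F x)) = (\<lambda>x. f (pdiff \<alpha> F x))" for \<alpha>
      using Suc.prems by (intro ext pdiff_linear) auto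
    then show "pdiff \<alpha> (\<lambda>x. f (F x)) \<in> C_k k" for \<alpha>
      using Suc by auto
  qed
qed

lemma C_k_sum:
  assumes "\<And>i. i \<in> I \<Longrightarrow> F i \<in> C_k k"
  shows "(\<lambda>x. \<Sum>i\<in>I. F i x) \<in> C_k k"
  using assms by (induction I rule: infinite_finite_induct) (auto intro: C_k_add C_k_const simp del: C_k.simps)

lemma C_k_nth: "(\<lambda>x::real^'d::finite. x $ \<alpha>) \<in> C_k k"
proof (cases k)
  case (Suc n)
  have *: "((\<lambda>x::real^'d. x $ \<alpha>) has_derivative (\<lambda>h. h $ \<alpha>)) (at x)" for x
    by (rule bounded_linear_imp_has_derivative[OF bounded_linear_vec_nth])
  then have "pdiff \<beta> (\<lambda>x::real^'d. x $ \<alpha>) = (\<lambda>x. axis \<beta> 1 $ \<alpha>)" for \<beta>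
    by (intro ext) (rule pdiff_eqI)
  then show ?thesis
    using differentiableI[OF *] Suc by (auto simp: C_k_const simp del: C_k.simps intro!: C_k_SucI)
qed (auto intro: continuous_intros)

text \<open>Covers translations (\<open>c = 1\<close>), reflections (\<open>c = -1\<close>) and
  dilations at once: convolution reflects its kernel, while mollifiers and cutoffs are dilated
  bumps.\<close>

lemma pdiff_affine:
  assumes "F differentiable (at (t + c *\<^sub>R x))"
  shows "pdiff \<alpha> (\<lambda>x. F (t + c *\<^sub>R x)) x = c *\<^sub>R pdiff \<alpha> F (t + c *\<^sub>R x)"
    "(\<lambda>x. F (t + c *\<^sub>R x)) differentiable (at x)"
proof -
  have F: "(F has_derivative frechet_derivative F (at (t + c *\<^sub>R x))) (at (t + c *\<^sub>R x))"
    using assms frechet_derivative_works by blast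
  have *: "((\<lambda>x. F (t + c *\<^sub>R x)) has_derivative
      (\<lambda>h. frechet_derivative F (at (t + c *\<^sub>R x)) (c *\<^sub>R h))) (at x)"
    by (rule has_derivative_compose[where f="\<lambda>x. t + c *\<^sub>R x", OF _ F])
       (auto intro!: derivative_eq_intros)
  interpret bounded_linear "frechet_derivative F (at (t + c *\<^sub>R x))"
    using F has_derivative_bounded_linear by blast
  show "pdiff \<alpha> (\<lambda>x. F (t + c *\<^sub>R x)) x = c *\<^sub>R pdiff \<alpha> F (t + c *\<^sub>R x)"
    using pdiff_eqI[OF *] by (simp add: scaleR pdiff_def)
  show "(\<lambda>x. F (t + c *\<^sub>R x)) differentiable (at x)"
    using * by (auto simp: differentiable_def)
qed

lemma C_k_affine:
  assumes "F \<in> C_k k"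
  shows "(\<lambda>x. F (t + c *\<^sub>R x)) \<in> C_k k"
  using assms
proof (induction k arbitrary: F)
  case 0
  then show ?case by (auto intro!: continuous_on_compose2[of UNIV F] continuous_intros)
next
  case (Suc k)
  show ?case
  proof (rule C_k_SucI)
    show "(\<lambda>x. F (t + c *\<^sub>R x)) differentiable (at x)" for x
      using Suc.prems by (intro pdiff_affine) auto
    have "pdiff \<alpha> (\<lambda>x. F (t + c *\<^sub>R x)) = (\<lambda>x. c *\<^sub>R pdiff \<alpha> F (t + c *\<^sub>R x))" for \<alpha>
      using Suc.prems by (intro ext pdiff_affine) auto
    then show "pdiff \<alpha> (\<lambda>x. F (t + c *\<^sub>R x)) \<in> C_k k" for \<alpha>
      using Suc by (auto intro!: C_k_scaleR C_k_const simp del: C_k.simps dest: C_k_SucD)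
  qed
qed

section \<open>A flat function and a smooth bump\<close>

text \<open>The classical flat function exp(-1/t), divided by powers of t. The powers make the
  family closed under differentiation up to linear combinations, so that one induction gives
  smoothness.\<close>

definition flat_exp :: "nat \<Rightarrow> real \<Rightarrow> real"
  where "flat_exp n t = (if t > 0 then exp (- 1 / t) / t ^ n else 0)"

lemma flat_exp_tendsto_0: "(flat_exp n \<longlongrightarrow> 0) (at 0)"
proof -
  have "((\<lambda>t. (inverse t) ^ n / exp (inverse t)) \<longlongrightarrow> (0::real)) (at_right 0)"
    by (rule filterlim_compose[OF tendsto_power_div_exp_0 filterlim_inverse_at_top_right])
  moreover have "\<forall>\<^sub>F t in at_right 0. (inverse t) ^ n / exp (inverse t) = flat_exp n t"
    by (auto simp: eventually_at_right_field flat_exp_def exp_minus field_simps intro!: exI[of _ 1])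
  ultimately have "(flat_exp n \<longlongrightarrow> 0) (at_right 0)"
    using tendsto_cong by force
  moreover have "(flat_exp n \<longlongrightarrow> 0) (at_left 0)"
    by (rule tendsto_eventually) (auto simp: eventually_at_left_field flat_exp_def intro!: exI[of _ "-1"])
  ultimately show ?thesis
    by (simp add: filterlim_split_at)
qed

lemma has_real_derivative_flat_exp:
  "(flat_exp n has_real_derivative flat_exp (n + 2) t - real n * flat_exp (n + 1) t) (at t)"
proof -
  consider "t > 0" | "t < 0" | "t = 0" by linarith
  then show ?thesis
  proof cases
    case 1
    have "((\<lambda>t. exp (- inverse t) * inverse t ^ n) has_real_derivative
        exp (- inverse t) * inverse t ^ 2 * inverse t ^ n
        + real n * (inverse t ^ (n - 1) * (- (inverse t ^ 2))) * exp (- inverse t)) (at t)"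
      using 1 by (auto intro!: derivative_eq_intros simp: power2_eq_square)
    also have "exp (- inverse t) * inverse t ^ 2 * inverse t ^ n
        + real n * (inverse t ^ (n - 1) * (- (inverse t ^ 2))) * exp (- inverse t)
        = flat_exp (n + 2) t - real n * flat_exp (n + 1) t"
      using 1 by (cases n) (simp_all add: flat_exp_def field_simps power2_eq_square)
    finally have "((\<lambda>t. exp (- 1 / t) / t ^ n) has_real_derivative
        flat_exp (n + 2) t - real n * flat_exp (n + 1) t) (at t)"
      by (simp add: field_simps)
    then show ?thesis
      by (rule has_field_derivative_transform_within_open[where S="{0<..}"])
         (use 1 in \<open>auto simp: flat_exp_def\<close>)
  next
    case 2
    have "((\<lambda>t. 0) has_real_derivative flat_exp (n + 2) t - real n * flat_exp (n + 1) t) (at t)"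
      using 2 by (auto simp: flat_exp_def)
    then show ?thesis
      by (rule has_field_derivative_transform_within_open[where S="{..<0}"])
         (use 2 in \<open>auto simp: flat_exp_def\<close>)
  next
    case 3
    \<comment> \<open>The difference quotient of \<open>flat_exp n\<close> at 0 is
      \<open>flat_exp (Suc n)\<close>, since dividing by t raises the index by one.\<close>
    have "(flat_exp n has_real_derivative 0) (at 0)"
      unfolding DERIV_def
      by (rule Lim_transform_eventually[OF flat_exp_tendsto_0[of "Suc n"]])
         (auto simp: flat_exp_def eventually_at_filter)
    then show ?thesis using 3 by (simp add: flat_exp_def)
  qed
qed

text \<open>The prefactor \<open>P\<close> and the index \<open>n\<close> are generalised because a
  derivative is a sum of three products of the same shape, with other prefactors and with the
  indices n, n + 1 and n + 2.\<close>

lemma C_k_flat_exp: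
  fixes P Q :: "real ^ 'd::finite \<Rightarrow> real"
  assumes "\<And>k. P \<in> C_k k" "\<And>k. Q \<in> C_k k"
  shows "(\<lambda>x. P x * flat_exp n (Q x)) \<in> C_k k"
  using assms(1)
proof (induction k arbitrary: P n)
  case 0
  have "continuous_on UNIV (flat_exp n)"
    by (auto intro!: continuous_at_imp_continuous_on DERIV_isCont has_real_derivative_flat_exp)
  then show ?case
    using 0[of 0] assms(2)[of 0] continuous_on_compose2[of UNIV "flat_exp n" UNIV Q]
    by (auto intro!: continuous_intros)
next
  case (Suc k)
  let ?q = "\<lambda>x \<alpha>. (flat_exp (n + 2) (Q x) - real n * flat_exp (n + 1) (Q x)) * pdiff \<alpha> Q x"
  let ?D = "\<lambda>\<alpha> x. pdiff \<alpha> P x * flat_exp n (Q x) + ((P x * pdiff \<alpha> Q x) * flat_exp (n + 2) (Q x)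
             + (- real n * (P x * pdiff \<alpha> Q x)) * flat_exp (n + 1) (Q x))"
  have diff: "P differentiable (at x)" "Q differentiable (at x)" for x
    using Suc.prems[of 1] assms(2)[of 1] by auto
  have Q': "(Q has_derivative frechet_derivative Q (at x)) (at x)" for x
    using diff frechet_derivative_works by blast
  have *: "((\<lambda>x. flat_exp n (Q x)) has_derivative
      (\<lambda>h. frechet_derivative Q (at x) h * (flat_exp (n + 2) (Q x) - real n * flat_exp (n + 1) (Q x)))) (at x)" for x
    using DERIV_compose_FDERIV[OF has_real_derivative_flat_exp Q'[of x]] .
  then have d: "(\<lambda>x. flat_exp n (Q x)) differentiable (at x)" for x
    by (auto simp: differentiable_def)
  have pq: "pdiff \<alpha> (\<lambda>x. flat_exp n (Q x)) x = ?q x \<alpha>" for \<alpha> x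
    using pdiff_eqI[OF *] by (simp add: pdiff_def mult.commute)
  have pd: "pdiff \<alpha> (\<lambda>x. P x * flat_exp n (Q x)) = ?D \<alpha>" for \<alpha>
    unfolding fun_eq_iff bounded_bilinear.pdiff_bilinear[OF bounded_bilinear_mult diff(1) d] pq
    by (simp add: algebra_simps)
  have smooth: "pdiff \<alpha> P \<in> C_k j" "pdiff \<alpha> Q \<in> C_k j" for \<alpha> j
    using Suc.prems[of "Suc j"] assms(2)[of "Suc j"] by auto
  have PQ: "(\<lambda>x. P x * pdiff \<alpha> Q x) \<in> C_k j" for \<alpha> j
    by (intro bounded_bilinear.C_k_bilinear[OF bounded_bilinear_mult] Suc.prems smooth)
  have nPQ: "(\<lambda>x. - real n * (P x * pdiff \<alpha> Q x)) \<in> C_k j" for \<alpha> j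
    by (intro bounded_bilinear.C_k_bilinear[OF bounded_bilinear_mult C_k_const] PQ)
  show ?case
  proof (rule C_k_SucI)
    show "(\<lambda>x. P x * flat_exp n (Q x)) differentiable (at x)" for x
      using diff d by auto
    show "pdiff \<alpha> (\<lambda>x. P x * flat_exp n (Q x)) \<in> C_k k" for \<alpha>
      unfolding pd by (intro C_k_add Suc.IH smooth PQ nPQ)
  qed
qed

text \<open>Vanishing outside some ball is easier to carry through sums, products and substitutions
  than compactness of the closed support.\<close>

lemma test_functions_iff:
  fixes \<phi> :: "real ^ 'd::finite \<Rightarrow> 'b::real_normed_vector"
  shows "\<phi> \<in> test_functions \<longleftrightarrow> (\<forall>k. \<phi> \<in> C_k k) \<and> (\<exists>R. \<forall>x. R < norm x \<longrightarrow> \<phi> x = 0)"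
proof -
  have "compact (closure {x. \<phi> x \<noteq> 0}) \<longleftrightarrow> bounded {x. \<phi> x \<noteq> 0}"
    by simp
  also have "\<dots> \<longleftrightarrow> (\<exists>R. \<forall>x. R < norm x \<longrightarrow> \<phi> x = 0)"
    unfolding bounded_iff by (auto simp: not_less[symmetric]) 
  finally show ?thesis by (auto simp: test_functions_def)
qed

lemma test_functions_C_k: "\<phi> \<in> test_functions \<Longrightarrow> \<phi> \<in> C_k k"
  by (auto simp: test_functions_def)

text \<open>The standard bump exp(-1 / (1 - |x|^2)) on the unit ball, 0 elsewhere. The squared norm
  is spelled out in coordinates so that its smoothness follows from \<open>C_k_nth\<close>.\<close>

definition bump :: "real ^ 'd::finite \<Rightarrow> real"
  where "bump x = flat_exp 0 (1 - (\<Sum>\<alpha>\<in>UNIV. x $ \<alpha> * x $ \<alpha>))"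

lemma bump_eq: "bump x = flat_exp 0 (1 - (norm x)\<^sup>2)"
  by (simp add: bump_def inner_vec_def power2_norm_eq_inner)

lemma bump_C_k: "(bump :: real ^ 'd::finite \<Rightarrow> real) \<in> C_k k"
proof -
  have "(\<lambda>x::real^'d. 1 + (\<Sum>\<alpha>\<in>UNIV. -1 * (x $ \<alpha> * x $ \<alpha>))) \<in> C_k k" for k
    by (intro C_k_add C_k_const C_k_sum bounded_bilinear.C_k_bilinear[OF bounded_bilinear_mult] C_k_nth)
  then have "(\<lambda>x::real^'d. 1 * flat_exp 0 (1 + (\<Sum>\<alpha>\<in>UNIV. -1 * (x $ \<alpha> * x $ \<alpha>)))) \<in> C_k k"
    by (intro C_k_flat_exp C_k_const)
  moreover have "bump = (\<lambda>x::real^'d. 1 * flat_exp 0 (1 + (\<Sum>\<alpha>\<in>UNIV. -1 * (x $ \<alpha> * x $ \<alpha>))))"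
    by (simp add: bump_def fun_eq_iff sum_negf)
  ultimately show ?thesis by (simp only: mult_1)
qed

lemma bump_nonneg: "bump x \<ge> 0"
  by (simp add: bump_def flat_exp_def)

lemma bump_0: "bump 0 > 0"
  by (simp add: bump_def flat_exp_def)

lemma bump_outside: "1 < norm x \<Longrightarrow> bump x = 0"
  by (simp add: bump_eq flat_exp_def not_less)

lemma bump_minus: "bump (- x) = bump x"
  by (simp add: bump_eq)

lemma bump_test: "bump \<in> test_functions"
  using bump_C_k bump_outside by (auto simp: test_functions_iff simp del: C_k.simps)

section \<open>Local integrability and square integrability\<close>

text \<open>\<open>bounded_bilinear\<close> allows arbitrary normed spaces, whereas
  \<open>L1_loc\<close> and \<open>L2\<close> consist of functions with Euclidean values; this
  locale carries the facts on measurability and integrability.\<close>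

locale euclidean_bilinear = bounded_bilinear prod
  for prod :: "'a::euclidean_space \<Rightarrow> 'b::euclidean_space \<Rightarrow> 'c::euclidean_space"

locale euclidean_linear = bounded_linear f
  for f :: "'a::euclidean_space \<Rightarrow> 'b::euclidean_space"

lemma euclidean_bilinear_scaleR: "euclidean_bilinear (scaleR :: real \<Rightarrow> 'a::euclidean_space \<Rightarrow> 'a)"
  by (simp add: euclidean_bilinear_def bounded_bilinear_scaleR)

lemma euclidean_bilinear_inner: "euclidean_bilinear (inner :: 'a::euclidean_space \<Rightarrow> 'a \<Rightarrow> real)"
  by (simp add: euclidean_bilinear_def bounded_bilinear_inner)

lemma (in euclidean_bilinear) euclidean_linear_right: "euclidean_linear (\<lambda>y. prod x y)"
  by (simp add: euclidean_linear_def bounded_linear_right)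

lemma euclidean_linear_vec_nth: "euclidean_linear (\<lambda>x::'a::euclidean_space ^ 'd::finite. x $ \<alpha>)"
  by (simp add: euclidean_linear_def bounded_linear_vec_nth)

lemma continuous_imp_measurable_lebesgue:
  fixes F :: "'a::euclidean_space \<Rightarrow> 'b::euclidean_space"
  assumes "continuous_on UNIV F"
  shows "F \<in> borel_measurable lebesgue"
  using borel_measurable_continuous_onI[OF assms] by (intro measurable_completion) simp

text \<open>Each coordinate is changed on a null set. The Borel version is what Fubini's theorem
  asks for: the product measure is formed from \<open>lborel\<close>, while the functions are only
  Lebesgue measurable.\<close>

lemma ex_borel_representative:
  fixes F :: "'a::euclidean_space \<Rightarrow> 'b::euclidean_space"
  assumes F: "F \<in> borel_measurable lebesgue"
  obtains F' where "F' \<in> borel_measurable borel" "AE x in lebesgue. F x = F' x"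
proof -
  have "\<exists>g\<in>borel_measurable lborel. AE x in lborel. F x \<bullet> b = g x" for b
    using F by (intro completion_ex_borel_measurable_real) auto
  then obtain g where g: "\<And>b. g b \<in> borel_measurable lborel" "\<And>b. AE x in lborel. F x \<bullet> b = g b x"
    by metis
  define F' where "F' x = (\<Sum>b\<in>Basis. g b x *\<^sub>R b)" for x
  have "F' \<in> borel_measurable borel"
    unfolding F'_def using g(1) by (auto intro!: borel_measurable_sum borel_measurable_scaleR)
  moreover have "AE x in lborel. \<forall>b\<in>Basis. F x \<bullet> b = g b x"
    using g(2) by (auto simp: AE_ball_countable countable_finite)
  then have "AE x in lborel. F x = F' x"
  proof eventually_elim
    case (elim x)
    then have "F' x = (\<Sum>b\<in>Basis. (F x \<bullet> b) *\<^sub>R b)" by (simp add: F'_def)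
    then show ?case by (simp add: euclidean_representation)
  qed
  ultimately show ?thesis
    using that AE_completion by blast
qed

lemma (in euclidean_bilinear) borel_measurable_bilinear:
  fixes F :: "'x \<Rightarrow> 'a" and G :: "'x \<Rightarrow> 'b"
  assumes "F \<in> borel_measurable M" "G \<in> borel_measurable M"
  shows "(\<lambda>x. prod (F x) (G x)) \<in> borel_measurable M"
  by (rule borel_measurable_continuous_Pair[OF assms])
     (intro continuous_on continuous_on_fst continuous_on_snd continuous_on_id)

text \<open>Besides the test functions this contains auxiliary kernels that are merely continuous,
  such as the absolute value of a kernel \<open>k\<close>, the square root of that, and
  \<open>norm x\<close> times it.\<close>

definition Cc :: "(real ^ 'd::finite \<Rightarrow> 'b::real_normed_vector) set"
  where "Cc = {\<phi>. continuous_on UNIV \<phi> \<and> (\<exists>R. \<forall>x. R < norm x \<longrightarrow> \<phi> x = 0)}"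

lemma Cc_continuous: "\<phi> \<in> Cc \<Longrightarrow> continuous_on UNIV \<phi>"
  by (simp add: Cc_def)

lemma test_functions_Cc: "\<phi> \<in> test_functions \<Longrightarrow> \<phi> \<in> Cc"
  using C_k_0 test_functions_iff by (auto simp: Cc_def simp del: C_k.simps C_k_0 simp flip: C_k_0)

lemma Cc_boundE:
  assumes "\<phi> \<in> Cc"
  obtains C R where "C \<ge> 0" "R \<ge> 0" "\<And>x. norm (\<phi> x) \<le> C * indicator (cball 0 R) x"
    "\<And>x. norm (\<phi> x) \<le> C"
proof -
  obtain R0 where R0: "\<forall>x. R0 < norm x \<longrightarrow> \<phi> x = 0"
    using assms by (auto simp: Cc_def)
  define R where "R = \<bar>R0\<bar>"
  have R: "R < norm x \<Longrightarrow> \<phi> x = 0" for x using R0 by (auto simp: R_def)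
  have "compact (\<phi> ` cball 0 R)"
    using assms by (intro compact_continuous_image continuous_on_subset[OF Cc_continuous]) auto
  then obtain C where C: "\<And>x. x \<in> cball 0 R \<Longrightarrow> norm (\<phi> x) \<le> C"
    using compact_imp_bounded bounded_iff by (metis imageI)
  have "norm (\<phi> 0) \<le> C" by (rule C) (simp add: R_def)
  then have C0: "C \<ge> 0" using norm_ge_zero order_trans by blast
  have "norm (\<phi> x) \<le> C * indicator (cball 0 R) x" for x
    using C[of x] R[of x] by (auto simp: indicator_def)
  moreover have "norm (\<phi> x) \<le> C" for x
    using C[of x] R[of x] C0 by (cases "R < norm x") auto
  ultimately show ?thesis using that C0 by (metis R_def abs_ge_zero)
qed

lemma (in bounded_bilinear) Cc_bilinear_left:
  assumes "\<phi> \<in> Cc" "continuous_on UNIV F"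
  shows "(\<lambda>x. prod (\<phi> x) (F x)) \<in> Cc"
  using assms by (fastforce simp: Cc_def zero_left zero_right intro: continuous_on)

lemma (in bounded_bilinear) Cc_bilinear_right:
  assumes "\<phi> \<in> Cc" "continuous_on UNIV F"
  shows "(\<lambda>x. prod (F x) (\<phi> x)) \<in> Cc"
  using assms by (fastforce simp: Cc_def zero_left zero_right intro: continuous_on)

lemma Cc_norm: "\<phi> \<in> Cc \<Longrightarrow> (\<lambda>x. norm (\<phi> x)) \<in> Cc"
  by (auto simp: Cc_def intro: continuous_intros)

lemma Cc_affine:
  assumes "\<phi> \<in> Cc" "c \<noteq> 0"
  shows "(\<lambda>x. \<phi> (t + c *\<^sub>R x)) \<in> Cc"
proof -
  obtain R where R: "\<And>x. R < norm x \<Longrightarrow> \<phi> x = 0"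
    using assms by (auto simp: Cc_def)
  have "\<phi> (t + c *\<^sub>R x) = 0" if "(R + norm t) / \<bar>c\<bar> < norm x" for x
  proof (rule R)
    have "R + norm t < norm (c *\<^sub>R x)" using that assms(2) by (simp add: field_simps)
    then show "R < norm (t + c *\<^sub>R x)"
      using norm_triangle_ineq2[of "c *\<^sub>R x" "- t"] by (simp add: add.commute)
  qed
  then show ?thesis
    using assms by (auto simp: Cc_def intro!: continuous_on_compose2[of UNIV \<phi>] continuous_intros)
qed

text \<open>The exterior of the ball is open, so the function agrees with 0 near each of its
  points.\<close>

lemma pdiff_eq_0_outside:
  assumes "\<And>x. R < norm x \<Longrightarrow> \<phi> x = 0" "R < norm x"
  shows "pdiff \<alpha> \<phi> x = 0"
proof -
  have "(\<phi> has_derivative (\<lambda>_. 0)) (at x)"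
  proof (rule has_derivative_transform_within_open[where f="\<lambda>_. 0" and s="{x. R < norm x}"])
    show "open {x::real^'a. R < norm x}" by (intro open_Collect_less continuous_intros)
  qed (use assms in auto)
  then show ?thesis by (simp add: pdiff_eqI)
qed

lemma Cc_pdiff:
  assumes "\<phi> \<in> C_k 1" "\<phi> \<in> Cc"
  shows "pdiff \<alpha> \<phi> \<in> Cc"
proof -
  obtain R where R: "\<And>x. R < norm x \<Longrightarrow> \<phi> x = 0"
    using assms by (auto simp: Cc_def)
  then have "pdiff \<alpha> \<phi> x = 0" if "R < norm x" for x
    using that by (rule pdiff_eq_0_outside)
  then show ?thesis
    using assms(1) by (auto simp: Cc_def)
qed

lemma test_functions_pdiff:
  assumes "\<phi> \<in> test_functions"
  shows "pdiff \<alpha> \<phi> \<in> test_functions"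
proof -
  have "pdiff \<alpha> \<phi> \<in> Cc"
    using assms by (intro Cc_pdiff test_functions_Cc test_functions_C_k)
  then show ?thesis
    using assms C_k_SucD(2)[OF test_functions_C_k[OF assms]] by (auto simp: test_functions_iff Cc_def simp del: C_k.simps)
qed

lemma test_functions_add:
  assumes "\<phi> \<in> test_functions" "\<psi> \<in> test_functions"
  shows "(\<lambda>x. \<phi> x + \<psi> x) \<in> test_functions"
proof -
  obtain R S where "\<And>x. R < norm x \<Longrightarrow> \<phi> x = 0" "\<And>x. S < norm x \<Longrightarrow> \<psi> x = 0"
    using assms by (auto simp: test_functions_iff)
  then have "\<forall>x. max R S < norm x \<longrightarrow> \<phi> x + \<psi> x = 0" by auto
  then show ?thesis
    using assms C_k_add unfolding test_functions_iff by blast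
qed

lemma (in bounded_bilinear) test_functions_bilinear:
  assumes "\<phi> \<in> test_functions" "\<And>k. F \<in> C_k k"
  shows "(\<lambda>x. prod (\<phi> x) (F x)) \<in> test_functions"
  using assms(1) C_k_bilinear[OF _ assms(2)] unfolding test_functions_iff
  by (metis zero_left)

lemma test_functions_cmult:
  assumes "\<phi> \<in> test_functions"
  shows "(\<lambda>x. c *\<^sub>R \<phi> x) \<in> test_functions"
  using assms C_k_scaleR[OF C_k_const] by (auto simp: test_functions_iff simp del: C_k.simps)

lemma test_functions_scaleR_const:
  assumes "\<phi> \<in> test_functions"
  shows "(\<lambda>x. \<phi> x *\<^sub>R c) \<in> test_functions"
  by (rule bounded_bilinear.test_functions_bilinear[OF bounded_bilinear_scaleR assms C_k_const])

lemma test_functions_affine: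
  assumes "\<phi> \<in> test_functions" "c \<noteq> 0"
  shows "(\<lambda>x. \<phi> (t + c *\<^sub>R x)) \<in> test_functions"
  using C_k_affine[OF test_functions_C_k[OF assms(1)]] Cc_affine[OF test_functions_Cc[OF assms(1)] assms(2)]
  by (auto simp: test_functions_iff Cc_def simp del: C_k.simps)

lemma test_functions_reflect:
  assumes "\<phi> \<in> test_functions"
  shows "(\<lambda>y. \<phi> (x - y)) \<in> test_functions"
  using test_functions_affine[OF assms, of "-1" x] by simp

lemma (in bounded_linear) test_functions_linear:
  assumes "\<phi> \<in> test_functions"
  shows "(\<lambda>x. f (\<phi> x)) \<in> test_functions"
  using assms C_k_linear unfolding test_functions_iff by (metis zero)

lemma L1_loc_integrable_indicator:
  assumes "F \<in> L1_loc" "compact K"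
  shows "integrable lebesgue (\<lambda>x. indicator K x *\<^sub>R F x)"
  using assms by (auto simp: L1_loc_def set_integrable_def)

lemma L1_loc_measurable: "F \<in> L1_loc \<Longrightarrow> F \<in> borel_measurable lebesgue"
  by (simp add: L1_loc_def)

text \<open>The compactly supported factor is bounded by a multiple of the indicator of a ball, on
  which \<open>F\<close> is integrable.\<close>

lemma (in euclidean_bilinear) integrable_Cc_L1_loc:
  fixes F :: "real ^ 'd::finite \<Rightarrow> 'b"
  assumes "\<phi> \<in> Cc" "F \<in> L1_loc"
  shows "integrable lebesgue (\<lambda>x. prod (\<phi> x) (F x))"
proof -
  obtain C R where C: "C \<ge> 0" "\<And>x. norm (\<phi> x) \<le> C * indicator (cball 0 R) x"
    using Cc_boundE[OF assms(1)] by metis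
  obtain K where K: "K \<ge> 0" "\<And>a b. norm (prod a b) \<le> norm a * norm b * K"
    using nonneg_bounded by metis
  have "integrable lebesgue (\<lambda>x. (C * K) *\<^sub>R norm (indicator (cball 0 R) x *\<^sub>R F x))"
    by (intro integrable_scaleR_right integrable_norm L1_loc_integrable_indicator assms compact_cball)
  then show ?thesis
  proof (rule Bochner_Integration.integrable_bound)
    show "(\<lambda>x. prod (\<phi> x) (F x)) \<in> borel_measurable lebesgue"
      using assms by (intro borel_measurable_bilinear continuous_imp_measurable_lebesgue
          L1_loc_measurable Cc_continuous)
    show "AE x in lebesgue. norm (prod (\<phi> x) (F x)) \<le> norm ((C * K) *\<^sub>R norm (indicator (cball 0 R) x *\<^sub>R F x))"
    proof (intro AE_I2)
      fix x
      have "norm (prod (\<phi> x) (F x)) \<le> norm (\<phi> x) * norm (F x) * K" by (rule K)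
      also have "\<dots> \<le> (C * indicator (cball 0 R) x) * norm (F x) * K"
        using C K by (intro mult_right_mono) auto
      finally show "norm (prod (\<phi> x) (F x)) \<le> norm ((C * K) *\<^sub>R norm (indicator (cball 0 R) x *\<^sub>R F x))"
        using C K by (simp add: mult_ac abs_mult)
    qed
  qed
qed

lemma continuous_imp_L1_loc:
  assumes "continuous_on UNIV F"
  shows "F \<in> L1_loc"
proof -
  have "set_integrable lebesgue K F" if "compact K" for K
  proof -
    have "integrable lborel (\<lambda>x. indicator K x *\<^sub>R F x)"
      using that assms by (intro borel_integrable_compact) (auto intro: continuous_on_subset)
    then show ?thesis
      unfolding set_integrable_def by (subst integrable_completion) auto
  qed
  then show ?thesis
    by (simp add: L1_loc_def continuous_imp_measurable_lebesgue assms)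
qed

lemma L1_loc_cong_AE:
  assumes "F \<in> L1_loc" "AE x in lebesgue. F x = G x" "G \<in> borel_measurable lebesgue"
  shows "G \<in> L1_loc"
proof -
  have "set_integrable lebesgue K G" if "compact K" for K
  proof -
    have K: "K \<in> sets lebesgue" using that by (simp add: borel_compact)
    have "integrable lebesgue (\<lambda>x. indicator K x *\<^sub>R F x)"
      by (rule L1_loc_integrable_indicator[OF assms(1) that])
    then show ?thesis
      unfolding set_integrable_def
      by (rule integrable_cong_AE_imp) (use assms K in \<open>auto elim: eventually_mono\<close>)
  qed
  then show ?thesis using assms(3) by (simp add: L1_loc_def)
qed

lemma (in euclidean_bilinear) L1_loc_bilinear:
  fixes F :: "real ^ 'd::finite \<Rightarrow> 'b" and A :: "real ^ 'd::finite \<Rightarrow> 'a"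
  assumes "continuous_on UNIV A" "F \<in> L1_loc"
  shows "(\<lambda>x. prod (A x) (F x)) \<in> L1_loc"
proof -
  have m: "(\<lambda>x. prod (A x) (F x)) \<in> borel_measurable lebesgue"
    using assms by (intro borel_measurable_bilinear continuous_imp_measurable_lebesgue L1_loc_measurable)
  have "set_integrable lebesgue S (\<lambda>x. prod (A x) (F x))" if S: "compact S" for S
  proof -
    have "bounded (A ` S)"
      using S assms(1) by (intro compact_imp_bounded compact_continuous_image) (auto intro: continuous_on_subset)
    then obtain C where C: "C > 0" "\<And>x. x \<in> S \<Longrightarrow> norm (A x) \<le> C"
      by (metis bounded_pos imageI)
    obtain K where K: "K \<ge> 0" "\<And>a b. norm (prod a b) \<le> norm a * norm b * K"
      using nonneg_bounded by metis
    have "integrable lebesgue (\<lambda>x. (C * K) *\<^sub>R norm (indicator S x *\<^sub>R F x))"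
      by (intro integrable_scaleR_right integrable_norm L1_loc_integrable_indicator assms S)
    then show ?thesis
      unfolding set_integrable_def
    proof (rule Bochner_Integration.integrable_bound)
      have "S \<in> sets lebesgue" using S by (simp add: borel_compact)
      then show "(\<lambda>x. indicat_real S x *\<^sub>R prod (A x) (F x)) \<in> borel_measurable lebesgue"
        using m by auto
      show "AE x in lebesgue. norm (indicat_real S x *\<^sub>R prod (A x) (F x))
           \<le> norm ((C * K) *\<^sub>R norm (indicat_real S x *\<^sub>R F x))"
      proof (intro AE_I2)
        fix x
        have "norm (prod (A x) (F x)) \<le> C * norm (F x) * K" if "x \<in> S"
          using order_trans[OF K(2) mult_right_mono[OF mult_right_mono[OF C(2)[OF that]]]] K(1) by simp
        then show "norm (indicat_real S x *\<^sub>R prod (A x) (F x))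
           \<le> norm ((C * K) *\<^sub>R norm (indicat_real S x *\<^sub>R F x))"
          using C K by (auto simp: indicator_def mult_ac abs_mult)
      qed
    qed
  qed
  then show ?thesis using m by (simp add: L1_loc_def)
qed

lemma L1_loc_add: "F \<in> L1_loc \<Longrightarrow> G \<in> L1_loc \<Longrightarrow> (\<lambda>x. F x + G x) \<in> L1_loc"
  by (auto simp: L1_loc_def intro: set_integral_add)

lemma (in euclidean_linear) L1_loc_linear:
  assumes "F \<in> L1_loc"
  shows "(\<lambda>x. f (F x)) \<in> L1_loc"
proof -
  have "f \<in> borel_measurable borel"
    by (intro borel_measurable_continuous_onI linear_continuous_on bounded_linear)
  then have "(\<lambda>x. f (F x)) \<in> borel_measurable lebesgue"
    using L1_loc_measurable[OF assms(1)] by measurable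
  moreover have "set_integrable lebesgue K (\<lambda>x. f (F x))" if "compact K" for K
    using integrable_bounded_linear[OF bounded_linear L1_loc_integrable_indicator[OF assms(1) that]]
    by (simp add: set_integrable_def scaleR)
  ultimately show ?thesis by (simp add: L1_loc_def)
qed

section \<open>Square integrable functions: Cauchy-Schwarz inequality, norm and completeness\<close>

lemma L2_measurable: "F \<in> L2 \<Longrightarrow> F \<in> borel_measurable lebesgue"
  by (simp add: L2_def)

lemma L2_integrable_power2: "F \<in> L2 \<Longrightarrow> integrable lebesgue (\<lambda>x. (norm (F x))\<^sup>2)"
  by (simp add: L2_def)

lemma norm_L2_nonneg [simp]: "0 \<le> norm_L2 F"
  by (simp add: norm_L2_def)

lemma norm_L2_power2: "(norm_L2 F)\<^sup>2 = (\<integral>x. (norm (F x))\<^sup>2 \<partial>lebesgue)"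
  by (simp add: norm_L2_def)

lemma L2_bound:
  assumes "F \<in> borel_measurable lebesgue" "G \<in> L2" "c \<ge> 0"
    and "AE x in lebesgue. norm (F x) \<le> c * norm (G x)"
  shows "F \<in> L2" "norm_L2 F \<le> c * norm_L2 G"
proof -
  have le: "AE x in lebesgue. (norm (F x))\<^sup>2 \<le> c\<^sup>2 * (norm (G x))\<^sup>2"
    using assms(4) by eventually_elim (metis norm_ge_zero power_mono power_mult_distrib)
  have G: "integrable lebesgue (\<lambda>x. c\<^sup>2 * (norm (G x))\<^sup>2)"
    using assms(2) by (intro integrable_mult_right L2_integrable_power2)
  have F: "integrable lebesgue (\<lambda>x. (norm (F x))\<^sup>2)"
    by (rule Bochner_Integration.integrable_bound[OF G])
       (use assms(1) le in \<open>auto elim!: eventually_mono\<close>)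
  then show "F \<in> L2" using assms(1) by (simp add: L2_def)
  have "(norm_L2 F)\<^sup>2 \<le> (\<integral>x. c\<^sup>2 * (norm (G x))\<^sup>2 \<partial>lebesgue)"
    unfolding norm_L2_power2 by (rule integral_mono_AE[OF F G le])
  also have "\<dots> = (c * norm_L2 G)\<^sup>2"
    by (simp add: norm_L2_power2 power_mult_distrib)
  finally show "norm_L2 F \<le> c * norm_L2 G"
    by (rule power2_le_imp_le) (simp add: assms)
qed

lemma L2_cong_AE:
  assumes "F \<in> L2" "AE x in lebesgue. F x = G x" "G \<in> borel_measurable lebesgue"
  shows "G \<in> L2" "norm_L2 G = norm_L2 F"
proof -
  have ae: "AE x in lebesgue. norm (G x) \<le> 1 * norm (F x)" "AE x in lebesgue. norm (F x) \<le> 1 * norm (G x)"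
    using assms(2) by (auto elim!: eventually_mono)
  show "G \<in> L2" by (rule L2_bound[OF assms(3,1) _ ae(1)]) simp
  with L2_bound(2)[OF assms(3,1) _ ae(1)] L2_bound(2)[OF L2_measurable[OF assms(1)] _ _ ae(2)]
  show "norm_L2 G = norm_L2 F" by simp
qed

lemma L2_norm_mult_integrable:
  assumes "F \<in> L2" "G \<in> L2"
  shows "integrable lebesgue (\<lambda>x. norm (F x) * norm (G x))"
proof (rule Bochner_Integration.integrable_bound)
  show "integrable lebesgue (\<lambda>x. (norm (F x))\<^sup>2 + (norm (G x))\<^sup>2)"
    using assms by (intro Bochner_Integration.integrable_add L2_integrable_power2)
  show "(\<lambda>x. norm (F x) * norm (G x)) \<in> borel_measurable lebesgue"
    using assms[THEN L2_measurable] by measurable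
  have "a * b \<le> a\<^sup>2 + b\<^sup>2" if "a \<ge> 0" "b \<ge> 0" for a b :: real
    using sum_squares_bound[of a b] mult_nonneg_nonneg[OF that] by simp
  then show "AE x in lebesgue. norm (norm (F x) * norm (G x)) \<le> norm ((norm (F x))\<^sup>2 + (norm (G x))\<^sup>2)"
    by auto
qed

text \<open>With p and q the two norms, the integral of (q |F| - p |G|)^2 is nonnegative, and after
  expansion pq can be divided out. If p or q vanishes, that function is zero almost everywhere, and
  so is the product.\<close>

lemma L2_Cauchy_Schwarz:
  assumes "F \<in> L2" "G \<in> L2"
  shows "(\<integral>x. norm (F x) * norm (G x) \<partial>lebesgue) \<le> norm_L2 F * norm_L2 G"
proof -
  let ?I = "\<integral>x. norm (F x) * norm (G x) \<partial>lebesgue"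
  note int = L2_integrable_power2[OF assms(1)] L2_integrable_power2[OF assms(2)]
    L2_norm_mult_integrable[OF assms]
  define p q where "p = norm_L2 F" and "q = norm_L2 G"
  have pq: "p \<ge> 0" "q \<ge> 0" by (auto simp: p_def q_def)
  have zero: "AE x in lebesgue. H x = 0" if "H \<in> L2" "norm_L2 H = 0" for H :: "real ^ 'x::finite \<Rightarrow> 'y::euclidean_space"
  proof -
    have "(\<integral>x. (norm (H x))\<^sup>2 \<partial>lebesgue) = 0"
      using that(2) norm_L2_power2[of H] by simp
    then show ?thesis
      using L2_integrable_power2[OF that(1)] by (subst (asm) integral_nonneg_eq_0_iff_AE) auto
  qed
  show ?thesis
  proof (cases "p = 0 \<or> q = 0")
    case True
    then have "AE x in lebesgue. norm (F x) * norm (G x) = 0"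
      using zero[OF assms(1)] zero[OF assms(2)] by (auto simp: p_def q_def elim!: eventually_mono)
    then have "?I = 0"
      by (simp add: integral_eq_zero_AE)
    then show ?thesis by simp
  next
    case False
    then have pos: "p * q > 0" using pq by auto
    have "0 \<le> (\<integral>x. (q * norm (F x) - p * norm (G x))\<^sup>2 \<partial>lebesgue)"
      by simp
    also have "\<dots> = (\<integral>x. q\<^sup>2 * (norm (F x))\<^sup>2 + p\<^sup>2 * (norm (G x))\<^sup>2 - (2 * p * q) * (norm (F x) * norm (G x)) \<partial>lebesgue)"
      by (intro arg_cong[where f="integral\<^sup>L lebesgue"] ext) (simp add: power2_eq_square algebra_simps)
    also have "\<dots> = q\<^sup>2 * p\<^sup>2 + p\<^sup>2 * q\<^sup>2 - (2 * p * q) * ?I"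
      using int by (simp add: p_def q_def norm_L2_power2)
    finally have "(p * q) * ?I \<le> (p * q) * (p * q)"
      by (simp add: power2_eq_square algebra_simps)
    then have "?I \<le> p * q" using pos mult_le_cancel_left_pos by blast
    then show ?thesis by (simp add: p_def q_def)
  qed
qed

lemma (in euclidean_bilinear) L2_bilinear_integrable:
  fixes F :: "real ^ 'd::finite \<Rightarrow> 'a"
  assumes "F \<in> L2" "G \<in> L2"
  shows "integrable lebesgue (\<lambda>x. prod (F x) (G x))"
proof -
  obtain K where K: "K \<ge> 0" "\<And>a b. norm (prod a b) \<le> norm a * norm b * K"
    using nonneg_bounded by metis
  have "integrable lebesgue (\<lambda>x. norm (F x) * norm (G x) * K)"
    using L2_norm_mult_integrable[OF assms] by simp
  then show ?thesis
  proof (rule Bochner_Integration.integrable_bound)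
    show "(\<lambda>x. prod (F x) (G x)) \<in> borel_measurable lebesgue"
      by (rule borel_measurable_bilinear[OF assms[THEN L2_measurable]])
    show "AE x in lebesgue. norm (prod (F x) (G x)) \<le> norm (norm (F x) * norm (G x) * K)"
      using K by (simp add: abs_mult)
  qed
qed

definition ip_L2 :: "(real ^ 'd::finite \<Rightarrow> 'b::euclidean_space) \<Rightarrow> (real ^ 'd \<Rightarrow> 'b) \<Rightarrow> real"
  where "ip_L2 F G = (\<integral>x. F x \<bullet> G x \<partial>lebesgue)"

lemmas L2_inner_integrable = euclidean_bilinear.L2_bilinear_integrable[OF euclidean_bilinear_inner]

lemma abs_ip_L2_le:
  assumes "F \<in> L2" "G \<in> L2"
  shows "\<bar>ip_L2 F G\<bar> \<le> norm_L2 F * norm_L2 G"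
proof -
  have "\<bar>ip_L2 F G\<bar> \<le> (\<integral>x. \<bar>F x \<bullet> G x\<bar> \<partial>lebesgue)"
    unfolding ip_L2_def by (rule integral_abs_bound)
  also have "\<dots> \<le> (\<integral>x. norm (F x) * norm (G x) \<partial>lebesgue)"
    using assms by (intro integral_mono integrable_abs L2_inner_integrable L2_norm_mult_integrable Cauchy_Schwarz_ineq2)
  also have "\<dots> \<le> norm_L2 F * norm_L2 G"
    by (rule L2_Cauchy_Schwarz[OF assms])
  finally show ?thesis .
qed

lemma ip_L2_self: "ip_L2 F F = (norm_L2 F)\<^sup>2"
  by (simp add: ip_L2_def norm_L2_power2 power2_norm_eq_inner)

lemma ip_L2_commute: "ip_L2 F G = ip_L2 G F"
  by (simp add: ip_L2_def inner_commute)

lemma L2_scaleR: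
  assumes "F \<in> L2"
  shows "(\<lambda>x. c *\<^sub>R F x) \<in> L2" "norm_L2 (\<lambda>x. c *\<^sub>R F x) = \<bar>c\<bar> * norm_L2 F"
  using assms by (auto simp: L2_def norm_L2_def power_mult_distrib real_sqrt_mult)

lemma L2_add:
  assumes "F \<in> L2" "G \<in> L2"
  shows "(\<lambda>x. F x + G x) \<in> L2"
proof -
  have "integrable lebesgue (\<lambda>x. (norm (F x + G x))\<^sup>2)"
  proof (rule Bochner_Integration.integrable_bound)
    show "integrable lebesgue (\<lambda>x. 2 * (norm (F x))\<^sup>2 + 2 * (norm (G x))\<^sup>2)"
      using assms by (intro Bochner_Integration.integrable_add integrable_mult_right L2_integrable_power2)
    show "(\<lambda>x. (norm (F x + G x))\<^sup>2) \<in> borel_measurable lebesgue"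
      using assms[THEN L2_measurable] by measurable
    have "(norm (a + b))\<^sup>2 \<le> 2 * (norm a)\<^sup>2 + 2 * (norm b)\<^sup>2" for a b :: 'b
    proof -
      have "(norm (a + b))\<^sup>2 \<le> (norm a + norm b)\<^sup>2"
        by (intro power_mono norm_triangle_ineq) simp
      also have "\<dots> \<le> 2 * (norm a)\<^sup>2 + 2 * (norm b)\<^sup>2"
        using sum_squares_bound[of "norm a" "norm b"] by (simp add: power2_sum)
      finally show ?thesis .
    qed
    then show "AE x in lebesgue. norm ((norm (F x + G x))\<^sup>2) \<le> norm (2 * (norm (F x))\<^sup>2 + 2 * (norm (G x))\<^sup>2)"
      by auto
  qed
  then show ?thesis using assms by (auto simp: L2_def)
qed

lemma L2_diff: "F \<in> L2 \<Longrightarrow> G \<in> L2 \<Longrightarrow> (\<lambda>x. F x - G x) \<in> L2"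
  using L2_add[OF _ L2_scaleR(1)[of G "-1"], of F] by simp

lemma L2_zero: "(\<lambda>x. 0) \<in> L2" "norm_L2 (\<lambda>x. 0) = 0"
  by (auto simp: L2_def norm_L2_def)

lemma L2_sum: "(\<And>i. i \<in> I \<Longrightarrow> F i \<in> L2) \<Longrightarrow> (\<lambda>x. \<Sum>i\<in>I. F i x) \<in> L2"
  by (induction I rule: infinite_finite_induct) (auto intro: L2_add L2_zero)

lemma ip_L2_add_left:
  "F \<in> L2 \<Longrightarrow> G \<in> L2 \<Longrightarrow> H \<in> L2 \<Longrightarrow> ip_L2 (\<lambda>x. F x + G x) H = ip_L2 F H + ip_L2 G H"
  by (simp add: ip_L2_def inner_add_left L2_inner_integrable)

lemma ip_L2_scaleR_right: "ip_L2 F (\<lambda>x. c *\<^sub>R H x) = c * ip_L2 F H"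
  by (simp add: ip_L2_def)

lemma ip_L2_add_right:
  "F \<in> L2 \<Longrightarrow> G \<in> L2 \<Longrightarrow> H \<in> L2 \<Longrightarrow> ip_L2 H (\<lambda>x. F x + G x) = ip_L2 H F + ip_L2 H G"
  using ip_L2_add_left[of F G H] by (simp add: ip_L2_commute)

lemma ip_L2_diff_right:
  "F \<in> L2 \<Longrightarrow> G \<in> L2 \<Longrightarrow> H \<in> L2 \<Longrightarrow> ip_L2 H (\<lambda>x. F x - G x) = ip_L2 H F - ip_L2 H G"
  by (simp add: ip_L2_def inner_diff_right L2_inner_integrable)

lemma norm_L2_add_power2:
  assumes "F \<in> L2" "G \<in> L2"
  shows "(norm_L2 (\<lambda>x. F x + G x))\<^sup>2 = (norm_L2 F)\<^sup>2 + 2 * ip_L2 F G + (norm_L2 G)\<^sup>2"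
  using assms by (simp add: ip_L2_add_left ip_L2_add_right L2_add ip_L2_commute[of G F] flip: ip_L2_self)

lemma norm_L2_triangle:
  assumes "F \<in> L2" "G \<in> L2"
  shows "norm_L2 (\<lambda>x. F x + G x) \<le> norm_L2 F + norm_L2 G"
proof (rule power2_le_imp_le)
  show "(norm_L2 (\<lambda>x. F x + G x))\<^sup>2 \<le> (norm_L2 F + norm_L2 G)\<^sup>2"
    using abs_ip_L2_le[OF assms] by (simp add: norm_L2_add_power2[OF assms] power2_sum)
qed simp

lemma norm_L2_minus: "norm_L2 (\<lambda>x. G x - F x) = norm_L2 (\<lambda>x. F x - G x)"
  by (simp add: norm_L2_def norm_minus_commute)

lemma norm_L2_diff_ge:
  assumes "F \<in> L2" "G \<in> L2"
  shows "\<bar>norm_L2 F - norm_L2 G\<bar> \<le> norm_L2 (\<lambda>x. F x - G x)"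
  using norm_L2_triangle[OF L2_diff[OF assms] assms(2)]
    norm_L2_triangle[OF L2_diff[OF assms(2,1)] assms(1)] norm_L2_minus[of G F] by simp

lemma norm_L2_sum:
  assumes "\<And>i. i \<in> I \<Longrightarrow> F i \<in> L2"
  shows "norm_L2 (\<lambda>x. \<Sum>i\<in>I. F i x) \<le> (\<Sum>i\<in>I. norm_L2 (F i))"
  using assms
proof (induction I rule: infinite_finite_induct)
  case (insert i I)
  then show ?case
    using norm_L2_triangle[of "F i" "\<lambda>x. \<Sum>i\<in>I. F i x"] L2_sum[of I F] by force
qed (auto simp: L2_zero)

lemma nn_integral_L2:
  assumes "F \<in> L2"
  shows "(\<integral>\<^sup>+x. ennreal ((norm (F x))\<^sup>2) \<partial>lebesgue) = ennreal ((norm_L2 F)\<^sup>2)"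
  unfolding norm_L2_power2
  by (rule nn_integral_eq_integral[OF L2_integrable_power2[OF assms]]) simp

lemma L2_nn_integralI:
  assumes "F \<in> borel_measurable lebesgue" "(\<integral>\<^sup>+x. ennreal ((norm (F x))\<^sup>2) \<partial>lebesgue) \<le> ennreal (B\<^sup>2)" "B \<ge> 0"
  shows "F \<in> L2" "norm_L2 F \<le> B"
proof -
  have "(\<integral>\<^sup>+x. ennreal (norm ((norm (F x))\<^sup>2)) \<partial>lebesgue) < \<infinity>"
    using assms(2) le_less_trans by fastforce
  then show F: "F \<in> L2"
    using assms(1) by (auto simp: L2_def integrable_iff_bounded)
  have "ennreal ((norm_L2 F)\<^sup>2) \<le> ennreal (B\<^sup>2)"
    using nn_integral_L2[OF F] assms(2) by simp
  then show "norm_L2 F \<le> B"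
    using assms(3) by (auto intro: power2_le_imp_le)
qed

text \<open>Fatou's lemma for the squared norms: the \<open>L2\<close> norm is lower semicontinuous
  under almost everywhere convergence.\<close>

lemma L2_Fatou:
  assumes "\<And>n. F n \<in> L2" "\<And>n. norm_L2 (F n) \<le> B" "H \<in> borel_measurable lebesgue"
    and "AE x in lebesgue. (\<lambda>n. F n x) \<longlonglongrightarrow> H x"
  shows "H \<in> L2" "norm_L2 H \<le> B"
proof -
  have B: "B \<ge> 0" using assms(2)[of 0] norm_L2_nonneg order_trans by blast
  have "AE x in lebesgue. ennreal ((norm (H x))\<^sup>2) = liminf (\<lambda>n. ennreal ((norm (F n x))\<^sup>2))"
    using assms(4)
  proof eventually_elim
    case (elim x)
    have "(\<lambda>n. ennreal ((norm (F n x))\<^sup>2)) \<longlonglongrightarrow> ennreal ((norm (H x))\<^sup>2)"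
      by (intro tendsto_ennrealI tendsto_intros elim)
    then show ?case by (intro lim_imp_Liminf[symmetric]) auto
  qed
  then have "(\<integral>\<^sup>+x. ennreal ((norm (H x))\<^sup>2) \<partial>lebesgue)
      = (\<integral>\<^sup>+x. liminf (\<lambda>n. ennreal ((norm (F n x))\<^sup>2)) \<partial>lebesgue)"
    by (rule nn_integral_cong_AE)
  also have "\<dots> \<le> liminf (\<lambda>n. \<integral>\<^sup>+x. ennreal ((norm (F n x))\<^sup>2) \<partial>lebesgue)"
    using assms(1)[THEN L2_measurable] by (intro nn_integral_liminf) measurable
  also have "\<dots> \<le> ennreal (B\<^sup>2)"
    using assms(1,2) by (intro Liminf_le) (auto simp: nn_integral_L2 intro!: always_eventually ennreal_leI power_mono)
  finally show "H \<in> L2" "norm_L2 H \<le> B"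
    using L2_nn_integralI[OF assms(3) _ B] by auto
qed

text \<open>The squared increments have integrals of order 16^(-n), so they remain summable after
  multiplication by 4^n. Where the weighted series has a finite sum \<open>H\<close>, the increments
  are at most sqrt H times 2^(-n), and the telescoping series converges absolutely.\<close>

lemma AE_convergent_if_fast_Cauchy_L2:
  fixes F :: "nat \<Rightarrow> real ^ 'd::finite \<Rightarrow> 'b::euclidean_space"
  assumes "\<And>n. F n \<in> L2" "\<And>n. norm_L2 (\<lambda>x. F (Suc n) x - F n x) \<le> C * (1/4) ^ n"
  shows "AE x in lebesgue. convergent (\<lambda>n. F n x)"
proof -
  define h where "h n x = 4 ^ n * (norm (F (Suc n) x - F n x))\<^sup>2" for n x
  have D: "(\<lambda>x. F (Suc n) x - F n x) \<in> L2" for n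
    by (intro L2_diff assms)
  have int: "(\<integral>\<^sup>+x. ennreal (h n x) \<partial>lebesgue) \<le> ennreal (C\<^sup>2 * (1/4) ^ n)" for n
  proof -
    have "(\<integral>\<^sup>+x. ennreal (h n x) \<partial>lebesgue) = ennreal (4 ^ n) * (\<integral>\<^sup>+x. ennreal ((norm (F (Suc n) x - F n x))\<^sup>2) \<partial>lebesgue)"
      unfolding h_def using D[of n, THEN L2_measurable]
      by (subst nn_integral_cmult[symmetric]) (auto simp: ennreal_mult)
    also have "\<dots> = ennreal (4 ^ n * (norm_L2 (\<lambda>x. F (Suc n) x - F n x))\<^sup>2)"
      by (simp add: nn_integral_L2[OF D] ennreal_mult)
    also have "\<dots> \<le> ennreal (4 ^ n * (C * (1/4) ^ n)\<^sup>2)"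
      by (intro ennreal_leI mult_left_mono power_mono assms) auto
    also have "4 ^ n * (C * (1/4) ^ n)\<^sup>2 = C\<^sup>2 * (1/4) ^ n"
      by (simp add: power_mult_distrib power_divide field_simps power2_eq_square)
    finally show ?thesis .
  qed
  have meas: "(\<lambda>x. ennreal (h n x)) \<in> borel_measurable lebesgue" for n
    unfolding h_def using assms(1)[THEN L2_measurable] by measurable
  have "(\<integral>\<^sup>+x. (\<Sum>n. ennreal (h n x)) \<partial>lebesgue) = (\<Sum>n. \<integral>\<^sup>+x. ennreal (h n x) \<partial>lebesgue)"
    by (rule nn_integral_suminf[OF meas])
  also have "\<dots> \<le> (\<Sum>n. ennreal (C\<^sup>2 * (1/4) ^ n))"
    by (intro suminf_le int) auto
  also have "\<dots> = ennreal (\<Sum>n. C\<^sup>2 * (1/4) ^ n)"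
    by (intro suminf_ennreal2 summable_mult summable_geometric) auto
  also have "\<dots> < \<infinity>" by simp
  finally have "AE x in lebesgue. (\<Sum>n. ennreal (h n x)) \<noteq> \<infinity>"
    using meas by (intro nn_integral_PInf_AE) auto
  then show ?thesis
  proof eventually_elim
    case (elim x)
    obtain H where H: "(\<Sum>n. ennreal (h n x)) = ennreal H" "H \<ge> 0"
      using elim by (cases "\<Sum>n. ennreal (h n x)") auto
    have bd: "norm (F (Suc n) x - F n x) \<le> sqrt H * (1/2) ^ n" for n
    proof (rule power2_le_imp_le)
      have "ennreal (h n x) \<le> ennreal H"
        unfolding H(1)[symmetric] using sum_le_suminf[of "\<lambda>n. ennreal (h n x)" "{n}"] by auto
      then have "h n x \<le> H" using H(2) by simp
      then have "(norm (F (Suc n) x - F n x))\<^sup>2 \<le> H * (1/4) ^ n"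
        by (simp add: h_def field_simps)
      also have "\<dots> = (sqrt H * (1/2) ^ n)\<^sup>2"
      proof -
        have "(1/4 :: real) ^ n = ((1/2)\<^sup>2) ^ n"
          by (simp add: power2_eq_square)
        also have "\<dots> = ((1/2) ^ n)\<^sup>2"
          by (simp only: power_mult[symmetric] mult.commute)
        finally show ?thesis using H(2) by (simp only: power_mult_distrib real_sqrt_pow2)
      qed
      finally show "(norm (F (Suc n) x - F n x))\<^sup>2 \<le> (sqrt H * (1/2) ^ n)\<^sup>2" .
    qed (use H in simp)
    have sm: "summable (\<lambda>n. sqrt H * (1/2 :: real) ^ n)"
      by (intro summable_mult summable_geometric) simp
    have "summable (\<lambda>n. F (Suc n) x - F n x)"
      by (rule summable_comparison_test'[OF sm bd])
    then have "convergent (\<lambda>n. \<Sum>i<n. F (Suc i) x - F i x)"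
      by (simp add: summable_iff_convergent)
    then have "convergent (\<lambda>n. F n x - F 0 x)"
      using sum_lessThan_telescope[of "\<lambda>n. F n x"] by simp
    then have "convergent (\<lambda>n. (F n x - F 0 x) + F 0 x)"
      by (intro convergent_add convergent_const)
    then show ?case by simp
  qed
qed

text \<open>For geometrically small increments no subsequence has to be extracted: the pointwise
  limit exists, and \<open>L2_Fatou\<close>, applied to \<open>F n - F (m + n)\<close> as m grows,
  turns it into a limit in norm.\<close>

lemma L2_complete:
  fixes F :: "nat \<Rightarrow> real ^ 'd::finite \<Rightarrow> 'b::euclidean_space"
  assumes F: "\<And>n. F n \<in> L2" and C: "\<And>n. norm_L2 (\<lambda>x. F (Suc n) x - F n x) \<le> C * (1/4) ^ n"
  obtains H where "H \<in> L2" "(\<lambda>n. norm_L2 (\<lambda>x. F n x - H x)) \<longlonglongrightarrow> 0"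
proof -
  have C0: "C \<ge> 0" using order_trans[OF norm_L2_nonneg C[of 0]] by simp
  define H where "H x = lim (\<lambda>n. F n x)" for x
  have ae: "AE x in lebesgue. (\<lambda>n. F n x) \<longlonglongrightarrow> H x"
    using AE_convergent_if_fast_Cauchy_L2[OF F C] by eventually_elim (simp add: H_def convergent_LIMSEQ_iff)
  have meas: "H \<in> borel_measurable lebesgue"
    unfolding H_def using F[THEN L2_measurable] by (intro borel_measurable_lim_metric)
  \<comment> \<open>The factor 1 - (1/4)^m lets the induction close, like the closed form of a
    partial geometric sum; the constant 2 is a rounded up 4/3.\<close>
  have tail: "norm_L2 (\<lambda>x. F n x - F (m + n) x) \<le> 2 * C * (1/4) ^ n * (1 - (1/4) ^ m)" for n m
  proof (induction m)
    case (Suc m)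
    have "norm_L2 (\<lambda>x. F n x - F (Suc m + n) x)
        = norm_L2 (\<lambda>x. (F n x - F (m + n) x) + (F (m + n) x - F (Suc (m + n)) x))"
      by simp
    also have "\<dots> \<le> norm_L2 (\<lambda>x. F n x - F (m + n) x) + norm_L2 (\<lambda>x. F (m + n) x - F (Suc (m + n)) x)"
      by (intro norm_L2_triangle L2_diff F)
    also have "\<dots> \<le> 2 * C * (1/4) ^ n * (1 - (1/4) ^ m) + C * (1/4) ^ (m + n)"
      using Suc C[of "m + n"] norm_L2_minus[of "F (Suc (m + n))" "F (m + n)"] by simp
    also have "\<dots> \<le> 2 * C * (1/4) ^ n * (1 - (1/4) ^ Suc m)"
      using C0 by (simp add: power_add field_simps)
    finally show ?case .
  qed (simp add: L2_zero)
  have tail': "norm_L2 (\<lambda>x. F n x - F (m + n) x) \<le> 2 * C * (1/4) ^ n" for n m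
    using C0 by (intro order_trans[OF tail] mult_left_le) auto
  have lim: "AE x in lebesgue. (\<lambda>m. F n x - F (m + n) x) \<longlonglongrightarrow> F n x - H x" for n
    using ae by eventually_elim (intro tendsto_intros LIMSEQ_ignore_initial_segment)
  have Fn: "(\<lambda>x. F n x - H x) \<in> L2" "norm_L2 (\<lambda>x. F n x - H x) \<le> 2 * C * (1/4) ^ n" for n
    using L2_Fatou[where F="\<lambda>m x. F n x - F (m + n) x", OF L2_diff[OF F F] tail' _ lim[of n]]
      meas F[of n, THEN L2_measurable] by auto
  \<comment> \<open>\<open>H\<close> is written as \<open>F 0\<close> minus a difference that is
    already known to be square integrable.\<close>
  have "(\<lambda>x. F 0 x - (F 0 x - H x)) \<in> L2"
    by (intro L2_diff F Fn)
  moreover have "(\<lambda>n. norm_L2 (\<lambda>x. F n x - H x)) \<longlonglongrightarrow> 0"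
  proof (rule tendsto_sandwich[OF _ _ tendsto_const])
    show "(\<lambda>n. 2 * C * (1/4) ^ n) \<longlonglongrightarrow> 0"
      by (intro tendsto_mult_right_zero LIMSEQ_power_zero) simp
  qed (use Fn in auto)
  ultimately show ?thesis using that by simp
qed

lemma Cc_L2: "\<phi> \<in> Cc \<Longrightarrow> \<phi> \<in> L2"
  for \<phi> :: "real ^ 'd::finite \<Rightarrow> 'b::euclidean_space"
  using euclidean_bilinear.integrable_Cc_L1_loc[OF euclidean_bilinear_inner _
      continuous_imp_L1_loc[OF Cc_continuous], of \<phi> \<phi>]
  by (simp add: L2_def continuous_imp_measurable_lebesgue Cc_continuous power2_norm_eq_inner)

lemmas test_functions_L2 = Cc_L2[OF test_functions_Cc]

section \<open>The Riesz representation theorem for functionals on test functions\<close>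

lemma quadratic_nonneg_imp_zero:
  fixes a b :: real
  assumes "b \<ge> 0" "\<And>t. 0 \<le> 2 * t * a + t\<^sup>2 * b"
  shows "a = 0"
proof (rule ccontr)
  assume "a \<noteq> 0"
  \<comment> \<open>The vertex of the parabola lies at -a / b; replacing b by b + 1 avoids a
    division by zero and still gives a negative value.\<close>
  define s t where "s = b + 1" and "t = - a / s"
  have ts: "t * s = - a" using assms(1) by (simp add: t_def s_def)
  have "0 \<le> (2 * t * a + t\<^sup>2 * b) * s\<^sup>2"
    by (intro mult_nonneg_nonneg assms) simp
  also have "\<dots> = 2 * (t * s) * a * s + (t * s)\<^sup>2 * b"
    by (simp add: algebra_simps power2_eq_square)
  also have "\<dots> = - (2 * a\<^sup>2 * (b + 1)) + a\<^sup>2 * b"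
    unfolding ts by (simp add: s_def algebra_simps power2_eq_square)
  also have "\<dots> < 0"
  proof -
    have "0 < a\<^sup>2" "0 \<le> a\<^sup>2 * b" using \<open>a \<noteq> 0\<close> assms(1) by auto
    moreover have "- (2 * a\<^sup>2 * (b + 1)) + a\<^sup>2 * b = - (2 * a\<^sup>2) - a\<^sup>2 * b"
      by (simp add: algebra_simps)
    ultimately show ?thesis by linarith
  qed
  finally show False by simp
qed

text \<open>By the parallelogram identity the left-hand side is the squared distance of two near
  minimisers: \<open>a\<close> and \<open>b\<close> are their values, \<open>c\<close> is the value
  at their midpoint and \<open>m\<close> the infimum.\<close>

lemma near_min_bound:
  fixes a b c m :: real
  assumes "a < m + e" "b < m + e'" "m \<le> c"
  shows "2 * (b + a - 2 * c) \<le> 2 * (e' + e)"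
  using assms by argo

text \<open>The representing function is the \<open>L2\<close>-limit of a minimising sequence of
  \<open>\<parallel>\<phi>\<parallel>\<^sup>2 - 2 T \<phi>\<close>; the parallelogram identity makes that sequence Cauchy.\<close>

lemma L2_riesz_test_functions:
  fixes T :: "(real ^ 'd::finite \<Rightarrow> 'b::euclidean_space) \<Rightarrow> real"
  assumes add: "\<And>\<phi> \<psi>. \<phi> \<in> test_functions \<Longrightarrow> \<psi> \<in> test_functions \<Longrightarrow> T (\<lambda>x. \<phi> x + \<psi> x) = T \<phi> + T \<psi>"
    and scale: "\<And>\<phi> c. \<phi> \<in> test_functions \<Longrightarrow> T (\<lambda>x. c *\<^sub>R \<phi> x) = c * T \<phi>"
    and bound: "\<And>\<phi>. \<phi> \<in> test_functions \<Longrightarrow> \<bar>T \<phi>\<bar> \<le> C * norm_L2 \<phi>"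
    and C: "C \<ge> 0"
  obtains F where "F \<in> L2" "norm_L2 F \<le> C" "\<And>\<phi>. \<phi> \<in> test_functions \<Longrightarrow> T \<phi> = ip_L2 F \<phi>"
proof -
  let ?D = "test_functions :: (real ^ 'd \<Rightarrow> 'b) set"
  define J where "J \<phi> = (norm_L2 \<phi>)\<^sup>2 - 2 * T \<phi>" for \<phi>
  have zero: "(\<lambda>x. 0) \<in> ?D" by (simp add: test_functions_iff C_k_const del: C_k.simps)
  \<comment> \<open>Completing the square: by the bound on \<open>T\<close>, \<open>J \<phi>\<close>
    is at least (|\<phi>| - C)^2 - C^2, with |\<phi>| the \<open>L2\<close> norm.\<close>
  have J_ge: "- C\<^sup>2 \<le> J \<phi>" if "\<phi> \<in> ?D" for \<phi>
    using bound[OF that] zero_le_power2[of "norm_L2 \<phi> - C"] by (simp add: J_def power2_diff algebra_simps)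
  then have bdd: "bdd_below (J ` ?D)" by (intro bdd_belowI2) 
  define m where "m = (INF \<phi>\<in>?D. J \<phi>)"
  have m: "m \<le> J \<phi>" if "\<phi> \<in> ?D" for \<phi>
    unfolding m_def by (rule cINF_lower[OF bdd that])
  \<comment> \<open>Distances enter squared, so the tolerance 16^(-n) yields increments of order
    4^(-n), the rate that \<open>L2_complete\<close> expects.\<close>
  have "\<exists>\<phi>\<in>?D. J \<phi> < m + (1/16) ^ n" for n
    using cINF_less_iff[OF _ bdd, of "m + (1/16) ^ n"] zero by (auto simp: m_def)
  then obtain \<phi> where \<phi>: "\<And>n. \<phi> n \<in> ?D" "\<And>n. J (\<phi> n) < m + (1/16) ^ n"
    by metis
  note \<phi>L2 = test_functions_L2[OF \<phi>(1)]
  have "norm_L2 (\<lambda>x. \<phi> (Suc n) x - \<phi> n x) \<le> 2 * (1/4) ^ n" for n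
  proof (rule power2_le_imp_le)
    let ?a = "\<phi> (Suc n)" and ?b = "\<phi> n"
    let ?h = "\<lambda>x. (1/2) *\<^sub>R (?a x + ?b x)"
    have h: "?h \<in> ?D"
      by (intro test_functions_cmult test_functions_add \<phi>)
    have "J ?h = (1/4) * ((norm_L2 ?a)\<^sup>2 + 2 * ip_L2 ?a ?b + (norm_L2 ?b)\<^sup>2) - (T ?a + T ?b)"
      by (simp add: J_def scale add \<phi> test_functions_add L2_scaleR L2_add \<phi>L2 power_mult_distrib
          norm_L2_add_power2 power_divide add_divide_distrib)
    moreover have "(norm_L2 (\<lambda>x. ?a x - ?b x))\<^sup>2 = (norm_L2 ?a)\<^sup>2 - 2 * ip_L2 ?a ?b + (norm_L2 ?b)\<^sup>2"
      using norm_L2_add_power2[OF \<phi>L2[of "Suc n"] L2_scaleR(1)[OF \<phi>L2[of n], of "-1"]]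
        ip_L2_scaleR_right[of ?a "-1" ?b] L2_scaleR(2)[OF \<phi>L2[of n], of "-1"] by simp
    ultimately have "(norm_L2 (\<lambda>x. ?a x - ?b x))\<^sup>2 = 2 * (J ?a + J ?b - 2 * J ?h)"
      by (simp add: J_def field_simps)
    also have "\<dots> \<le> 2 * ((1/16) ^ Suc n + (1/16) ^ n)"
    proof -
      from near_min_bound[OF \<phi>(2) \<phi>(2) m[OF h]] show ?thesis .
    qed
    also have "\<dots> \<le> 4 * (1/16) ^ n" by simp
    also have "\<dots> = (2 * (1/4) ^ n)\<^sup>2"
      by (simp add: power_mult_distrib power2_eq_square flip: power_mult_distrib)
    finally show "(norm_L2 (\<lambda>x. ?a x - ?b x))\<^sup>2 \<le> (2 * (1/4) ^ n)\<^sup>2" .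
  qed simp
  then obtain F where F: "F \<in> L2" and lim: "(\<lambda>n. norm_L2 (\<lambda>x. \<phi> n x - F x)) \<longlonglongrightarrow> 0"
    using L2_complete[where F=\<phi>, OF \<phi>L2] by blast
  have ip_lim: "(\<lambda>n. ip_L2 G (\<phi> n)) \<longlonglongrightarrow> ip_L2 G F" if G: "G \<in> L2" for G
  proof (rule LIM_zero_cancel, rule tendsto_rabs_zero_cancel, rule tendsto_sandwich[OF _ _ tendsto_const])
    show "\<forall>\<^sub>F n in sequentially. \<bar>ip_L2 G (\<phi> n) - ip_L2 G F\<bar> \<le> norm_L2 G * norm_L2 (\<lambda>x. \<phi> n x - F x)"
      using abs_ip_L2_le[OF G L2_diff[OF \<phi>L2 F]] by (simp add: ip_L2_diff_right G \<phi>L2 F)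
    show "(\<lambda>n. norm_L2 G * norm_L2 (\<lambda>x. \<phi> n x - F x)) \<longlonglongrightarrow> 0"
      by (intro tendsto_mult_right_zero lim)
  qed auto
  have norm_lim: "(\<lambda>n. norm_L2 (\<phi> n)) \<longlonglongrightarrow> norm_L2 F"
  proof (rule LIM_zero_cancel, rule tendsto_rabs_zero_cancel, rule tendsto_sandwich[OF _ _ tendsto_const lim])
    show "\<forall>\<^sub>F n in sequentially. \<bar>norm_L2 (\<phi> n) - norm_L2 F\<bar> \<le> norm_L2 (\<lambda>x. \<phi> n x - F x)"
      using norm_L2_diff_ge[OF \<phi>L2 F] by simp
  qed auto
  have rep: "T \<psi> = ip_L2 F \<psi>" if \<psi>: "\<psi> \<in> ?D" for \<psi>
  proof -
    \<comment> \<open>The Euler-Lagrange argument: a step t \<psi> away from \<phi> n cannot take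
      \<open>J\<close> below its infimum, which \<phi> n attains up to 16^(-n). For fixed t this
      passes to the limit in n.\<close>
    have "0 \<le> 2 * t * (ip_L2 F \<psi> - T \<psi>) + t\<^sup>2 * (norm_L2 \<psi>)\<^sup>2" for t
    proof (rule LIMSEQ_le_const)
      show "(\<lambda>n. 2 * t * (ip_L2 \<psi> (\<phi> n) - T \<psi>) + t\<^sup>2 * (norm_L2 \<psi>)\<^sup>2 + (1/16) ^ n)
          \<longlonglongrightarrow> 2 * t * (ip_L2 F \<psi> - T \<psi>) + t\<^sup>2 * (norm_L2 \<psi>)\<^sup>2"
        unfolding ip_L2_commute[of F]
        by (rule tendsto_eq_rhs, (rule tendsto_intros ip_lim test_functions_L2 \<psi> LIMSEQ_power_zero)+) auto
      have "0 \<le> 2 * t * (ip_L2 \<psi> (\<phi> n) - T \<psi>) + t\<^sup>2 * (norm_L2 \<psi>)\<^sup>2 + (1/16) ^ n" for n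
      proof -
        have t\<psi>: "(\<lambda>x. t *\<^sub>R \<psi> x) \<in> ?D" by (intro test_functions_cmult \<psi>)
        have "m \<le> J (\<lambda>x. \<phi> n x + t *\<^sub>R \<psi> x)"
          by (intro m test_functions_add \<phi> t\<psi>)
        also have "\<dots> = (norm_L2 (\<phi> n))\<^sup>2 + 2 * (t * ip_L2 (\<phi> n) \<psi>) + t\<^sup>2 * (norm_L2 \<psi>)\<^sup>2 - 2 * (T (\<phi> n) + t * T \<psi>)"
          by (simp add: J_def norm_L2_add_power2 \<phi>L2 test_functions_L2 t\<psi> \<phi> add scale \<psi> L2_scaleR
              ip_L2_scaleR_right power_mult_distrib)
        finally show ?thesis
          using \<phi>(2)[of n] ip_L2_commute[of \<psi>] by (simp add: J_def algebra_simps)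
      qed
      then show "\<exists>N. \<forall>n\<ge>N. 0 \<le> 2 * t * (ip_L2 \<psi> (\<phi> n) - T \<psi>) + t\<^sup>2 * (norm_L2 \<psi>)\<^sup>2 + (1/16) ^ n"
        by blast
    qed
    then show ?thesis using quadratic_nonneg_imp_zero[of "(norm_L2 \<psi>)\<^sup>2"] by fastforce
  qed
  \<comment> \<open>The bound on \<open>T\<close> is read along the minimising sequence, where
    \<open>T (\<phi> n)\<close> tends to the squared norm of \<open>F\<close>.\<close>
  have "(norm_L2 F)\<^sup>2 \<le> C * norm_L2 F"
  proof (rule LIMSEQ_le)
    show "(\<lambda>n. ip_L2 F (\<phi> n)) \<longlonglongrightarrow> (norm_L2 F)\<^sup>2"
      using ip_lim[OF F] by (simp add: ip_L2_self)
    show "(\<lambda>n. C * norm_L2 (\<phi> n)) \<longlonglongrightarrow> C * norm_L2 F"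
      by (intro tendsto_intros norm_lim)
    show "\<exists>N. \<forall>n\<ge>N. ip_L2 F (\<phi> n) \<le> C * norm_L2 (\<phi> n)"
      using bound[OF \<phi>(1)] rep[OF \<phi>(1)] by (metis abs_le_D1)
  qed
  then have "norm_L2 F \<le> C"
    using C norm_L2_nonneg[of F] by (cases "norm_L2 F = 0") (auto simp: power2_eq_square mult_le_cancel_right)
  then show ?thesis using that F rep by blast
qed

lemma L2_norm_components:
  fixes F :: "real ^ 'd::finite \<Rightarrow> 'b::euclidean_space ^ 'n::finite"
  assumes "F \<in> L2"
  shows "(\<lambda>x. F x $ i) \<in> L2" "norm_L2 (\<lambda>x. F x $ i) \<le> norm_L2 F"
proof -
  have m: "(\<lambda>x. F x $ i) \<in> borel_measurable lebesgue"
    by (rule measurable_compose[OF L2_measurable[OF assms] borel_measurable_continuous_onI])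
       (intro continuous_intros)
  have n: "AE x in lebesgue. norm (F x $ i) \<le> 1 * norm (F x)"
    by (intro AE_I2) (simp add: Finite_Cartesian_Product.norm_nth_le)
  show "(\<lambda>x. F x $ i) \<in> L2" "norm_L2 (\<lambda>x. F x $ i) \<le> norm_L2 F"
    using L2_bound[OF m assms _ n] by simp_all
qed

section \<open>Convolution and mollification\<close>

lemma nn_integral_affine:
  fixes g :: "'a::euclidean_space \<Rightarrow> ennreal"
  assumes [measurable]: "g \<in> borel_measurable borel" and "c \<noteq> 0"
  shows "(\<integral>\<^sup>+x. g x \<partial>lborel) = ennreal (\<bar>c\<bar> ^ DIM('a)) * (\<integral>\<^sup>+x. g (t + c *\<^sub>R x) \<partial>lborel)"
  by (subst lborel_affine[OF assms(2), of t])
     (simp add: nn_integral_density nn_integral_distr nn_integral_cmult)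

lemma integral_affine:
  fixes g :: "'a::euclidean_space \<Rightarrow> 'b::euclidean_space"
  assumes [measurable]: "g \<in> borel_measurable borel" and "c \<noteq> 0"
  shows "(\<integral>x. g x \<partial>lebesgue) = (\<bar>c\<bar> ^ DIM('a)) *\<^sub>R (\<integral>x. g (t + c *\<^sub>R x) \<partial>lebesgue)"
proof -
  have "(\<integral>x. g x \<partial>lborel) = (\<bar>c\<bar> ^ DIM('a)) *\<^sub>R (\<integral>x. g (t + c *\<^sub>R x) \<partial>lborel)"
    by (subst lborel_affine[OF assms(2), of t]) (simp add: integral_density integral_distr)
  then show ?thesis by (simp add: integral_completion)
qed

lemma integral_reflect:
  fixes g :: "'a::euclidean_space \<Rightarrow> 'b::euclidean_space"
  assumes "g \<in> borel_measurable borel"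
  shows "(\<integral>y. g (x - y) \<partial>lebesgue) = (\<integral>y. g y \<partial>lebesgue)"
  using integral_affine[OF assms, of "-1" x] by simp

lemma Cc_integrable:
  fixes \<phi> :: "real ^ 'd::finite \<Rightarrow> 'b::euclidean_space"
  assumes "\<phi> \<in> Cc"
  shows "integrable lebesgue \<phi>"
  using euclidean_bilinear.integrable_Cc_L1_loc[OF _ assms continuous_imp_L1_loc[of "\<lambda>_. 1::real"],
      of "\<lambda>a r. r *\<^sub>R a"] bounded_bilinear.flip[OF bounded_bilinear_scaleR]
  by (simp add: euclidean_bilinear_def)

section \<open>Integration by parts for functions of class C^1\<close>

lemma C_1_lipschitz:
  fixes F :: "real ^ 'd::finite \<Rightarrow> 'b::real_normed_vector"
  assumes "F \<in> C_k 1" "\<And>\<alpha> x. norm (pdiff \<alpha> F x) \<le> N"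
  shows "norm (F x - F y) \<le> (real CARD('d) * N) * norm (x - y)"
proof (rule differentiable_bound[where S=UNIV and f'="\<lambda>x h. \<Sum>\<alpha>\<in>UNIV. h $ \<alpha> *\<^sub>R pdiff \<alpha> F x"])
  show "(F has_derivative (\<lambda>h. \<Sum>\<alpha>\<in>UNIV. h $ \<alpha> *\<^sub>R pdiff \<alpha> F x)) (at x)" for x
    using assms(1) by (intro has_derivative_pdiff) auto
  have "norm (\<Sum>\<alpha>\<in>UNIV. h $ \<alpha> *\<^sub>R pdiff \<alpha> F x) \<le> (real CARD('d) * N) * norm h" for x h
  proof -
    have "norm (\<Sum>\<alpha>\<in>UNIV. h $ \<alpha> *\<^sub>R pdiff \<alpha> F x) \<le> (\<Sum>\<alpha>\<in>(UNIV::'d set). norm h * N)"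
      by (intro sum_norm_le) (auto intro!: mult_mono assms component_le_norm_cart)
    then show ?thesis by (simp add: mult_ac)
  qed
  then show "onorm (\<lambda>h. \<Sum>\<alpha>\<in>UNIV. h $ \<alpha> *\<^sub>R pdiff \<alpha> F x) \<le> real CARD('d) * N" for x
    by (intro onorm_le)
qed auto

lemma C_1_Cc_lipschitz:
  fixes F :: "real ^ 'd::finite \<Rightarrow> 'b::real_normed_vector"
  assumes "F \<in> C_k 1" "F \<in> Cc"
  obtains L where "L \<ge> 0" "\<And>x y. norm (F x - F y) \<le> L * norm (x - y)"
proof -
  have "\<exists>C. C \<ge> 0 \<and> (\<forall>x. norm (pdiff \<alpha> F x) \<le> C)" for \<alpha>
    using Cc_boundE[OF Cc_pdiff[OF assms, of \<alpha>]] by metis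
  then obtain C where C: "\<And>\<alpha>. C \<alpha> \<ge> 0" "\<And>\<alpha> x. norm (pdiff \<alpha> F x) \<le> C \<alpha>"
    by metis
  have "norm (pdiff \<alpha> F x) \<le> (\<Sum>\<alpha>\<in>UNIV. C \<alpha>)" for \<alpha> x
    using C(2)[of \<alpha> x] member_le_sum[of \<alpha> UNIV C] C(1) by force
  from C_1_lipschitz[OF assms(1) this] show ?thesis
    using that[of "real CARD('d) * (\<Sum>\<alpha>\<in>UNIV. C \<alpha>)"] C(1) by (simp add: sum_nonneg)
qed

text \<open>Dominated convergence is a statement about sequences, so the derivative is read along
  null sequences that avoid 0.\<close>

lemma has_derivative_sequentially:
  assumes "(F has_derivative D) (at x)" "\<And>n. X n \<noteq> 0" "X \<longlonglongrightarrow> 0"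
  shows "(\<lambda>n. (F (x + X n) - F x - D (X n)) /\<^sub>R norm (X n)) \<longlonglongrightarrow> 0"
proof -
  have "((\<lambda>h. norm (F (x + h) - F x - D h) / norm h) \<longlongrightarrow> 0) (at 0)"
    using assms(1) by (simp add: has_derivative_at)
  then have "(\<lambda>n. norm (F (x + X n) - F x - D (X n)) / norm (X n)) \<longlonglongrightarrow> 0"
    using assms(2,3) by (auto simp: tendsto_at_iff_sequentially o_def)
  then show ?thesis
    by (subst tendsto_norm_zero_iff[symmetric]) (simp add: divide_inverse mult.commute)
qed

text \<open>Difference quotients have integral 0 by translation invariance and tend pointwise to the
  partial derivative. They are bounded by the Lipschitz constant, and as the shifts have length at
  most 1 they all vanish outside the ball of radius R + 1.\<close>

lemma integral_pdiff_eq_0: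
  fixes \<psi> :: "real ^ 'd::finite \<Rightarrow> 'b::euclidean_space"
  assumes "\<psi> \<in> C_k 1" "\<psi> \<in> Cc"
  shows "(\<integral>x. pdiff \<alpha> \<psi> x \<partial>lebesgue) = 0"
proof -
  obtain L where L: "L \<ge> 0" "\<And>x y. norm (\<psi> x - \<psi> y) \<le> L * norm (x - y)"
    using C_1_Cc_lipschitz[OF assms] by metis
  obtain R where R: "\<And>x. R < norm x \<Longrightarrow> \<psi> x = 0"
    using assms(2) by (auto simp: Cc_def)
  define h :: "nat \<Rightarrow> real" where "h n = inverse (real (Suc n))" for n
  have h: "h n > 0" "h n \<le> 1" for n by (auto simp: h_def field_simps)
  have hlim: "h \<longlonglongrightarrow> 0" unfolding h_def by (rule LIMSEQ_inverse_real_of_nat)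
  define X where "X n = h n *\<^sub>R (axis \<alpha> 1 :: real ^ 'd)" for n
  have nX: "norm (X n) = h n" for n using h[of n] by (simp add: X_def)
  define D where "D n x = (\<psi> (x + X n) - \<psi> x) /\<^sub>R h n" for n x
  have Cc_shift: "(\<lambda>x. \<psi> (x + X n)) \<in> Cc" for n
    using Cc_affine[OF assms(2), of 1 "X n"] by (simp add: add.commute)
  have "(\<lambda>n. \<integral>x. D n x \<partial>lebesgue) \<longlonglongrightarrow> (\<integral>x. pdiff \<alpha> \<psi> x \<partial>lebesgue)"
  proof (rule integral_dominated_convergence[where w="\<lambda>x. L * indicator (cball 0 (R + 1)) x"])
    show "pdiff \<alpha> \<psi> \<in> borel_measurable lebesgue"
      using assms(1) by (intro continuous_imp_measurable_lebesgue) auto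
    show "D n \<in> borel_measurable lebesgue" for n
      unfolding D_def using Cc_continuous[OF Cc_shift] Cc_continuous[OF assms(2)]
      by (intro continuous_imp_measurable_lebesgue continuous_intros)
    show "integrable lebesgue (\<lambda>x::real^'d. L * indicator (cball 0 (R + 1)) x)"
      by (intro integrable_mult_right integrable_real_indicator) (auto simp: emeasure_bounded_finite[OF bounded_cball, unfolded infinity_ennreal_def])
    show "AE x in lebesgue. (\<lambda>n. D n x) \<longlonglongrightarrow> pdiff \<alpha> \<psi> x"
    proof (intro AE_I2)
      fix x
      let ?D = "frechet_derivative \<psi> (at x)"
      have d: "(\<psi> has_derivative ?D) (at x)"
        using assms(1) frechet_derivative_works by auto
      interpret bounded_linear ?D using d has_derivative_bounded_linear by blast
      have "X \<longlonglongrightarrow> 0" unfolding X_def by (rule tendsto_eq_rhs[OF tendsto_scaleR[OF hlim tendsto_const]]) simp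
      then have "(\<lambda>n. (\<psi> (x + X n) - \<psi> x - ?D (X n)) /\<^sub>R norm (X n)) \<longlonglongrightarrow> 0"
        using h nX by (intro has_derivative_sequentially[OF d]) (metis norm_zero less_irrefl)
      moreover have "(\<psi> (x + X n) - \<psi> x - ?D (X n)) /\<^sub>R norm (X n) = D n x - pdiff \<alpha> \<psi> x" for n
        using h[of n] unfolding nX by (simp add: D_def X_def scaleR pdiff_def scaleR_diff_right)
      ultimately show "(\<lambda>n. D n x) \<longlonglongrightarrow> pdiff \<alpha> \<psi> x"
        using LIM_zero_cancel by simp
    qed
    show "AE x in lebesgue. norm (D n x) \<le> L * indicator (cball 0 (R + 1)) x" for n
    proof (intro AE_I2)
      fix x
      show "norm (D n x) \<le> L * indicator (cball 0 (R + 1)) x"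
      proof (cases "norm x \<le> R + 1")
        case True
        have "norm (D n x) = norm (\<psi> (x + X n) - \<psi> x) / h n"
          using h[of n] by (simp add: D_def divide_inverse mult.commute)
        also have "\<dots> \<le> (L * h n) / h n"
          using L(2)[of "x + X n" x] h[of n] by (intro divide_right_mono) (auto simp: nX)
        finally show ?thesis using True h[of n] by simp
      next
        case False
        then have "R < norm x" "R < norm (x + X n)"
          using h[of n] norm_triangle_ineq2[of x "- X n"] nX[of n] by auto
        then show ?thesis using R L(1) by (simp add: D_def)
      qed
    qed
  qed
  moreover have "(\<integral>x. D n x \<partial>lebesgue) = 0" for n
  proof -
    have "(\<integral>x. \<psi> (x + X n) \<partial>lebesgue) = (\<integral>x. \<psi> x \<partial>lebesgue)"
      using integral_affine[of \<psi> 1 "X n"] borel_measurable_continuous_onI[OF Cc_continuous[OF assms(2)]]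
      by (simp add: add.commute)
    then show ?thesis
      unfolding D_def using Cc_integrable[OF Cc_shift[of n]] Cc_integrable[OF assms(2)] by simp
  qed
  ultimately show ?thesis
    by (simp add: LIMSEQ_const_iff)
qed

text \<open>The product with a test function is of class C^1 with compact support, so its derivative
  has integral 0; the product rule splits that integral.\<close>

lemma C_1_is_weak_pdiff:
  fixes F :: "real ^ 'd::finite \<Rightarrow> 'b::euclidean_space"
  assumes F: "F \<in> C_k 1"
  shows "is_weak_pdiff \<alpha> F (pdiff \<alpha> F)"
proof -
  have cont: "continuous_on UNIV F" "continuous_on UNIV (pdiff \<alpha> F)"
    using F C_k_continuous[OF F] by auto
  have "(\<integral>x. pdiff \<alpha> \<phi> x *\<^sub>R F x \<partial>lebesgue) = - (\<integral>x. \<phi> x *\<^sub>R pdiff \<alpha> F x \<partial>lebesgue)"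
    if \<phi>: "\<phi> \<in> test_functions" for \<phi> :: "real ^ 'd \<Rightarrow> real"
  proof -
    have Cc: "\<phi> \<in> Cc" "pdiff \<alpha> \<phi> \<in> Cc" and C1: "\<phi> \<in> C_k 1"
      using \<phi> test_functions_pdiff test_functions_Cc test_functions_C_k by blast+
    have "(\<lambda>x. \<phi> x *\<^sub>R F x) \<in> C_k 1" "(\<lambda>x. \<phi> x *\<^sub>R F x) \<in> Cc"
      using C_k_scaleR[OF C1 F] bounded_bilinear.Cc_bilinear_left[OF bounded_bilinear_scaleR Cc(1) cont(1)] .
    from integral_pdiff_eq_0[OF this, of \<alpha>]
    have "0 = (\<integral>x. \<phi> x *\<^sub>R pdiff \<alpha> F x + pdiff \<alpha> \<phi> x *\<^sub>R F x \<partial>lebesgue)"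
      using F C1 by (subst (asm) pdiff_scaleR) auto
    also have "\<dots> = (\<integral>x. \<phi> x *\<^sub>R pdiff \<alpha> F x \<partial>lebesgue) + (\<integral>x. pdiff \<alpha> \<phi> x *\<^sub>R F x \<partial>lebesgue)"
      by (intro Bochner_Integration.integral_add euclidean_bilinear.integrable_Cc_L1_loc[OF euclidean_bilinear_scaleR]
          Cc continuous_imp_L1_loc cont)
    finally show ?thesis by (simp add: eq_neg_iff_add_eq_0 add.commute)
  qed
  then show ?thesis
    by (simp add: is_weak_pdiff_def continuous_imp_L1_loc cont)
qed

section \<open>Convolution with a compactly supported kernel\<close>

definition conv :: "(real ^ 'd::finite \<Rightarrow> real) \<Rightarrow> (real ^ 'd \<Rightarrow> 'b::euclidean_space) \<Rightarrow> real ^ 'd \<Rightarrow> 'b"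
  where "conv k F x = (\<integral>y. k (x - y) *\<^sub>R F y \<partial>lebesgue)"

lemma Cc_reflect: "k \<in> Cc \<Longrightarrow> (\<lambda>y. k (x - y)) \<in> Cc"
  using Cc_affine[of k "-1" x] by simp

lemma conv_integrable:
  assumes "k \<in> Cc" "F \<in> L1_loc"
  shows "integrable lebesgue (\<lambda>y. k (x - y) *\<^sub>R F y)"
  by (intro euclidean_bilinear.integrable_Cc_L1_loc[OF euclidean_bilinear_scaleR] Cc_reflect assms)

text \<open>Differentiation under the integral sign along sequences \<open>x + X i\<close>. The
  remainder quotient of the kernel is bounded by \<open>M\<close>, and because the shifts are
  bounded it vanishes for y outside one fixed ball; on that ball \<open>M * norm (F y)\<close> is an
  integrable majorant.\<close>

lemma conv_has_derivative:
  fixes F :: "real ^ 'd::finite \<Rightarrow> 'b::euclidean_space"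
  assumes k: "k \<in> C_k 1" "k \<in> Cc" and F: "F \<in> L1_loc"
  shows "(conv k F has_derivative (\<lambda>h. \<Sum>\<alpha>\<in>UNIV. h $ \<alpha> *\<^sub>R conv (pdiff \<alpha> k) F x)) (at x)"
proof -
  let ?D = "\<lambda>h. \<Sum>\<alpha>\<in>UNIV. h $ \<alpha> *\<^sub>R conv (pdiff \<alpha> k) F x"
  let ?d = "\<lambda>z h. \<Sum>\<alpha>\<in>UNIV. h $ \<alpha> *\<^sub>R pdiff \<alpha> k z"
  obtain L where L: "L \<ge> 0" "\<And>x y. norm (k x - k y) \<le> L * norm (x - y)"
    using C_1_Cc_lipschitz[OF k] by metis
  have "\<exists>C R. C \<ge> 0 \<and> (\<forall>x. norm (pdiff \<alpha> k x) \<le> C) \<and> (\<forall>x. R < norm x \<longrightarrow> pdiff \<alpha> k x = 0)" for \<alpha>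
    using Cc_boundE[OF Cc_pdiff[OF k, of \<alpha>]] Cc_pdiff[OF k, of \<alpha>] unfolding Cc_def by (smt (verit) mem_Collect_eq)
  then obtain C R1 where C: "\<And>\<alpha>. C \<alpha> \<ge> 0" "\<And>\<alpha> x. norm (pdiff \<alpha> k x) \<le> C \<alpha>"
    "\<And>\<alpha> x. R1 \<alpha> < norm x \<Longrightarrow> pdiff \<alpha> k x = 0"
    by metis
  obtain R0 where R0: "\<And>x. R0 < norm x \<Longrightarrow> k x = 0"
    using k(2) by (auto simp: Cc_def)
  define R where "R = \<bar>R0\<bar> + (\<Sum>\<alpha>\<in>UNIV. \<bar>R1 \<alpha>\<bar>)"
  have "\<bar>R1 \<alpha>\<bar> \<le> (\<Sum>\<alpha>\<in>UNIV. \<bar>R1 \<alpha>\<bar>)" for \<alpha>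
    by (rule member_le_sum) auto
  then have R: "R < norm x \<Longrightarrow> k x = 0" "R < norm x \<Longrightarrow> pdiff \<alpha> k x = 0" for x \<alpha>
    using R0[of x] C(3)[of \<alpha> x] unfolding R_def by (smt (verit) sum_nonneg abs_ge_zero)+
  define M where "M = L + (\<Sum>\<alpha>\<in>UNIV. C \<alpha>)"
  have M: "M \<ge> 0" unfolding M_def using L C by (intro add_nonneg_nonneg sum_nonneg) auto
  have d: "(k has_derivative ?d z) (at z)" for z
    using k(1) by (intro has_derivative_pdiff) auto
  have d_bound: "norm (?d z h) \<le> (\<Sum>\<alpha>\<in>UNIV. C \<alpha>) * norm h" for z h
  proof -
    have "norm (?d z h) \<le> (\<Sum>\<alpha>\<in>(UNIV::'d set). norm h * C \<alpha>)"
      using C by (intro sum_norm_le) (auto intro!: mult_mono component_le_norm_cart simp: abs_mult)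
    then show ?thesis by (simp add: sum_distrib_left mult.commute)
  qed
  have bl: "bounded_linear ?D"
    by (intro bounded_linear_sum bounded_linear_scaleR_left bounded_linear_compose[OF bounded_linear_scaleR_left]
        bounded_linear_vec_nth)
  have int: "integrable lebesgue (\<lambda>y. k (z - y) *\<^sub>R F y)" "integrable lebesgue (\<lambda>y. pdiff \<alpha> k (z - y) *\<^sub>R F y)" for z \<alpha>
    by (intro conv_integrable k F Cc_pdiff)+
  have eq: "conv k F (x + h) - conv k F x - ?D h =
      (\<integral>y. (k (x - y + h) - k (x - y) - ?d (x - y) h) *\<^sub>R F y \<partial>lebesgue)" for h
  proof -
    have "?D h = (\<integral>y. (\<Sum>\<alpha>\<in>UNIV. h $ \<alpha> *\<^sub>R (pdiff \<alpha> k (x - y) *\<^sub>R F y)) \<partial>lebesgue)"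
      unfolding conv_def using int
      by (subst Bochner_Integration.integral_sum) (auto simp del: scaleR_scaleR intro!: integrable_scaleR_right)
    moreover have "integrable lebesgue (\<lambda>y. \<Sum>\<alpha>\<in>UNIV. h $ \<alpha> *\<^sub>R (pdiff \<alpha> k (x - y) *\<^sub>R F y))"
      using int by (intro Bochner_Integration.integrable_sum integrable_scaleR_right)
    ultimately have "conv k F (x + h) - conv k F x - ?D h =
      (\<integral>y. k (x + h - y) *\<^sub>R F y - k (x - y) *\<^sub>R F y - (\<Sum>\<alpha>\<in>UNIV. h $ \<alpha> *\<^sub>R (pdiff \<alpha> k (x - y) *\<^sub>R F y)) \<partial>lebesgue)"
      unfolding conv_def using int by simp
    also have "\<dots> = (\<integral>y. (k (x - y + h) - k (x - y) - ?d (x - y) h) *\<^sub>R F y \<partial>lebesgue)"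
      by (intro arg_cong[where f="integral\<^sup>L lebesgue"] ext)
         (simp add: scaleR_diff_left scaleR_sum_left algebra_simps)
    finally show ?thesis .
  qed
  have "((\<lambda>h. norm (conv k F (x + h) - conv k F x - ?D h) / norm h) \<longlongrightarrow> 0) (at 0)"
    unfolding tendsto_at_iff_sequentially o_def
  proof (intro allI impI)
    fix X :: "nat \<Rightarrow> real ^ 'd"
    assume "\<forall>i. X i \<in> UNIV - {0}" and X: "X \<longlonglongrightarrow> 0"
    then have X0: "X i \<noteq> 0" for i by auto
    obtain B where B: "\<And>i. norm (X i) \<le> B"
      using convergent_imp_bounded[OF X] by (auto simp: bounded_iff)
    let ?r = "\<lambda>i y. ((k (x - y + X i) - k (x - y) - ?d (x - y) (X i)) /\<^sub>R norm (X i)) *\<^sub>R F y"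
    let ?K = "cball (0 :: real ^ 'd) (R + norm x + B)"
    have mF: "F \<in> borel_measurable lebesgue" by (rule L1_loc_measurable[OF F])
    have contk: "continuous_on UNIV k" "continuous_on UNIV (pdiff \<alpha> k)" for \<alpha>
      using k by (auto simp: Cc_def)
    have "(\<lambda>i. \<integral>y. ?r i y \<partial>lebesgue) \<longlonglongrightarrow> (\<integral>y. 0 \<partial>(lebesgue :: (real ^ 'd) measure))"
    proof (rule integral_dominated_convergence[where w="\<lambda>y. M * norm (indicator ?K y *\<^sub>R F y)"])
      show "?r i \<in> borel_measurable lebesgue" for i
        by (intro euclidean_bilinear.borel_measurable_bilinear[OF euclidean_bilinear_scaleR] mF
            continuous_imp_measurable_lebesgue continuous_intros continuous_on_compose2[OF contk(1)]
            continuous_on_compose2[OF contk(2)]) auto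
      show "integrable lebesgue (\<lambda>y. M * norm (indicator ?K y *\<^sub>R F y))"
        by (intro integrable_mult_right integrable_norm L1_loc_integrable_indicator F compact_cball)
      show "AE y in lebesgue. (\<lambda>i. ?r i y) \<longlonglongrightarrow> 0"
        using has_derivative_sequentially[OF d X0 X]
        by (intro AE_I2) (rule tendsto_eq_rhs, rule tendsto_scaleR[OF _ tendsto_const], auto)
      show "AE y in lebesgue. norm (?r i y) \<le> M * norm (indicator ?K y *\<^sub>R F y)" for i
      proof (intro AE_I2)
        fix y
        have b: "\<bar>(k (x - y + X i) - k (x - y) - ?d (x - y) (X i)) /\<^sub>R norm (X i)\<bar> \<le> M"
        proof -
          have "\<bar>k (x - y + X i) - k (x - y) - ?d (x - y) (X i)\<bar> \<le> L * norm (X i) + (\<Sum>\<alpha>\<in>UNIV. C \<alpha>) * norm (X i)"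
            using L(2)[of "x - y + X i" "x - y"] d_bound[where z="x - y" and h="X i"] by simp
          then show ?thesis using X0[of i] by (simp add: M_def abs_mult field_simps)
        qed
        show "norm (?r i y) \<le> M * norm (indicator ?K y *\<^sub>R F y)"
        proof (cases "y \<in> ?K")
          case True
          then show ?thesis using mult_right_mono[OF b, of "norm (F y)"] by simp
        next
          case False
          then have y: "norm y > R + norm x + B" by simp
          have "R < norm (x - y)" "R < norm (x - y + X i)"
            using y B[of i] order_trans[OF norm_ge_zero B[of i]] norm_triangle_ineq2[of y x] norm_triangle_ineq2[of y "x + X i"]
              norm_triangle_ineq[of x "X i"] norm_minus_commute[of y x] norm_minus_commute[of y "x + X i"]
            by (auto simp: algebra_simps)
          then show ?thesis using R M by simp
        qed
      qed
    qed auto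
    then have "(\<lambda>i. norm (\<integral>y. ?r i y \<partial>lebesgue)) \<longlonglongrightarrow> 0"
      by (simp add: tendsto_norm_zero)
    moreover have "norm (\<integral>y. ?r i y \<partial>lebesgue) = norm (conv k F (x + X i) - conv k F x - ?D (X i)) / norm (X i)" for i
      unfolding eq by (simp add: divide_inverse mult.commute flip: scaleR_scaleR)
    ultimately show "(\<lambda>i. norm (conv k F (x + X i) - conv k F x - ?D (X i)) / norm (X i)) \<longlonglongrightarrow> 0"
      by simp
  qed
  then show ?thesis using bl by (simp add: has_derivative_at)
qed

text \<open>All derivatives fall on the kernel, so the induction on the order runs over kernels
  while \<open>F\<close> stays fixed.\<close>

lemma conv_C_k:
  assumes k: "k \<in> test_functions" and F: "F \<in> L1_loc"
  shows "conv k F \<in> C_k n" "pdiff \<alpha> (conv k F) = conv (pdiff \<alpha> k) F"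
proof -
  have D: "(conv k F has_derivative (\<lambda>h. \<Sum>\<alpha>\<in>UNIV. h $ \<alpha> *\<^sub>R conv (pdiff \<alpha> k) F x)) (at x)"
    if "k \<in> test_functions" for x k
    by (intro conv_has_derivative test_functions_C_k test_functions_Cc that F)
  have pd: "pdiff \<alpha> (conv k F) = conv (pdiff \<alpha> k) F" if "k \<in> test_functions" for \<alpha> k
  proof (rule ext)
    show "pdiff \<alpha> (conv k F) x = conv (pdiff \<alpha> k) F x" for x
      unfolding pdiff_eqI[OF D[OF that]]
      by (simp add: axis_def if_distrib[of "\<lambda>r. r *\<^sub>R _"] sum.delta cong: if_cong)
  qed
  then show "pdiff \<alpha> (conv k F) = conv (pdiff \<alpha> k) F" using k by blast
  show "conv k F \<in> C_k n" using k
  proof (induction n arbitrary: k)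
    case 0
    then show ?case
      by (auto intro!: continuous_at_imp_continuous_on has_derivative_continuous[OF D])
  next
    case (Suc n)
    show ?case
      using D[OF Suc.prems] pd[OF Suc.prems] Suc.IH[OF test_functions_pdiff[OF Suc.prems]]
      by (auto intro!: C_k_SucI simp del: C_k.simps intro: differentiableI)
  qed
qed

text \<open>The weak derivative is tested with y \<mapsto> k (x - y). Reflection and integration by
  parts each produce a minus sign, and the two cancel.\<close>

lemma conv_weak_pdiff:
  assumes k: "k \<in> test_functions" and FG: "is_weak_pdiff \<alpha> F G"
  shows "conv (pdiff \<alpha> k) F = conv k G"
proof (rule ext)
  fix x
  have t: "(\<lambda>y. k (x - y)) \<in> test_functions"
    by (rule test_functions_reflect[OF k])
  have "pdiff \<alpha> (\<lambda>y. k (x - y)) y = - pdiff \<alpha> k (x - y)" for y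
    using pdiff_affine(1)[of k x "-1" y \<alpha>] C_k_SucD(1)[OF test_functions_C_k[OF k, of "Suc 0"]] by simp
  moreover have "(\<integral>y. pdiff \<alpha> (\<lambda>y. k (x - y)) y *\<^sub>R F y \<partial>lebesgue) = - (\<integral>y. k (x - y) *\<^sub>R G y \<partial>lebesgue)"
    using FG t by (simp add: is_weak_pdiff_def)
  ultimately show "conv (pdiff \<alpha> k) F x = conv k G x"
    by (simp add: conv_def)
qed

lemma conv_cong_AE:
  assumes "AE x in lebesgue. F x = G x" "F \<in> borel_measurable lebesgue" "G \<in> borel_measurable lebesgue" "k \<in> Cc"
  shows "conv k F = conv k G"
proof (rule ext)
  fix x
  have "(\<lambda>y. k (x - y)) \<in> borel_measurable lebesgue"
    by (intro continuous_imp_measurable_lebesgue Cc_continuous Cc_reflect assms)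
  then have "(\<lambda>y. k (x - y) *\<^sub>R F y) \<in> borel_measurable lebesgue" "(\<lambda>y. k (x - y) *\<^sub>R G y) \<in> borel_measurable lebesgue"
    using assms by auto
  then show "conv k F x = conv k G x"
    unfolding conv_def using assms(1) by (intro integral_cong_AE) (auto elim: eventually_mono)
qed

lemma measurable_conv_kernel:
  fixes F :: "real ^ 'd::finite \<Rightarrow> 'b::euclidean_space"
  assumes "k \<in> Cc" and [measurable]: "F \<in> borel_measurable borel"
  shows "(\<lambda>(x, y). k (x - y) *\<^sub>R F y) \<in> borel_measurable (lborel \<Otimes>\<^sub>M lborel)"
proof -
  have [measurable]: "k \<in> borel_measurable borel"
    by (intro borel_measurable_continuous_onI Cc_continuous assms)
  show ?thesis by measurable
qed

lemma conv_eq_lborel: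
  assumes "k \<in> Cc" and [measurable]: "F \<in> borel_measurable borel"
  shows "conv k F x = (\<integral>y. k (x - y) *\<^sub>R F y \<partial>lborel)"
proof -
  have [measurable]: "k \<in> borel_measurable borel"
    by (intro borel_measurable_continuous_onI Cc_continuous assms)
  show ?thesis unfolding conv_def by (rule integral_completion) measurable
qed

lemma conv_borel_measurable:
  assumes k: "k \<in> Cc" and F: "F \<in> borel_measurable lebesgue"
  shows "conv k F \<in> borel_measurable borel"
proof -
  obtain F' where F': "F' \<in> borel_measurable borel" "AE x in lebesgue. F x = F' x"
    using ex_borel_representative[OF F] by metis
  have "(\<lambda>x. \<integral>y. k (x - y) *\<^sub>R F' y \<partial>lborel) \<in> borel_measurable lborel"
    using measurable_conv_kernel[OF k F'(1)] by (rule lborel.borel_measurable_lebesgue_integral)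
  then have "conv k F' \<in> borel_measurable borel"
    unfolding conv_eq_lborel[OF k F'(1), abs_def] by simp
  moreover have "conv k F = conv k F'"
    using F' F k by (intro conv_cong_AE) (auto intro: measurable_completion)
  ultimately show ?thesis by simp
qed

lemma integrable_lborel_product:
  fixes u w :: "'a::euclidean_space \<Rightarrow> real"
  assumes [measurable]: "integrable lborel u" "integrable lborel w"
  shows "integrable (lborel \<Otimes>\<^sub>M lborel) (\<lambda>(x, y). u x * w y)"
proof -
  show ?thesis
  proof (rule lborel_pair.Fubini_integrable)
    show "integrable lborel (\<lambda>x. \<integral>y. norm (case (x, y) of (x, y) \<Rightarrow> u x * w y) \<partial>lborel)"
      using assms by (simp add: abs_mult)
  qed (use assms in auto)
qed

text \<open>Fubini's theorem: the adjoint of a convolution is the convolution with the reflected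
  kernel. Where the integrand is nonzero, x lies in a ball given by \<phi> and y in the ball of
  radius R + Rk, so the double integral converges absolutely although \<open>F\<close> is only
  locally integrable.\<close>

lemma integral_conv_swap:
  fixes F \<phi> :: "real ^ 'd::finite \<Rightarrow> 'b::euclidean_space"
  assumes k: "k \<in> Cc" and F: "F \<in> L1_loc" and \<phi>: "\<phi> \<in> Cc"
  shows "(\<integral>x. conv k F x \<bullet> \<phi> x \<partial>lebesgue) = (\<integral>y. F y \<bullet> conv (\<lambda>z. k (- z)) \<phi> y \<partial>lebesgue)"
proof -
  obtain F' where F'[measurable]: "F' \<in> borel_measurable borel" and ae: "AE x in lebesgue. F x = F' x"
    using ex_borel_representative[OF L1_loc_measurable[OF F]] by metis
  have F'leb: "F' \<in> borel_measurable lebesgue" by (intro measurable_completion) simp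
  have F'L: "F' \<in> L1_loc" by (rule L1_loc_cong_AE[OF F ae F'leb])
  have kc[measurable]: "k \<in> borel_measurable borel"
    by (intro borel_measurable_continuous_onI Cc_continuous k)
  have pm[measurable]: "\<phi> \<in> borel_measurable borel"
    by (intro borel_measurable_continuous_onI Cc_continuous \<phi>)
  have k': "(\<lambda>z. k (- z)) \<in> Cc"
    using Cc_affine[OF k, of "-1" 0] by simp
  have cm: "conv k F' \<in> borel_measurable borel" "conv (\<lambda>z. k (- z)) \<phi> \<in> borel_measurable borel"
    by (intro conv_borel_measurable k k' F'leb continuous_imp_measurable_lebesgue Cc_continuous \<phi>)+
  define g where "g x y = k (x - y) * (F' y \<bullet> \<phi> x)" for x y
  obtain Ck Rk where Ck: "Ck \<ge> 0" "\<And>x. norm (k x) \<le> Ck * indicator (cball 0 Rk) x"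
    using Cc_boundE[OF k] by metis
  obtain C R where C: "C \<ge> 0" "\<And>x. norm (\<phi> x) \<le> C * indicator (cball 0 R) x"
    using Cc_boundE[OF \<phi>] by metis
  have "integrable lborel (\<lambda>x::real^'d. Ck * C * indicator (cball 0 R) x)"
    by (intro integrable_mult_right integrable_real_indicator)
       (auto simp: emeasure_bounded_finite[OF bounded_cball, unfolded infinity_ennreal_def])
  moreover have "integrable lborel (\<lambda>y. norm (indicator (cball 0 (R + Rk)) y *\<^sub>R F' y))"
  proof (rule integrable_norm)
    have "(\<lambda>y. indicator (cball 0 (R + Rk)) y *\<^sub>R F' y) \<in> borel_measurable lborel"
      by (intro borel_measurable_scaleR borel_measurable_indicator) (use F' in auto)
    then show "integrable lborel (\<lambda>y. indicator (cball 0 (R + Rk)) y *\<^sub>R F' y)"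
      using L1_loc_integrable_indicator[OF F'L compact_cball, of 0 "R + Rk"]
      by (simp add: integrable_completion)
  qed
  ultimately have "integrable (lborel \<Otimes>\<^sub>M lborel) (\<lambda>(x :: real ^ 'd, y). Ck * C * indicator (cball 0 R) x
      * norm (indicator (cball 0 (R + Rk)) y *\<^sub>R F' y))"
    by (rule integrable_lborel_product)
  then have int: "integrable (lborel \<Otimes>\<^sub>M lborel) (\<lambda>(x, y). g x y)"
  proof (rule Bochner_Integration.integrable_bound)
    show "(\<lambda>(x, y). g x y) \<in> borel_measurable (lborel \<Otimes>\<^sub>M lborel)"
      unfolding g_def by measurable
    have "\<bar>g x y\<bar> \<le> Ck * C * indicator (cball 0 R) x * norm (indicator (cball 0 (R + Rk)) y *\<^sub>R F' y)" for x y
    proof (cases "norm x \<le> R \<and> norm (x - y) \<le> Rk")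
      case True
      then have "norm y \<le> R + Rk"
        using norm_triangle_ineq4[of x "x - y"] by simp
      moreover have "\<bar>g x y\<bar> \<le> Ck * (norm (F' y) * C)"
        unfolding g_def abs_mult
        using Ck(2)[of "x - y"] C(2)[of x] True Ck(1) C(1)
        by (intro mult_mono order_trans[OF Cauchy_Schwarz_ineq2]) auto
      ultimately show ?thesis using True by (simp add: mult_ac)
    next
      case False
      then have "\<phi> x = 0 \<or> k (x - y) = 0"
        using Ck(2)[of "x - y"] C(2)[of x] by (auto simp: indicator_def split: if_splits)
      then show ?thesis using Ck C by (auto simp: g_def)
    qed
    then show "AE x in lborel \<Otimes>\<^sub>M lborel. norm (case x of (x, y) \<Rightarrow> g x y)
      \<le> norm (case x of (x, y) \<Rightarrow> Ck * C * indicator (cball 0 R) x * norm (indicator (cball 0 (R + Rk)) y *\<^sub>R F' y))"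
      by (intro AE_I2) (fastforce intro: order_trans[OF _ abs_ge_self])
  qed
  have i1: "(\<integral>y. g x y \<partial>lborel) = conv k F' x \<bullet> \<phi> x" for x
  proof -
    have "(\<integral>y. g x y \<partial>lborel) = (\<integral>y. (k (x - y) *\<^sub>R F' y) \<bullet> \<phi> x \<partial>lebesgue)"
      unfolding g_def by (subst integral_completion) auto
    also have "\<dots> = conv k F' x \<bullet> \<phi> x"
      unfolding conv_def using conv_integrable[OF k F'L] by (rule integral_inner_left)
    finally show ?thesis .
  qed
  have i2: "(\<integral>x. g x y \<partial>lborel) = F' y \<bullet> conv (\<lambda>z. k (- z)) \<phi> y" for y
  proof -
    have "(\<integral>x. g x y \<partial>lborel) = (\<integral>x. F' y \<bullet> (k (- (y - x)) *\<^sub>R \<phi> x) \<partial>lebesgue)"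
      unfolding g_def by (subst integral_completion) auto
    also have "\<dots> = F' y \<bullet> conv (\<lambda>z. k (- z)) \<phi> y"
      unfolding conv_def
      using conv_integrable[OF k' continuous_imp_L1_loc[OF Cc_continuous[OF \<phi>]]] by (rule integral_inner_right)
    finally show ?thesis .
  qed
  have "(\<integral>x. conv k F x \<bullet> \<phi> x \<partial>lebesgue) = (\<integral>x. conv k F' x \<bullet> \<phi> x \<partial>lborel)"
    unfolding conv_cong_AE[OF ae L1_loc_measurable[OF F] F'leb k]
    using cm pm by (intro integral_completion borel_measurable_inner) auto
  also have "\<dots> = (\<integral>y. F' y \<bullet> conv (\<lambda>z. k (- z)) \<phi> y \<partial>lborel)"
    using lborel_pair.Fubini_integral[OF int] by (simp add: i1 i2)
  also have "\<dots> = (\<integral>y. F' y \<bullet> conv (\<lambda>z. k (- z)) \<phi> y \<partial>lebesgue)"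
    using cm by (intro integral_completion[symmetric]) measurable
  also have "\<dots> = (\<integral>y. F y \<bullet> conv (\<lambda>z. k (- z)) \<phi> y \<partial>lebesgue)"
  proof (rule integral_cong_AE)
    show "(\<lambda>y. F' y \<bullet> conv (\<lambda>z. k (- z)) \<phi> y) \<in> borel_measurable lebesgue"
      using cm by (intro measurable_completion) measurable
    show "(\<lambda>y. F y \<bullet> conv (\<lambda>z. k (- z)) \<phi> y) \<in> borel_measurable lebesgue"
      by (rule borel_measurable_inner[OF L1_loc_measurable[OF F] measurable_completion])
         (use cm(2) in simp)
  qed (use ae in \<open>auto elim: eventually_mono\<close>)
  finally show ?thesis .
qed

lemma L2_imp_L1_loc:
  assumes "F \<in> L2"
  shows "F \<in> L1_loc"
proof -
  have "set_integrable lebesgue K F" if K: "compact K" for K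
    unfolding set_integrable_def
  proof (rule Bochner_Integration.integrable_bound)
    have Ks: "K \<in> sets lborel" "emeasure lborel K < \<infinity>"
      using K emeasure_bounded_finite[OF compact_imp_bounded[OF K]] by (auto simp: borel_compact)
    show "integrable lebesgue (\<lambda>x. indicator K x + (norm (F x))\<^sup>2)"
      using Ks by (intro Bochner_Integration.integrable_add L2_integrable_power2 assms integrable_real_indicator) auto
    show "(\<lambda>x. indicat_real K x *\<^sub>R F x) \<in> borel_measurable lebesgue"
      using Ks L2_measurable[OF assms] by (intro borel_measurable_scaleR borel_measurable_indicator) auto
    have "a \<le> 1 + a\<^sup>2" for a :: real
      using sum_squares_bound[of a 1] zero_le_power2[of a] by (simp only: mult_1_right power_one)
    then show "AE x in lebesgue. norm (indicat_real K x *\<^sub>R F x) \<le> norm (indicat_real K x + (norm (F x))\<^sup>2)"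
      by (auto simp: indicator_def)
  qed
  then show ?thesis using L2_measurable[OF assms] by (simp add: L1_loc_def)
qed

lemma L2_imp_L2_loc:
  assumes "F \<in> L2"
  shows "F \<in> L2_loc"
proof -
  have "set_integrable lebesgue K (\<lambda>x. (norm (F x))\<^sup>2)" if K: "compact K" for K
    unfolding set_integrable_def using K
    by (intro integrable_mult_indicator L2_integrable_power2 assms) (auto simp: borel_compact)
  then show ?thesis using L2_measurable[OF assms] by (simp add: L2_loc_def)
qed

text \<open>Young's inequality. With \<bar>k\<bar> split into two square roots, Cauchy-Schwarz
  bounds the square of the convolution at each point by the mass of \<bar>k\<bar> times the
  convolution of \<bar>k\<bar> with |F|^2; Tonelli's theorem then integrates the latter.\<close>

lemma conv_L2:
  fixes F :: "real ^ 'd::finite \<Rightarrow> 'b::euclidean_space"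
  assumes k: "k \<in> Cc" and F: "F \<in> L2"
  shows "conv k F \<in> L2" "norm_L2 (conv k F) \<le> (\<integral>x. \<bar>k x\<bar> \<partial>lebesgue) * norm_L2 F"
proof -
  define K where "K = (\<integral>x. \<bar>k x\<bar> \<partial>lebesgue)"
  have K: "K \<ge> 0" by (simp add: K_def)
  obtain F' where F'[measurable]: "F' \<in> borel_measurable borel" and ae: "AE x in lebesgue. F x = F' x"
    using ex_borel_representative[OF L2_measurable[OF F]] by metis
  have F'leb: "F' \<in> borel_measurable lebesgue" by (intro measurable_completion) simp
  have F'L: "F' \<in> L2" "norm_L2 F' = norm_L2 F" using L2_cong_AE[OF F ae F'leb] by auto
  have eq: "conv k F = conv k F'"
    by (rule conv_cong_AE[OF ae L2_measurable[OF F] F'leb k])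
  have km[measurable]: "k \<in> borel_measurable borel"
    by (intro borel_measurable_continuous_onI Cc_continuous k)
  have ak: "(\<lambda>x. \<bar>k x\<bar>) \<in> Cc" using Cc_norm[OF k] by simp
  have refl: "(\<integral>y. \<bar>k (x - y)\<bar> \<partial>lebesgue) = K" for x
    unfolding K_def by (rule integral_reflect[where g="\<lambda>x. \<bar>k x\<bar>"]) measurable
  have nn_refl: "(\<integral>\<^sup>+x. ennreal \<bar>k (x - y)\<bar> \<partial>lborel) = ennreal K" for y
  proof -
    have "(\<integral>\<^sup>+x. ennreal \<bar>k (x - y)\<bar> \<partial>lborel) = (\<integral>\<^sup>+x. ennreal \<bar>k x\<bar> \<partial>lborel)"
      using nn_integral_affine[of "\<lambda>x. ennreal \<bar>k x\<bar>" 1 "- y"] by simp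
    also have "\<dots> = (\<integral>\<^sup>+x. ennreal \<bar>k x\<bar> \<partial>lebesgue)"
      by (simp add: nn_integral_completion)
    also have "\<dots> = ennreal K"
      unfolding K_def by (intro nn_integral_eq_integral Cc_integrable ak) auto
    finally show ?thesis .
  qed
  obtain C where C: "C \<ge> 0" "\<And>x. norm (k x) \<le> C" using Cc_boundE[OF k] by metis
  have pointwise: "ennreal ((norm (conv k F' x))\<^sup>2) \<le> ennreal K * (\<integral>\<^sup>+y. ennreal (\<bar>k (x - y)\<bar> * (norm (F' y))\<^sup>2) \<partial>lborel)" for x
  proof -
    define a where "a y = sqrt \<bar>k (x - y)\<bar>" for y
    define b where "b y = sqrt \<bar>k (x - y)\<bar> * norm (F' y)" for y
    have "(\<lambda>y. \<bar>k (x - y)\<bar>) \<in> Cc" using Cc_norm[OF Cc_reflect[OF k]] by simp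
    then have "a \<in> Cc" unfolding a_def Cc_def by (fastforce intro!: continuous_intros)
    then have a: "a \<in> L2" by (rule Cc_L2)
    have bm: "b \<in> borel_measurable lebesgue"
      unfolding b_def by (intro measurable_completion) measurable
    have b: "b \<in> L2"
    proof (rule L2_bound(1)[OF bm F'L(1), of "sqrt C"])
      show "AE y in lebesgue. norm (b y) \<le> sqrt C * norm (F' y)"
        using C by (intro AE_I2) (auto simp: b_def abs_mult intro!: mult_right_mono)
    qed (use C in simp)
    have "norm (conv k F' x) \<le> (\<integral>y. norm (k (x - y) *\<^sub>R F' y) \<partial>lebesgue)"
      unfolding conv_def by (rule integral_norm_bound)
    also have "\<dots> = (\<integral>y. norm (a y) * norm (b y) \<partial>lebesgue)"
      by (intro arg_cong[where f="integral\<^sup>L lebesgue"] ext) (simp add: a_def b_def flip: mult.assoc)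
    also have "\<dots> \<le> norm_L2 a * norm_L2 b" by (rule L2_Cauchy_Schwarz[OF a b])
    finally have "(norm (conv k F' x))\<^sup>2 \<le> (norm_L2 a)\<^sup>2 * (norm_L2 b)\<^sup>2"
      unfolding power_mult_distrib[symmetric] by (intro power_mono) auto
    also have "(norm_L2 a)\<^sup>2 = K" unfolding norm_L2_power2 by (simp add: a_def refl)
    finally have "ennreal ((norm (conv k F' x))\<^sup>2) \<le> ennreal K * ennreal ((norm_L2 b)\<^sup>2)"
      using K by (simp flip: ennreal_mult add: ennreal_leI)
    also have "ennreal ((norm_L2 b)\<^sup>2) = (\<integral>\<^sup>+y. ennreal (\<bar>k (x - y)\<bar> * (norm (F' y))\<^sup>2) \<partial>lborel)"
      by (simp add: nn_integral_L2[OF b, symmetric] nn_integral_completion b_def power_mult_distrib)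
    finally show ?thesis .
  qed
  have "(\<integral>\<^sup>+x. ennreal ((norm (conv k F x))\<^sup>2) \<partial>lebesgue)
      \<le> (\<integral>\<^sup>+x. ennreal K * (\<integral>\<^sup>+y. ennreal (\<bar>k (x - y)\<bar> * (norm (F' y))\<^sup>2) \<partial>lborel) \<partial>lborel)"
    unfolding nn_integral_completion eq by (intro nn_integral_mono pointwise)
  also have "\<dots> = ennreal K * (\<integral>\<^sup>+x. (\<integral>\<^sup>+y. ennreal (\<bar>k (x - y)\<bar> * (norm (F' y))\<^sup>2) \<partial>lborel) \<partial>lborel)"
    by (rule nn_integral_cmult) measurable
  also have "(\<integral>\<^sup>+x. (\<integral>\<^sup>+y. ennreal (\<bar>k (x - y)\<bar> * (norm (F' y))\<^sup>2) \<partial>lborel) \<partial>lborel)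
      = (\<integral>\<^sup>+y. (\<integral>\<^sup>+x. ennreal (\<bar>k (x - y)\<bar> * (norm (F' y))\<^sup>2) \<partial>lborel) \<partial>lborel)"
    by (rule lborel_pair.Fubini') measurable
  also have "\<dots> = (\<integral>\<^sup>+y. ennreal K * ennreal ((norm (F' y))\<^sup>2) \<partial>lborel)"
    by (simp add: ennreal_mult nn_integral_multc nn_refl)
  also have "\<dots> = ennreal K * ennreal ((norm_L2 F)\<^sup>2)"
    using nn_integral_L2[OF F'L(1)] F'L(2) by (simp add: nn_integral_cmult nn_integral_completion)
  also have "ennreal K * (ennreal K * ennreal ((norm_L2 F)\<^sup>2)) = ennreal ((K * norm_L2 F)\<^sup>2)"
    using K by (simp add: power_mult_distrib power2_eq_square ennreal_mult mult_ac)
  finally have le: "(\<integral>\<^sup>+x. ennreal ((norm (conv k F x))\<^sup>2) \<partial>lebesgue) \<le> ennreal ((K * norm_L2 F)\<^sup>2)" .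
  have "conv k F \<in> borel_measurable lebesgue"
    using conv_borel_measurable[OF k L2_measurable[OF F]] by (intro measurable_completion) simp
  from L2_nn_integralI[OF this le] K
  show "conv k F \<in> L2" "norm_L2 (conv k F) \<le> (\<integral>x. \<bar>k x\<bar> \<partial>lebesgue) * norm_L2 F"
    by (auto simp: K_def)
qed

lemma conv_test_functions:
  assumes k: "k \<in> test_functions" and \<phi>: "\<phi> \<in> Cc"
  shows "conv k \<phi> \<in> test_functions"
proof -
  obtain R where R: "\<And>x. R < norm x \<Longrightarrow> k x = 0"
    using k by (auto simp: test_functions_iff)
  obtain S where S: "\<And>x. S < norm x \<Longrightarrow> \<phi> x = 0"
    using \<phi> by (auto simp: Cc_def)
  have "conv k \<phi> x = 0" if "R + S < norm x" for x
  proof -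
    have "k (x - y) *\<^sub>R \<phi> y = 0" for y
      using R[of "x - y"] S[of y] that norm_triangle_ineq2[of x y] by (cases "S < norm y") auto
    then show ?thesis unfolding conv_def by (simp only: integral_zero)
  qed
  then show ?thesis
    using conv_C_k(1)[OF k continuous_imp_L1_loc[OF Cc_continuous[OF \<phi>]]]
    by (auto simp: test_functions_iff simp del: C_k.simps)
qed

section \<open>The mollifiers and their limits\<close>

definition bump_mass :: "'d::finite itself \<Rightarrow> real"
  where "bump_mass _ = (\<integral>x. bump (x :: real ^ 'd) \<partial>lebesgue)"

text \<open>A vanishing integral would make the nonnegative bump zero almost everywhere, hence
  everywhere by continuity, against \<open>bump_0\<close>.\<close>

lemma bump_mass_pos: "bump_mass TYPE('d::finite) > 0"
proof -
  let ?b = "bump :: real ^ 'd \<Rightarrow> real"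
  have Cc: "?b \<in> Cc" by (rule test_functions_Cc[OF bump_test])
  have "integral\<^sup>L lebesgue ?b \<noteq> 0"
  proof
    assume "integral\<^sup>L lebesgue ?b = 0"
    then have ae: "AE x in lebesgue. x \<in> {x. ?b x = 0}"
      using integral_nonneg_eq_0_iff_AE[OF Cc_integrable[OF Cc] AE_I2[OF bump_nonneg]] by simp
    have "closed {x. ?b x = 0}"
      using Cc_continuous[OF Cc] by (intro closed_Collect_eq continuous_intros)
    then have "(0 :: real ^ 'd) \<in> {x. ?b x = 0}"
      using ae by (rule mem_closed_if_AE_lebesgue)
    then show False using bump_0[where 'a='d] by simp
  qed
  moreover have "integral\<^sup>L lebesgue ?b \<ge> 0" by (rule integral_nonneg_AE[OF AE_I2[OF bump_nonneg]])
  ultimately show ?thesis by (simp add: bump_mass_def)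
qed

text \<open>Mass 1 and support in the ball of radius 1 / (n + 1). The summand \<open>0 +\<close>
  keeps the argument in the shape expected by the affine substitution lemmas.\<close>

definition eta :: "nat \<Rightarrow> real ^ 'd::finite \<Rightarrow> real"
  where "eta n x = (real (Suc n) ^ CARD('d) / bump_mass TYPE('d)) *\<^sub>R bump (0 + real (Suc n) *\<^sub>R x)"

lemma eta_test: "eta n \<in> test_functions"
  unfolding eta_def[abs_def] by (intro test_functions_cmult test_functions_affine bump_test) simp

lemmas eta_Cc = test_functions_Cc[OF eta_test]

lemma eta_nonneg: "0 \<le> eta n x"
  by (simp add: eta_def bump_nonneg bump_mass_pos less_imp_le)

lemma eta_even: "eta n (- x) = eta n x"
  by (simp add: eta_def bump_minus)

lemma eta_outside: "1 / real (Suc n) < norm x \<Longrightarrow> eta n x = 0"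
  by (simp add: eta_def bump_outside field_simps del: of_nat_Suc)

lemma bump_borel: "bump \<in> borel_measurable borel"
  by (intro borel_measurable_continuous_onI Cc_continuous test_functions_Cc bump_test)

lemma eta_integral: "(\<integral>x. eta n (x :: real ^ 'd::finite) \<partial>lebesgue) = 1"
proof -
  have "bump_mass TYPE('d) = \<bar>real (Suc n)\<bar> ^ CARD('d) * (\<integral>x. bump (0 + real (Suc n) *\<^sub>R (x :: real ^ 'd)) \<partial>lebesgue)"
    unfolding bump_mass_def by (subst integral_affine[OF bump_borel, of "real (Suc n)" 0]) auto
  moreover from this have "(\<integral>x. bump (0 + real (Suc n) *\<^sub>R (x :: real ^ 'd)) \<partial>lebesgue) \<noteq> 0"
    using bump_mass_pos[where 'd='d] by (metis mult_zero_right less_irrefl)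
  ultimately show ?thesis
    by (simp add: eta_def field_simps del: of_nat_Suc)
qed

lemma eta_integral_reflect: "(\<integral>y. eta n (x - y) \<partial>lebesgue) = 1"
  by (simp add: integral_reflect[OF borel_measurable_continuous_onI[OF Cc_continuous[OF eta_Cc]]] eta_integral)

lemma pdiff_eta:
  fixes x :: "real ^ 'd::finite"
  shows "pdiff \<alpha> (eta n) x = (real (Suc n) ^ CARD('d) / bump_mass TYPE('d)) * (real (Suc n) * pdiff \<alpha> bump (real (Suc n) *\<^sub>R x))"
proof -
  have d: "bump differentiable (at y)" for y :: "real ^ 'd"
    using C_k_SucD(1)[OF bump_C_k[of "Suc 0"]] .
  interpret bounded_linear "\<lambda>r::real. (real (Suc n) ^ CARD('d) / bump_mass TYPE('d)) *\<^sub>R r"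
    by (rule bounded_linear_scaleR_right)
  note a = pdiff_affine[where t=0 and c="real (Suc n)", OF d]
  show ?thesis
    unfolding eta_def[abs_def] pdiff_linear[OF a(2)] a(1) by simp
qed

text \<open>A bound, independent of n, for the first absolute moments of the first derivatives of
  the mollifiers; the sum serves all directions at once.\<close>

definition eta_const :: "'d::finite itself \<Rightarrow> real"
  where "eta_const _ = (\<Sum>\<alpha>\<in>UNIV. \<integral>x. \<bar>pdiff \<alpha> bump (x :: real ^ 'd)\<bar> \<partial>lebesgue) / bump_mass TYPE('d)"

lemma eta_const_nonneg: "0 \<le> eta_const TYPE('d::finite)"
  unfolding eta_const_def using bump_mass_pos[where 'd='d]
  by (intro divide_nonneg_nonneg sum_nonneg integral_nonneg_AE) auto

text \<open>The derivative costs a factor n + 1, but \<open>norm x\<close> is at most 1 / (n + 1) on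
  the support. This cancellation is what makes the commutator estimate uniform in n.\<close>

lemma eta_moment: "(\<integral>x. norm x * \<bar>pdiff \<alpha> (eta n) (x :: real ^ 'd::finite)\<bar> \<partial>lebesgue) \<le> eta_const TYPE('d)"
proof -
  let ?N = "real (Suc n)" and ?c = "bump_mass TYPE('d)"
  let ?p = "pdiff \<alpha> (bump :: real ^ 'd \<Rightarrow> real)"
  have c: "?c > 0" by (rule bump_mass_pos)
  have pCc: "?p \<in> Cc" "pdiff \<alpha> (eta n :: real ^ 'd \<Rightarrow> real) \<in> Cc"
    by (intro test_functions_Cc test_functions_pdiff bump_test eta_test)+
  have aCc: "(\<lambda>x. \<bar>?p x\<bar>) \<in> Cc" using Cc_norm[OF pCc(1)] by simp
  have am: "(\<lambda>x. \<bar>?p x\<bar>) \<in> borel_measurable borel"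
    by (intro borel_measurable_continuous_onI Cc_continuous aCc)
  have out: "1 < norm x \<Longrightarrow> ?p x = 0" for x
    by (rule pdiff_eq_0_outside[OF bump_outside])
  have sCc: "(\<lambda>x. \<bar>?p (0 + ?N *\<^sub>R x)\<bar>) \<in> Cc"
    using Cc_affine[OF aCc, of ?N 0] by simp
  have lCc: "(\<lambda>x. norm x * \<bar>pdiff \<alpha> (eta n) (x :: real ^ 'd)\<bar>) \<in> Cc"
    using bounded_bilinear.Cc_bilinear_right[OF bounded_bilinear_mult Cc_norm[OF pCc(2)], of norm]
    by (simp add: continuous_on_norm)
  have "(\<integral>x. norm x * \<bar>pdiff \<alpha> (eta n) (x :: real ^ 'd)\<bar> \<partial>lebesgue)
      \<le> (\<integral>x. (?N ^ CARD('d) / ?c) * \<bar>?p (0 + ?N *\<^sub>R x)\<bar> \<partial>lebesgue)"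
  proof (rule integral_mono[OF Cc_integrable[OF lCc]])
    show "integrable lebesgue (\<lambda>x. (?N ^ CARD('d) / ?c) * \<bar>?p (0 + ?N *\<^sub>R x)\<bar>)"
      by (intro integrable_mult_right Cc_integrable sCc)
    fix x :: "real ^ 'd"
    have "?N * norm x * \<bar>?p (?N *\<^sub>R x)\<bar> \<le> 1 * \<bar>?p (?N *\<^sub>R x)\<bar>"
    proof (cases "1 < norm (?N *\<^sub>R x)")
      case True
      then show ?thesis using out[OF True] by simp
    next
      case False
      then show ?thesis by (intro mult_right_mono) auto
    qed
    then have "(?N ^ CARD('d) / ?c) * (?N * norm x * \<bar>?p (?N *\<^sub>R x)\<bar>) \<le> (?N ^ CARD('d) / ?c) * \<bar>?p (?N *\<^sub>R x)\<bar>"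
      using c by (intro mult_left_mono) auto
    then show "norm x * \<bar>pdiff \<alpha> (eta n) x\<bar> \<le> (?N ^ CARD('d) / ?c) * \<bar>?p (0 + ?N *\<^sub>R x)\<bar>"
      using c by (simp add: pdiff_eta abs_mult mult_ac del: of_nat_Suc)
  qed
  also have "\<dots> = (\<bar>?N\<bar> ^ CARD('d) * (\<integral>x. \<bar>?p (0 + ?N *\<^sub>R x)\<bar> \<partial>lebesgue)) / ?c"
    by simp
  also have "\<bar>?N\<bar> ^ CARD('d) * (\<integral>x. \<bar>?p (0 + ?N *\<^sub>R x)\<bar> \<partial>lebesgue) = (\<integral>x. \<bar>?p x\<bar> \<partial>lebesgue)"
    using integral_affine[OF am, of ?N 0] by simp
  also have "\<dots> / ?c \<le> eta_const TYPE('d)"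
    unfolding eta_const_def using c
    by (intro divide_right_mono member_le_sum[where f="\<lambda>\<alpha>. \<integral>x. \<bar>pdiff \<alpha> bump (x :: real ^ 'd)\<bar> \<partial>lebesgue"]) auto
  finally show ?thesis .
qed

lemma conv_eta_bound:
  assumes "\<And>x. norm (\<psi> x) \<le> C" "continuous_on UNIV \<psi>"
  shows "norm (conv (eta n) \<psi> x) \<le> C"
proof -
  have int: "integrable lebesgue (\<lambda>y. eta n (x - y) *\<^sub>R \<psi> y)"
    by (intro conv_integrable eta_Cc continuous_imp_L1_loc assms)
  have "norm (conv (eta n) \<psi> x) \<le> (\<integral>y. norm (eta n (x - y) *\<^sub>R \<psi> y) \<partial>lebesgue)"
    unfolding conv_def by (rule integral_norm_bound)
  also have "\<dots> \<le> (\<integral>y. eta n (x - y) * C \<partial>lebesgue)"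
  proof (rule integral_mono[OF integrable_norm[OF int]])
    show "integrable lebesgue (\<lambda>y. eta n (x - y) * C)"
      by (intro integrable_mult_left Cc_integrable Cc_reflect eta_Cc)
    show "norm (eta n (x - y) *\<^sub>R \<psi> y) \<le> eta n (x - y) * C" for y
      unfolding norm_scaleR abs_of_nonneg[OF eta_nonneg] by (intro mult_left_mono assms eta_nonneg)
  qed
  also have "\<dots> = C" by (simp add: eta_integral_reflect)
  finally show ?thesis .
qed

text \<open>The radius R + 1 serves for every n, as a common majorant requires.\<close>

lemma conv_eta_outside:
  assumes "\<And>x. R < norm x \<Longrightarrow> \<psi> x = 0" "R + 1 < norm x"
  shows "conv (eta n) \<psi> x = 0"
proof -
  have "eta n (x - y) *\<^sub>R \<psi> y = 0" for y
  proof (cases "R < norm y")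
    case False
    then have "1 < norm (x - y)" using assms(2) norm_triangle_ineq2[of x y] by auto
    then have "1 / real (Suc n) < norm (x - y)"
      by (rule le_less_trans[rotated]) simp
    then show ?thesis by (simp add: eta_outside del: of_nat_Suc)
  qed (simp add: assms)
  then show ?thesis unfolding conv_def by (simp only: integral_zero)
qed

lemma conv_eta_tendsto:
  assumes \<psi>: "continuous_on UNIV \<psi>"
  shows "(\<lambda>n. conv (eta n) \<psi> x) \<longlonglongrightarrow> \<psi> x"
proof (rule LIMSEQ_I)
  fix e :: real assume e: "e > 0"
  have "isCont \<psi> x" using \<psi> by (simp add: continuous_on_eq_continuous_at)
  \<comment> \<open>Half of e leaves room for a strict inequality, which integration turns into a
    weak one.\<close>
  then obtain d where d: "d > 0" "\<And>y. dist y x < d \<Longrightarrow> dist (\<psi> y) (\<psi> x) < e / 2"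
    using e unfolding continuous_at_eps_delta by (metis half_gt_zero)
  obtain N where N: "1 / real (Suc N) < d"
    using reals_Archimedean[OF d(1)] by (auto simp: inverse_eq_divide)
  have "norm (conv (eta n) \<psi> x - \<psi> x) < e" if n: "n \<ge> N" for n
  proof -
    have nd: "1 / real (Suc n) < d"
      using n by (intro le_less_trans[OF _ N] divide_left_mono) auto
    have int: "integrable lebesgue (\<lambda>y. eta n (x - y) *\<^sub>R \<psi> y)" "integrable lebesgue (\<lambda>y. eta n (x - y) *\<^sub>R \<psi> x)"
      by (intro conv_integrable eta_Cc continuous_imp_L1_loc \<psi> continuous_on_const)+
    have "(\<integral>y. eta n (x - y) *\<^sub>R \<psi> x \<partial>lebesgue) = \<psi> x"
      using Cc_integrable[OF Cc_reflect[OF eta_Cc]] by (subst integral_scaleR_left) (auto simp: eta_integral_reflect)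
    then have "conv (eta n) \<psi> x - \<psi> x = (\<integral>y. eta n (x - y) *\<^sub>R \<psi> y - eta n (x - y) *\<^sub>R \<psi> x \<partial>lebesgue)"
      using int by (simp add: conv_def)
    also have "norm \<dots> \<le> (\<integral>y. norm (eta n (x - y) *\<^sub>R \<psi> y - eta n (x - y) *\<^sub>R \<psi> x) \<partial>lebesgue)"
      by (rule integral_norm_bound)
    also have "\<dots> \<le> (\<integral>y. eta n (x - y) * (e / 2) \<partial>lebesgue)"
    proof (rule integral_mono)
      show "integrable lebesgue (\<lambda>y. norm (eta n (x - y) *\<^sub>R \<psi> y - eta n (x - y) *\<^sub>R \<psi> x))"
        using int by (intro integrable_norm Bochner_Integration.integrable_diff)
      show "integrable lebesgue (\<lambda>y. eta n (x - y) * (e / 2))"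
        by (intro integrable_mult_left Cc_integrable Cc_reflect eta_Cc)
      fix y
      show "norm (eta n (x - y) *\<^sub>R \<psi> y - eta n (x - y) *\<^sub>R \<psi> x) \<le> eta n (x - y) * (e / 2)"
      proof (cases "1 / real (Suc n) < norm (x - y)")
        case False
        then have "dist y x < d" using nd by (simp add: dist_norm norm_minus_commute)
        then have "norm (\<psi> y - \<psi> x) \<le> e / 2" using d(2)[of y] by (simp add: dist_norm)
        then show ?thesis
          unfolding scaleR_diff_right[symmetric] norm_scaleR abs_of_nonneg[OF eta_nonneg]
          by (intro mult_left_mono eta_nonneg)
      qed (simp add: eta_outside del: of_nat_Suc)
    qed
    also have "\<dots> = e / 2" by (simp add: eta_integral_reflect)
    also have "\<dots> < e" using e by simp
    finally show ?thesis .
  qed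
  then show "\<exists>no. \<forall>n\<ge>no. norm (conv (eta n) \<psi> x - \<psi> x) < e" by blast
qed

text \<open>The mollifier sits on the continuous factor, where convergence is pointwise, uniformly
  bounded and confined to one ball; \<open>F\<close> then supplies an integrable majorant on that
  ball.\<close>

lemma (in euclidean_bilinear) conv_eta_weak_limit:
  fixes F :: "real ^ 'd::finite \<Rightarrow> 'b"
  assumes \<psi>: "\<psi> \<in> Cc" and F: "F \<in> L1_loc"
  shows "(\<lambda>n. \<integral>x. prod (conv (eta n) \<psi> x) (F x) \<partial>lebesgue) \<longlonglongrightarrow> (\<integral>x. prod (\<psi> x) (F x) \<partial>lebesgue)"
proof -
  obtain K where K: "K \<ge> 0" "\<And>a b. norm (prod a b) \<le> norm a * norm b * K"
    using nonneg_bounded by metis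
  obtain C where C: "C \<ge> 0" "\<And>x. norm (\<psi> x) \<le> C" using Cc_boundE[OF \<psi>] by metis
  obtain R where R: "\<And>x. R < norm x \<Longrightarrow> \<psi> x = 0" using \<psi> by (auto simp: Cc_def)
  note cont = Cc_continuous[OF \<psi>]
  have t: "conv (eta n) \<psi> \<in> Cc" for n
    by (intro test_functions_Cc conv_test_functions eta_test \<psi>)
  show ?thesis
  proof (rule integral_dominated_convergence[where w="\<lambda>x. C * K * norm (indicator (cball 0 (R + 1)) x *\<^sub>R F x)"])
    show "(\<lambda>x. prod (\<psi> x) (F x)) \<in> borel_measurable lebesgue" "(\<lambda>x. prod (conv (eta n) \<psi> x) (F x)) \<in> borel_measurable lebesgue" for n
      using Cc_continuous[OF t] cont
      by (intro borel_measurable_bilinear continuous_imp_measurable_lebesgue L1_loc_measurable F; simp)+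
    show "integrable lebesgue (\<lambda>x. C * K * norm (indicator (cball 0 (R + 1)) x *\<^sub>R F x))"
      by (intro integrable_mult_right integrable_norm L1_loc_integrable_indicator F compact_cball)
    show "AE x in lebesgue. (\<lambda>n. prod (conv (eta n) \<psi> x) (F x)) \<longlonglongrightarrow> prod (\<psi> x) (F x)"
      by (intro AE_I2 tendsto conv_eta_tendsto cont tendsto_const)
    show "AE x in lebesgue. norm (prod (conv (eta n) \<psi> x) (F x)) \<le> C * K * norm (indicator (cball 0 (R + 1)) x *\<^sub>R F x)" for n
    proof (intro AE_I2)
      fix x
      show "norm (prod (conv (eta n) \<psi> x) (F x)) \<le> C * K * norm (indicator (cball 0 (R + 1)) x *\<^sub>R F x)"
      proof (cases "R + 1 < norm x")
        case True
        then have "conv (eta n) \<psi> x = 0" by (intro conv_eta_outside[OF R])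
        then show ?thesis using C K by (simp add: zero_left)
      next
        case False
        have "norm (prod (conv (eta n) \<psi> x) (F x)) \<le> norm (conv (eta n) \<psi> x) * norm (F x) * K"
          by (rule K)
        also have "\<dots> \<le> C * norm (F x) * K"
          using K C by (intro mult_right_mono conv_eta_bound cont) auto
        finally show ?thesis using False by (simp add: mult_ac)
      qed
    qed
  qed
qed

section \<open>The fundamental lemma of the calculus of variations\<close>

lemma (in euclidean_bilinear) integral_Cc_eq_of_test:
  fixes F G :: "real ^ 'd::finite \<Rightarrow> 'b"
  assumes "F \<in> L1_loc" "G \<in> L1_loc" "\<psi> \<in> Cc"
    and "\<And>\<phi>. \<phi> \<in> test_functions \<Longrightarrow> (\<integral>x. prod (\<phi> x) (F x) \<partial>lebesgue) = (\<integral>x. prod (\<phi> x) (G x) \<partial>lebesgue)"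
  shows "(\<integral>x. prod (\<psi> x) (F x) \<partial>lebesgue) = (\<integral>x. prod (\<psi> x) (G x) \<partial>lebesgue)"
  using conv_eta_weak_limit[OF assms(3,1)] conv_eta_weak_limit[OF assms(3,2)]
    assms(4)[OF conv_test_functions[OF eta_test assms(3)]] LIMSEQ_unique by fastforce

text \<open>The ideal test function sgn F is an almost everywhere limit of continuous functions.
  Truncated to [-1, 1] and multiplied by the tent max 0 (j - |x|) they belong to \<open>Cc\<close>,
  and in the limit the integral of the tent times |F| is 0.\<close>

lemma AE_zero_if_integral_Cc_zero_real:
  fixes F :: "real ^ 'd::finite \<Rightarrow> real"
  assumes F: "F \<in> L1_loc" and zero: "\<And>\<psi>. \<psi> \<in> Cc \<Longrightarrow> (\<integral>x. \<psi> x * F x \<partial>lebesgue) = 0"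
  shows "AE x in lebesgue. F x = 0"
proof -
  have Fm[measurable]: "F \<in> borel_measurable lebesgue" by (rule L1_loc_measurable[OF F])
  have "(\<lambda>x. sgn (F x)) \<in> borel_measurable lebesgue" by measurable
  then have "(\<lambda>x. sgn (F x)) measurable_on UNIV"
    by (simp add: measurable_on_iff_borel_measurable lebesgue_on_UNIV_eq)
  then obtain N g where N: "negligible N" and g: "\<And>n. continuous_on UNIV (g n)"
    and lim: "\<And>x. x \<notin> N \<Longrightarrow> (\<lambda>n. g n x) \<longlonglongrightarrow> sgn (F x)"
    by (auto simp: measurable_on_def)
  have aeN: "AE x in lebesgue. x \<notin> N"
    using N by (intro AE_not_in) (simp add: negligible_iff_null_sets)
  have "AE x in lebesgue. norm x < real j \<longrightarrow> F x = 0" for j :: nat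
  proof -
    define c :: "real ^ 'd \<Rightarrow> real" where "c x = max 0 (real j - norm x)" for x
    define h where "h n x = c x * max (- 1) (min 1 (g n x))" for n x
    have c: "c \<in> Cc" by (auto simp: Cc_def c_def intro!: continuous_intros exI[of _ "real j"])
    have h: "h n \<in> Cc" for n
      unfolding h_def using bounded_bilinear.Cc_bilinear_left[OF bounded_bilinear_mult c] g[of n]
      by (simp add: continuous_intros)
    have cF: "integrable lebesgue (\<lambda>x. c x * F x)"
      using euclidean_bilinear.integrable_Cc_L1_loc[OF euclidean_bilinear_scaleR c F] by simp
    have hm: "h n \<in> borel_measurable lebesgue" "c \<in> borel_measurable lebesgue" for n
      by (intro continuous_imp_measurable_lebesgue Cc_continuous h c)+
    have "(\<lambda>n. \<integral>x. h n x * F x \<partial>lebesgue) \<longlonglongrightarrow> (\<integral>x. c x * \<bar>F x\<bar> \<partial>lebesgue)"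
    proof (rule integral_dominated_convergence[where w="\<lambda>x. norm (c x * F x)"])
      show "AE x in lebesgue. (\<lambda>n. h n x * F x) \<longlonglongrightarrow> c x * \<bar>F x\<bar>"
        using aeN
      proof eventually_elim
        case (elim x)
        have "(\<lambda>n. h n x * F x) \<longlonglongrightarrow> c x * max (- 1) (min 1 (sgn (F x))) * F x"
          unfolding h_def by (intro tendsto_intros lim elim)
        also have "c x * max (- 1) (min 1 (sgn (F x))) * F x = c x * \<bar>F x\<bar>"
          by (simp add: sgn_if)
        finally show ?case .
      qed
      show "AE x in lebesgue. norm (h n x * F x) \<le> norm (c x * F x)" for n
      proof (intro AE_I2)
        fix x
        have "\<bar>max (- 1) (min 1 (g n x))\<bar> \<le> 1" by auto
        then have "\<bar>c x\<bar> * \<bar>max (- 1) (min 1 (g n x))\<bar> \<le> \<bar>c x\<bar>" by (intro mult_left_le) auto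
        then show "norm (h n x * F x) \<le> norm (c x * F x)"
          unfolding h_def by (simp add: abs_mult mult_right_mono)
      qed
    qed (use hm cF in \<open>auto intro!: integrable_norm\<close>)
    then have "(\<integral>x. c x * \<bar>F x\<bar> \<partial>lebesgue) = 0"
      using zero[OF h] by (simp add: LIMSEQ_const_iff)
    moreover have "integrable lebesgue (\<lambda>x. c x * \<bar>F x\<bar>)"
      using integrable_norm[OF cF] by (simp add: abs_mult c_def)
    ultimately have "AE x in lebesgue. c x * \<bar>F x\<bar> = 0"
      by (subst (asm) integral_nonneg_eq_0_iff_AE) (auto simp: c_def)
    then show ?thesis by eventually_elim (auto simp: c_def)
  qed
  then have "AE x in lebesgue. \<forall>j::nat. norm x < real j \<longrightarrow> F x = 0"
    by (subst AE_all_countable) blast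
  then show ?thesis by eventually_elim (meson reals_Archimedean2)
qed

lemma AE_eq_if_integral_test_eq:
  fixes F G :: "real ^ 'd::finite \<Rightarrow> 'b::euclidean_space"
  assumes F: "F \<in> L1_loc" and G: "G \<in> L1_loc"
    and eq: "\<And>\<phi> :: real ^ 'd \<Rightarrow> real. \<phi> \<in> test_functions \<Longrightarrow> (\<integral>x. \<phi> x *\<^sub>R F x \<partial>lebesgue) = (\<integral>x. \<phi> x *\<^sub>R G x \<partial>lebesgue)"
  shows "AE x in lebesgue. F x = G x"
proof -
  interpret sc: euclidean_bilinear "scaleR :: real \<Rightarrow> 'b \<Rightarrow> 'b" by (rule euclidean_bilinear_scaleR)
  have "AE x in lebesgue. (F x - G x) \<bullet> b = 0" for b
  proof (rule AE_zero_if_integral_Cc_zero_real)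
    have "(\<lambda>x. F x + (-1) *\<^sub>R G x) \<in> L1_loc"
      by (intro L1_loc_add F sc.L1_loc_bilinear G continuous_on_const)
    then have D: "(\<lambda>x. F x - G x) \<in> L1_loc" by simp
    show "(\<lambda>x. (F x - G x) \<bullet> b) \<in> L1_loc"
      using euclidean_linear.L1_loc_linear[OF _ D, of "\<lambda>x. x \<bullet> b"]
      by (simp add: euclidean_linear_def bounded_linear_inner_left)
    fix \<psi> :: "real ^ 'd \<Rightarrow> real" assume \<psi>: "\<psi> \<in> Cc"
    have int: "integrable lebesgue (\<lambda>x. \<psi> x *\<^sub>R F x)" "integrable lebesgue (\<lambda>x. \<psi> x *\<^sub>R G x)"
      by (intro sc.integrable_Cc_L1_loc \<psi> F G)+
    have "(\<integral>x. \<psi> x * ((F x - G x) \<bullet> b) \<partial>lebesgue) = (\<integral>x. (\<psi> x *\<^sub>R F x - \<psi> x *\<^sub>R G x) \<bullet> b \<partial>lebesgue)"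
      by (simp add: inner_diff_left right_diff_distrib)
    also have "\<dots> = (\<integral>x. \<psi> x *\<^sub>R F x - \<psi> x *\<^sub>R G x \<partial>lebesgue) \<bullet> b"
      by (rule integral_inner_left) (intro Bochner_Integration.integrable_diff int)
    also have "\<dots> = 0"
      using int sc.integral_Cc_eq_of_test[OF F G \<psi> eq] by simp
    finally show "(\<integral>x. \<psi> x * ((F x - G x) \<bullet> b) \<partial>lebesgue) = 0" .
  qed
  then have "AE x in lebesgue. \<forall>b\<in>Basis. (F x - G x) \<bullet> b = 0"
    by (auto simp: AE_ball_countable countable_finite)
  then show ?thesis
    by eventually_elim (auto intro: euclidean_eqI simp: inner_diff_left)
qed

section \<open>Weak derivatives\<close>

lemma is_weak_pdiff_L1_loc:
  assumes "is_weak_pdiff \<alpha> F G"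
  shows "F \<in> L1_loc" "G \<in> L1_loc"
  using assms by (auto simp: is_weak_pdiff_def)

lemma is_weak_pdiff_integral:
  assumes "is_weak_pdiff \<alpha> F G" "\<phi> \<in> test_functions"
  shows "(\<integral>x. pdiff \<alpha> \<phi> x *\<^sub>R F x \<partial>lebesgue) = - (\<integral>x. \<phi> x *\<^sub>R G x \<partial>lebesgue)"
  using assms unfolding is_weak_pdiff_def by blast

lemma is_weak_pdiff_unique:
  assumes "is_weak_pdiff \<alpha> F G" "is_weak_pdiff \<alpha> F H"
  shows "AE x in lebesgue. G x = H x"
  using assms by (intro AE_eq_if_integral_test_eq) (auto simp: is_weak_pdiff_def)

lemma is_weak_pdiff_cong_AE:
  assumes "is_weak_pdiff \<alpha> F G" "AE x in lebesgue. F x = F' x" "AE x in lebesgue. G x = G' x"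
    and "F' \<in> borel_measurable lebesgue" "G' \<in> borel_measurable lebesgue"
  shows "is_weak_pdiff \<alpha> F' G'"
proof -
  note L = is_weak_pdiff_L1_loc[OF assms(1)]
  have eq: "(\<integral>x. k x *\<^sub>R H x \<partial>lebesgue) = (\<integral>x. k x *\<^sub>R H' x \<partial>lebesgue)"
    if "k \<in> test_functions" "AE x in lebesgue. H x = H' x" "H \<in> borel_measurable lebesgue" "H' \<in> borel_measurable lebesgue"
    for k and H H' :: "real ^ 'a \<Rightarrow> 'b"
  proof (rule integral_cong_AE)
    have "k \<in> borel_measurable lebesgue"
      using that(1) by (intro continuous_imp_measurable_lebesgue Cc_continuous test_functions_Cc)
    then show "(\<lambda>x. k x *\<^sub>R H x) \<in> borel_measurable lebesgue" "(\<lambda>x. k x *\<^sub>R H' x) \<in> borel_measurable lebesgue"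
      using that by auto
  qed (use that(2) in \<open>auto elim: eventually_mono\<close>)
  show ?thesis
    unfolding is_weak_pdiff_def
  proof (intro conjI ballI)
    show "F' \<in> L1_loc" "G' \<in> L1_loc"
      using L assms by (auto intro: L1_loc_cong_AE)
    fix \<phi> :: "real ^ 'a \<Rightarrow> real" assume \<phi>: "\<phi> \<in> test_functions"
    show "(\<integral>x. pdiff \<alpha> \<phi> x *\<^sub>R F' x \<partial>lebesgue) = - (\<integral>x. \<phi> x *\<^sub>R G' x \<partial>lebesgue)"
      using eq[OF test_functions_pdiff[OF \<phi>] assms(2) L1_loc_measurable[OF L(1)] assms(4)]
        eq[OF \<phi> assms(3) L1_loc_measurable[OF L(2)] assms(5)] is_weak_pdiff_integral[OF assms(1) \<phi>]
      by simp
  qed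
qed

lemma (in euclidean_linear) is_weak_pdiff_linear:
  assumes "is_weak_pdiff \<alpha> F G"
  shows "is_weak_pdiff \<alpha> (\<lambda>x. f (F x)) (\<lambda>x. f (G x))"
proof -
  note L = is_weak_pdiff_L1_loc[OF assms]
  have eq: "(\<integral>x. k x *\<^sub>R f (H x) \<partial>lebesgue) = f (\<integral>x. k x *\<^sub>R H x \<partial>lebesgue)"
    if "k \<in> test_functions" "H \<in> L1_loc" for k and H :: "real ^ 'c \<Rightarrow> 'a"
    using integral_bounded_linear[OF bounded_linear
        euclidean_bilinear.integrable_Cc_L1_loc[OF euclidean_bilinear_scaleR test_functions_Cc[OF that(1)] that(2)]]
    by (simp add: scaleR)
  show ?thesis
    unfolding is_weak_pdiff_def
  proof (intro conjI ballI L1_loc_linear L)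
    fix \<phi> :: "real ^ 'c \<Rightarrow> real" assume \<phi>: "\<phi> \<in> test_functions"
    show "(\<integral>x. pdiff \<alpha> \<phi> x *\<^sub>R f (F x) \<partial>lebesgue) = - (\<integral>x. \<phi> x *\<^sub>R f (G x) \<partial>lebesgue)"
      using is_weak_pdiff_integral[OF assms \<phi>] \<phi> by (simp add: eq L test_functions_pdiff neg)
  qed
qed

lemma is_weak_pdiff_add:
  assumes "is_weak_pdiff \<alpha> F G" "is_weak_pdiff \<alpha> F' G'"
  shows "is_weak_pdiff \<alpha> (\<lambda>x. F x + F' x) (\<lambda>x. G x + G' x)"
proof -
  note L = is_weak_pdiff_L1_loc[OF assms(1)] is_weak_pdiff_L1_loc[OF assms(2)]
  have eq: "(\<integral>x. k x *\<^sub>R (H x + H' x) \<partial>lebesgue) = (\<integral>x. k x *\<^sub>R H x \<partial>lebesgue) + (\<integral>x. k x *\<^sub>R H' x \<partial>lebesgue)"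
    if "k \<in> test_functions" "H \<in> L1_loc" "H' \<in> L1_loc" for k and H H' :: "real ^ 'a \<Rightarrow> 'b"
    unfolding scaleR_add_right
    by (intro Bochner_Integration.integral_add euclidean_bilinear.integrable_Cc_L1_loc[OF euclidean_bilinear_scaleR]
        test_functions_Cc that)
  show ?thesis
    using assms by (auto simp: is_weak_pdiff_def eq test_functions_pdiff intro!: L1_loc_add)
qed

lemma is_weak_pdiff_zero: "is_weak_pdiff \<alpha> (\<lambda>x. 0) (\<lambda>x. 0)"
  by (simp add: is_weak_pdiff_def continuous_imp_L1_loc)

lemma is_weak_pdiff_sum:
  assumes "\<And>i. i \<in> I \<Longrightarrow> is_weak_pdiff \<alpha> (F i) (G i)"
  shows "is_weak_pdiff \<alpha> (\<lambda>x. \<Sum>i\<in>I. F i x) (\<lambda>x. \<Sum>i\<in>I. G i x)"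
  using assms by (induction I rule: infinite_finite_induct) (auto intro: is_weak_pdiff_add is_weak_pdiff_zero)

text \<open>Coefficients are only of class C^1, and so is their product with a test function. The
  defining identity is therefore extended to such functions by mollifying \<psi>.\<close>

lemma weak_pdiff_integral_C_1:
  assumes FG: "is_weak_pdiff \<alpha> F G" and \<psi>: "\<psi> \<in> C_k 1" "\<psi> \<in> Cc"
  shows "(\<integral>x. pdiff \<alpha> \<psi> x *\<^sub>R F x \<partial>lebesgue) = - (\<integral>x. \<psi> x *\<^sub>R G x \<partial>lebesgue)"
proof -
  note L = is_weak_pdiff_L1_loc[OF FG]
  interpret sc: euclidean_bilinear scaleR by (rule euclidean_bilinear_scaleR)
  have t: "conv (eta n) \<psi> \<in> test_functions" for n
    by (intro conv_test_functions eta_test \<psi>)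
  \<comment> \<open>The derivative passes to the kernel and from there to \<psi>.\<close>
  have "pdiff \<alpha> (conv (eta n) \<psi>) = conv (eta n) (pdiff \<alpha> \<psi>)" for n
    using conv_C_k(2)[OF eta_test continuous_imp_L1_loc[OF Cc_continuous[OF \<psi>(2)]]]
      conv_weak_pdiff[OF eta_test C_1_is_weak_pdiff[OF \<psi>(1)]] by simp
  moreover have "(\<integral>x. pdiff \<alpha> (conv (eta n) \<psi>) x *\<^sub>R F x \<partial>lebesgue) = - (\<integral>x. conv (eta n) \<psi> x *\<^sub>R G x \<partial>lebesgue)" for n
    using FG t by (simp add: is_weak_pdiff_def)
  ultimately have "(\<lambda>n. \<integral>x. conv (eta n) (pdiff \<alpha> \<psi>) x *\<^sub>R F x \<partial>lebesgue) \<longlonglongrightarrow> - (\<integral>x. \<psi> x *\<^sub>R G x \<partial>lebesgue)"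
    using tendsto_minus[OF sc.conv_eta_weak_limit[OF \<psi>(2) L(2)]] by simp
  with sc.conv_eta_weak_limit[OF Cc_pdiff[OF \<psi>] L(1)] show ?thesis
    by (rule LIMSEQ_unique)
qed

text \<open>The weak derivative of \<open>F\<close> is tested with the product of \<phi> and
  \<open>a\<close>.\<close>

lemma is_weak_pdiff_scaleR:
  assumes a: "a \<in> C_k 1" and FG: "is_weak_pdiff \<alpha> F G"
  shows "is_weak_pdiff \<alpha> (\<lambda>x. a x *\<^sub>R F x) (\<lambda>x. pdiff \<alpha> a x *\<^sub>R F x + a x *\<^sub>R G x)"
proof -
  note L = is_weak_pdiff_L1_loc[OF FG]
  interpret sc: euclidean_bilinear "scaleR :: real \<Rightarrow> 'b \<Rightarrow> 'b" by (rule euclidean_bilinear_scaleR)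
  have ca: "continuous_on UNIV a" "continuous_on UNIV (pdiff \<alpha> a)"
    using a C_k_continuous[OF a] by auto
  have L1: "(\<lambda>x. a x *\<^sub>R F x) \<in> L1_loc" "(\<lambda>x. pdiff \<alpha> a x *\<^sub>R F x) \<in> L1_loc" "(\<lambda>x. a x *\<^sub>R G x) \<in> L1_loc"
    by (intro sc.L1_loc_bilinear ca L)+
  show ?thesis
    unfolding is_weak_pdiff_def
  proof (intro conjI ballI L1 L1_loc_add)
    fix \<phi> :: "real ^ 'a \<Rightarrow> real" assume \<phi>: "\<phi> \<in> test_functions"
    note \<phi>Cc = test_functions_Cc[OF \<phi>] test_functions_Cc[OF test_functions_pdiff[OF \<phi>]]
    note \<phi>1 = test_functions_C_k[OF \<phi>, of 1]
    have p: "(\<lambda>x. \<phi> x * a x) \<in> C_k 1" "(\<lambda>x. \<phi> x * a x) \<in> Cc"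
      using bounded_bilinear.C_k_bilinear[OF bounded_bilinear_mult \<phi>1 a]
        bounded_bilinear.Cc_bilinear_left[OF bounded_bilinear_mult \<phi>Cc(1) ca(1)] .
    have pd: "pdiff \<alpha> (\<lambda>x. \<phi> x * a x) x = \<phi> x * pdiff \<alpha> a x + pdiff \<alpha> \<phi> x * a x" for x
      using a \<phi>1 by (intro bounded_bilinear.pdiff_bilinear[OF bounded_bilinear_mult]) auto
    have i: "integrable lebesgue (\<lambda>x. \<phi> x *\<^sub>R (pdiff \<alpha> a x *\<^sub>R F x))"
      "integrable lebesgue (\<lambda>x. pdiff \<alpha> \<phi> x *\<^sub>R (a x *\<^sub>R F x))" "integrable lebesgue (\<lambda>x. \<phi> x *\<^sub>R (a x *\<^sub>R G x))"
      by (intro sc.integrable_Cc_L1_loc \<phi>Cc L1)+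
    have "(\<integral>x. \<phi> x *\<^sub>R (pdiff \<alpha> a x *\<^sub>R F x) + pdiff \<alpha> \<phi> x *\<^sub>R (a x *\<^sub>R F x) \<partial>lebesgue)
        = - (\<integral>x. \<phi> x *\<^sub>R (a x *\<^sub>R G x) \<partial>lebesgue)"
      using weak_pdiff_integral_C_1[OF FG p] by (simp add: pd scaleR_add_left)
    then have "(\<integral>x. \<phi> x *\<^sub>R (pdiff \<alpha> a x *\<^sub>R F x) \<partial>lebesgue) + (\<integral>x. pdiff \<alpha> \<phi> x *\<^sub>R (a x *\<^sub>R F x) \<partial>lebesgue)
        = - (\<integral>x. \<phi> x *\<^sub>R (a x *\<^sub>R G x) \<partial>lebesgue)"
      using i by simp
    then show "(\<integral>x. pdiff \<alpha> \<phi> x *\<^sub>R (a x *\<^sub>R F x) \<partial>lebesgue)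
        = - (\<integral>x. \<phi> x *\<^sub>R (pdiff \<alpha> a x *\<^sub>R F x + a x *\<^sub>R G x) \<partial>lebesgue)"
      unfolding scaleR_add_right using i by (simp add: eq_neg_iff_add_eq_0 algebra_simps)
  qed
qed

text \<open>Expanding the coefficient in an orthonormal basis leaves scalar coefficients in front of
  fixed linear images of \<open>F\<close>, so the scalar product rule suffices.\<close>

lemma (in euclidean_bilinear) is_weak_pdiff_bilinear:
  assumes A: "A \<in> C_k 1" and FG: "is_weak_pdiff \<alpha> F G"
  shows "is_weak_pdiff \<alpha> (\<lambda>x. prod (A x) (F x)) (\<lambda>x. prod (pdiff \<alpha> A x) (F x) + prod (A x) (G x))"
proof -
  have rep: "prod a y = (\<Sum>b\<in>Basis. (a \<bullet> b) *\<^sub>R prod b y)" for a y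
    by (subst (1) euclidean_representation[of a, symmetric]) (simp add: sum_left scaleR_left)
  have Ab: "(\<lambda>x. A x \<bullet> b) \<in> C_k 1" "pdiff \<alpha> (\<lambda>x. A x \<bullet> b) x = pdiff \<alpha> A x \<bullet> b" for b x
    using bounded_linear.C_k_linear[OF bounded_linear_inner_left A]
      bounded_linear.pdiff_linear[OF bounded_linear_inner_left, of A x \<alpha> b] A by auto
  have "is_weak_pdiff \<alpha> (\<lambda>x. \<Sum>b\<in>Basis. (A x \<bullet> b) *\<^sub>R prod b (F x))
     (\<lambda>x. \<Sum>b\<in>Basis. pdiff \<alpha> (\<lambda>x. A x \<bullet> b) x *\<^sub>R prod b (F x) + (A x \<bullet> b) *\<^sub>R prod b (G x))"
    by (intro is_weak_pdiff_sum is_weak_pdiff_scaleR Ab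
        euclidean_linear.is_weak_pdiff_linear[OF euclidean_linear_right] FG)
  then show ?thesis
    unfolding rep[of "A _"] rep[of "pdiff \<alpha> A _"] by (simp add: Ab sum.distrib)
qed

section \<open>Vector-valued functions and weak gradients\<close>

lemma norm_axis: "norm (axis \<alpha> y :: 'b::real_normed_vector ^ 'd::finite) = norm y"
proof -
  have "(norm (axis \<alpha> y $ \<beta> :: 'b))\<^sup>2 = (if \<beta> = \<alpha> then (norm y)\<^sup>2 else 0)" for \<beta> :: 'd
    by (simp add: axis_def)
  then show ?thesis by (simp add: norm_vec_def L2_set_def)
qed

lemma bounded_linear_axis: "bounded_linear (axis \<alpha> :: 'b::real_normed_vector \<Rightarrow> 'b ^ 'd::finite)"
proof (rule bounded_linear_intro[where K=1])
  show "norm (axis \<alpha> x :: 'b ^ 'd) \<le> norm x * 1" for x :: 'b by (simp add: norm_axis)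
qed (simp_all add: vec_eq_iff axis_def)

lemma euclidean_linear_axis: "euclidean_linear (axis \<alpha> :: 'b::euclidean_space \<Rightarrow> 'b ^ 'd::finite)"
  by (simp add: euclidean_linear_def bounded_linear_axis)

text \<open>Reduces statements about tuples to the rules for sums and for linear maps.\<close>

lemma vec_lambda_eq_sum_axis: "(\<chi> \<alpha>. y \<alpha>) = (\<Sum>\<alpha>\<in>UNIV. axis \<alpha> (y \<alpha> :: 'b::real_normed_vector))"
  by (simp add: vec_eq_iff axis_def sum.delta cong: if_cong)

lemma is_weak_pdiff_vec:
  assumes "\<And>i. is_weak_pdiff \<alpha> (F i) (G i)"
  shows "is_weak_pdiff \<alpha> (\<lambda>x. \<chi> i. F i x) (\<lambda>x. \<chi> i. G i x)"
  unfolding vec_lambda_eq_sum_axis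
  by (intro is_weak_pdiff_sum euclidean_linear.is_weak_pdiff_linear[OF euclidean_linear_axis] assms)

lemma is_weak_pdiff_vec_nth:
  assumes "is_weak_pdiff \<alpha> F G"
  shows "is_weak_pdiff \<alpha> (\<lambda>x. F x $ i) (\<lambda>x. G x $ i)"
  by (rule euclidean_linear.is_weak_pdiff_linear[OF euclidean_linear_vec_nth assms])

lemma L2_vec:
  fixes F :: "'n::finite \<Rightarrow> real ^ 'd::finite \<Rightarrow> 'b::euclidean_space"
  assumes "\<And>i. F i \<in> L2"
  shows "(\<lambda>x. \<chi> i. F i x) \<in> L2" "norm_L2 (\<lambda>x. \<chi> i. F i x) \<le> (\<Sum>i\<in>UNIV. norm_L2 (F i))"
proof -
  have "(\<lambda>x. axis i (F i x) :: 'b ^ 'n) \<in> L2 \<and> norm_L2 (\<lambda>x. axis i (F i x) :: 'b ^ 'n) \<le> 1 * norm_L2 (F i)" for i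
  proof -
    have "(axis i :: 'b \<Rightarrow> 'b ^ 'n) \<in> borel_measurable borel"
      by (intro borel_measurable_continuous_onI linear_continuous_on bounded_linear_axis)
    then have "(\<lambda>x. axis i (F i x) :: 'b ^ 'n) \<in> borel_measurable lebesgue"
      using L2_measurable[OF assms] by measurable
    then show ?thesis
      using L2_bound[OF _ assms[of i], of "\<lambda>x. axis i (F i x) :: 'b ^ 'n" 1] by (simp add: norm_axis)
  qed
  then show "(\<lambda>x. \<chi> i. F i x) \<in> L2" "norm_L2 (\<lambda>x. \<chi> i. F i x) \<le> (\<Sum>i\<in>UNIV. norm_L2 (F i))"
    unfolding vec_lambda_eq_sum_axis
    by (auto intro!: L2_sum order_trans[OF norm_L2_sum] sum_mono)
qed

lemma L1_loc_vec:
  assumes "\<And>i. F i \<in> L1_loc"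
  shows "(\<lambda>x. \<chi> i. F i x) \<in> L1_loc"
proof -
  have "(\<lambda>x. \<Sum>i\<in>I. axis i (F i x)) \<in> L1_loc" for I
    by (induction I rule: infinite_finite_induct)
       (auto intro!: L1_loc_add euclidean_linear.L1_loc_linear[OF euclidean_linear_axis] assms
         simp: continuous_imp_L1_loc)
  then show ?thesis by (simp add: vec_lambda_eq_sum_axis)
qed

lemma is_weak_grad_L1_loc:
  assumes "is_weak_grad F G"
  shows "G \<in> L1_loc"
proof -
  have "(\<lambda>x. \<chi> \<alpha>. G x $ \<alpha>) \<in> L1_loc"
    using assms by (intro L1_loc_vec) (auto simp: is_weak_grad_def is_weak_pdiff_def)
  then show ?thesis by simp
qed

lemma is_weak_grad_unique:
  assumes "is_weak_grad F G" "is_weak_grad F H"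
  shows "AE x in lebesgue. G x = H x"
proof -
  have "AE x in lebesgue. G x $ \<alpha> = H x $ \<alpha>" for \<alpha>
    using assms by (intro is_weak_pdiff_unique[of \<alpha> F]) (auto simp: is_weak_grad_def)
  then have "AE x in lebesgue. \<forall>\<alpha>\<in>UNIV. G x $ \<alpha> = H x $ \<alpha>"
    by (subst AE_ball_countable) (auto intro: countable_finite)
  then show ?thesis by eventually_elim (simp add: vec_eq_iff)
qed

lemma is_weak_grad_wgrad: "is_weak_grad F G \<Longrightarrow> is_weak_grad F (wgrad F)"
  unfolding wgrad_def by (rule someI[of "is_weak_grad F"])

lemma wgrad_AE: "is_weak_grad F G \<Longrightarrow> AE x in lebesgue. G x = wgrad F x"
  by (rule is_weak_grad_unique[OF _ is_weak_grad_wgrad])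

lemma wgrad_measurable: "is_weak_grad F G \<Longrightarrow> wgrad F \<in> borel_measurable lebesgue"
  by (intro L1_loc_measurable is_weak_grad_L1_loc[OF is_weak_grad_wgrad])

lemma wgrad_L2:
  assumes "is_weak_grad F G" "G \<in> L2"
  shows "wgrad F \<in> L2" "norm_L2 (wgrad F) = norm_L2 G"
  using L2_cong_AE[OF assms(2) wgrad_AE[OF assms(1)] wgrad_measurable[OF assms(1)]] by auto

lemma is_weak_grad_cong_AE:
  assumes "is_weak_grad F G" "AE x in lebesgue. F x = F' x" "F' \<in> borel_measurable lebesgue"
  shows "is_weak_grad F' G"
  unfolding is_weak_grad_def
proof
  fix \<alpha>
  have FG: "is_weak_pdiff \<alpha> F (\<lambda>x. G x $ \<alpha>)" using assms(1) by (simp add: is_weak_grad_def)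
  show "is_weak_pdiff \<alpha> F' (\<lambda>x. G x $ \<alpha>)"
    by (rule is_weak_pdiff_cong_AE[OF FG assms(2) _ assms(3) L1_loc_measurable[OF is_weak_pdiff_L1_loc(2)[OF FG]]]) simp
qed

text \<open>The classical counterpart of \<open>wgrad\<close>, with the same index order but no
  choice involved. For functions of class C^1 the two agree almost everywhere.\<close>

definition grad :: "(real ^ 'd::finite \<Rightarrow> 'b::real_normed_vector) \<Rightarrow> real ^ 'd \<Rightarrow> 'b ^ 'd"
  where "grad F x = (\<chi> \<alpha>. pdiff \<alpha> F x)"

lemma C_1_is_weak_grad: "F \<in> C_k 1 \<Longrightarrow> is_weak_grad F (grad F)"
  for F :: "real ^ 'd::finite \<Rightarrow> 'b::euclidean_space"
  by (simp add: is_weak_grad_def grad_def C_1_is_weak_pdiff del: C_k.simps)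

lemma continuous_grad: "F \<in> C_k 1 \<Longrightarrow> continuous_on UNIV (grad F)"
  unfolding grad_def[abs_def] by (intro continuous_on_vec_lambda) auto

lemma test_functions_grad_Cc: "\<phi> \<in> test_functions \<Longrightarrow> grad \<phi> \<in> Cc"
proof -
  assume \<phi>: "\<phi> \<in> test_functions"
  then obtain R where "\<And>x. R < norm x \<Longrightarrow> \<phi> x = 0" by (auto simp: test_functions_iff)
  then have "grad \<phi> x = 0" if "R < norm x" for x
    using that by (auto simp: grad_def vec_eq_iff intro: pdiff_eq_0_outside[of R])
  then show ?thesis
    using continuous_grad[OF test_functions_C_k[OF \<phi>]] by (auto simp: Cc_def)
qed

text \<open>Weak derivatives are defined with scalar test functions, while the weak equation and the
  Riesz functional pair vector-valued ones by the inner product. Expansion along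
  \<open>Basis\<close> translates between the two.\<close>

lemma weak_pdiff_integral_inner:
  fixes F G :: "real ^ 'd::finite \<Rightarrow> 'b::euclidean_space"
  assumes FG: "is_weak_pdiff \<alpha> F G" and \<phi>: "\<phi> \<in> test_functions"
  shows "(\<integral>x. F x \<bullet> pdiff \<alpha> \<phi> x \<partial>lebesgue) = - (\<integral>x. G x \<bullet> \<phi> x \<partial>lebesgue)"
proof -
  note L = is_weak_pdiff_L1_loc[OF FG]
  have t: "(\<lambda>x. \<phi> x \<bullet> b) \<in> test_functions" for b
    by (rule bounded_linear.test_functions_linear[OF bounded_linear_inner_left \<phi>])
  have p: "pdiff \<alpha> (\<lambda>x. \<phi> x \<bullet> b) x = pdiff \<alpha> \<phi> x \<bullet> b" for b x
    using C_k_SucD(1)[OF test_functions_C_k[OF \<phi>, of "Suc 0"]]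
    by (rule bounded_linear.pdiff_linear[OF bounded_linear_inner_left])
  have sum: "(\<integral>x. H x \<bullet> \<psi> x \<partial>lebesgue) = (\<Sum>b\<in>Basis. (\<integral>x. (\<psi> x \<bullet> b) *\<^sub>R H x \<partial>lebesgue) \<bullet> b)"
    if H: "H \<in> L1_loc" and \<psi>: "\<psi> \<in> Cc" for H \<psi> :: "real ^ 'd \<Rightarrow> 'b"
  proof -
    have "(\<lambda>x. \<psi> x \<bullet> b) \<in> Cc" for b
      by (rule bounded_bilinear.Cc_bilinear_left[OF bounded_bilinear_inner \<psi> continuous_on_const])
    then have i: "integrable lebesgue (\<lambda>x. (\<psi> x \<bullet> b) *\<^sub>R H x)" for b
      by (intro euclidean_bilinear.integrable_Cc_L1_loc[OF euclidean_bilinear_scaleR] H)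
    have "(\<integral>x. H x \<bullet> \<psi> x \<partial>lebesgue) = (\<integral>x. (\<Sum>b\<in>Basis. ((\<psi> x \<bullet> b) *\<^sub>R H x) \<bullet> b) \<partial>lebesgue)"
      by (intro arg_cong[where f="integral\<^sup>L lebesgue"] ext) (subst euclidean_inner, simp add: mult.commute)
    also have "\<dots> = (\<Sum>b\<in>Basis. (\<integral>x. ((\<psi> x \<bullet> b) *\<^sub>R H x) \<bullet> b \<partial>lebesgue))"
      by (intro Bochner_Integration.integral_sum integrable_inner_left i)
    also have "\<dots> = (\<Sum>b\<in>Basis. (\<integral>x. (\<psi> x \<bullet> b) *\<^sub>R H x \<partial>lebesgue) \<bullet> b)"
      by (intro sum.cong refl integral_inner_left i)
    finally show ?thesis .
  qed
  show ?thesis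
    unfolding sum[OF L(1) test_functions_Cc[OF test_functions_pdiff[OF \<phi>]]] sum[OF L(2) test_functions_Cc[OF \<phi>]]
    using is_weak_pdiff_integral[OF FG t] by (simp add: p sum_negf)
qed

text \<open>The converse translation, with a scalar test function times a basis vector. It turns the
  Riesz representative into a weak derivative.\<close>

lemma is_weak_pdiff_innerI:
  fixes F G :: "real ^ 'd::finite \<Rightarrow> 'b::euclidean_space"
  assumes L: "F \<in> L1_loc" "G \<in> L1_loc"
    and eq: "\<And>\<phi>. \<phi> \<in> test_functions \<Longrightarrow> (\<integral>x. F x \<bullet> pdiff \<alpha> \<phi> x \<partial>lebesgue) = - (\<integral>x. G x \<bullet> \<phi> x \<partial>lebesgue)"
  shows "is_weak_pdiff \<alpha> F G"
  unfolding is_weak_pdiff_def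
proof (intro conjI ballI L)
  fix \<phi> :: "real ^ 'd \<Rightarrow> real" assume \<phi>: "\<phi> \<in> test_functions"
  have i: "integrable lebesgue (\<lambda>x. \<psi> x *\<^sub>R H x)" if "\<psi> \<in> test_functions" "H \<in> L1_loc" for \<psi> :: "real ^ 'd \<Rightarrow> real" and H :: "real ^ 'd \<Rightarrow> 'b"
    using that by (intro euclidean_bilinear.integrable_Cc_L1_loc[OF euclidean_bilinear_scaleR] test_functions_Cc)
  show "(\<integral>x. pdiff \<alpha> \<phi> x *\<^sub>R F x \<partial>lebesgue) = - (\<integral>x. \<phi> x *\<^sub>R G x \<partial>lebesgue)"
  proof (rule euclidean_eqI)
    fix b :: 'b assume "b \<in> Basis"
    have p: "pdiff \<alpha> (\<lambda>x. \<phi> x *\<^sub>R b) x = pdiff \<alpha> \<phi> x *\<^sub>R b" for x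
      using C_k_SucD(1)[OF test_functions_C_k[OF \<phi>, of "Suc 0"]]
      by (rule bounded_linear.pdiff_linear[OF bounded_linear_scaleR_left])
    have "(\<integral>x. pdiff \<alpha> \<phi> x *\<^sub>R F x \<partial>lebesgue) \<bullet> b = (\<integral>x. (pdiff \<alpha> \<phi> x *\<^sub>R F x) \<bullet> b \<partial>lebesgue)"
      by (rule integral_inner_left[symmetric]) (intro i test_functions_pdiff \<phi> L)
    also have "\<dots> = (\<integral>x. F x \<bullet> pdiff \<alpha> (\<lambda>x. \<phi> x *\<^sub>R b) x \<partial>lebesgue)"
      by (simp add: p)
    also have "\<dots> = - (\<integral>x. (\<phi> x *\<^sub>R G x) \<bullet> b \<partial>lebesgue)"
      by (subst eq[OF test_functions_scaleR_const[OF \<phi>]]) simp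
    also have "(\<integral>x. (\<phi> x *\<^sub>R G x) \<bullet> b \<partial>lebesgue) = (\<integral>x. \<phi> x *\<^sub>R G x \<partial>lebesgue) \<bullet> b"
      by (rule integral_inner_left) (intro i \<phi> L)
    finally show "(\<integral>x. pdiff \<alpha> \<phi> x *\<^sub>R F x \<partial>lebesgue) \<bullet> b = (- (\<integral>x. \<phi> x *\<^sub>R G x \<partial>lebesgue)) \<bullet> b"
      by simp
  qed
qed

text \<open>The second derivatives of test functions commute because a derivative may be put on
  either factor of the convolution with a mollifier.\<close>

lemma pdiff_commute:
  fixes \<phi> :: "real ^ 'd::finite \<Rightarrow> 'b::euclidean_space"
  assumes \<phi>: "\<phi> \<in> test_functions"
  shows "pdiff \<alpha> (pdiff \<beta> \<phi>) = pdiff \<beta> (pdiff \<alpha> \<phi>)"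
proof (rule ext)
  fix x
  note t = test_functions_pdiff[OF \<phi>]
  have w: "is_weak_pdiff \<gamma> \<psi> (pdiff \<gamma> \<psi>)" if "\<psi> \<in> test_functions" for \<gamma> and \<psi> :: "real ^ 'd \<Rightarrow> 'b"
    by (intro C_1_is_weak_pdiff test_functions_C_k that)
  have L: "\<psi> \<in> L1_loc" if "\<psi> \<in> test_functions" for \<psi> :: "real ^ 'd \<Rightarrow> 'b"
    by (intro continuous_imp_L1_loc Cc_continuous test_functions_Cc that)
  have cw: "pdiff \<gamma> (conv (eta n) \<psi>) = conv (eta n) (pdiff \<gamma> \<psi>)" if "\<psi> \<in> test_functions"
    for n \<gamma> and \<psi> :: "real ^ 'd \<Rightarrow> 'b"
    unfolding conv_C_k(2)[OF eta_test L[OF that]] by (rule conv_weak_pdiff[OF eta_test w[OF that]])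
  have step': "pdiff \<alpha> (pdiff \<beta> (conv (eta n) \<phi>)) = pdiff \<beta> (conv (eta n) (pdiff \<alpha> \<phi>))" for n
  proof -
    have "pdiff \<alpha> (pdiff \<beta> (conv (eta n) \<phi>)) = conv (pdiff \<alpha> (pdiff \<beta> (eta n))) \<phi>"
      by (simp add: conv_C_k(2)[OF eta_test L[OF \<phi>]] conv_C_k(2)[OF test_functions_pdiff[OF eta_test] L[OF \<phi>]])
    also have "\<dots> = conv (pdiff \<beta> (eta n)) (pdiff \<alpha> \<phi>)"
      by (rule conv_weak_pdiff[OF test_functions_pdiff[OF eta_test] w[OF \<phi>]])
    also have "\<dots> = pdiff \<beta> (conv (eta n) (pdiff \<alpha> \<phi>))"
      by (rule conv_C_k(2)[OF eta_test L[OF t], symmetric])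
    finally show ?thesis .
  qed
  have sym: "conv (eta n) (pdiff \<alpha> (pdiff \<beta> \<phi>)) = conv (eta n) (pdiff \<beta> (pdiff \<alpha> \<phi>))" for n
    using step'[of n] by (simp only: cw[OF \<phi>] cw[OF t])
  have lim: "(\<lambda>n. conv (eta n) (pdiff \<alpha> (pdiff \<beta> \<phi>)) x) \<longlonglongrightarrow> pdiff \<alpha> (pdiff \<beta> \<phi>) x" for \<alpha> \<beta>
    by (intro conv_eta_tendsto Cc_continuous test_functions_Cc test_functions_pdiff \<phi>)
  show "pdiff \<alpha> (pdiff \<beta> \<phi>) x = pdiff \<beta> (pdiff \<alpha> \<phi>) x"
    by (rule LIMSEQ_unique[OF lim[of \<alpha> \<beta>, unfolded sym] lim[of \<beta> \<alpha>]])
qed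

section \<open>Regularity for elliptic systems\<close>

text \<open>No plateau is needed: the cutoffs only have to be bounded and to tend to 1 pointwise.\<close>

definition cutoff :: "nat \<Rightarrow> real ^ 'd::finite \<Rightarrow> real"
  where "cutoff j x = (1 / bump (0 :: real ^ 'd)) *\<^sub>R bump (0 + inverse (real (Suc j)) *\<^sub>R x)"

lemma cutoff_test: "cutoff j \<in> test_functions"
  unfolding cutoff_def[abs_def] by (intro test_functions_cmult test_functions_affine bump_test) simp

lemma pdiff_cutoff:
  fixes x :: "real ^ 'd::finite"
  shows "pdiff \<alpha> (cutoff j) x = inverse (real (Suc j)) * ((1 / bump (0 :: real ^ 'd)) * pdiff \<alpha> bump (inverse (real (Suc j)) *\<^sub>R x))"
proof -
  have d: "bump differentiable (at y)" for y :: "real ^ 'd"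
    using C_k_SucD(1)[OF bump_C_k[of "Suc 0"]] .
  note a = pdiff_affine[where t=0 and c="inverse (real (Suc j))", OF d]
  show ?thesis
    unfolding cutoff_def[abs_def] bounded_linear.pdiff_linear[OF bounded_linear_scaleR_right a(2)] a(1) by simp
qed

text \<open>The dilated argument tends to 0, and the factor 1 / bump 0 normalises the limit to
  1.\<close>

lemma cutoff_tendsto:
  fixes x :: "real ^ 'd::finite"
  shows "(\<lambda>j. cutoff j x) \<longlonglongrightarrow> 1"
proof -
  have lim: "(\<lambda>j. inverse (real (Suc j)) *\<^sub>R x) \<longlonglongrightarrow> 0"
    by (rule tendsto_eq_rhs[OF tendsto_scaleR[OF LIMSEQ_inverse_real_of_nat tendsto_const]]) simp
  have "isCont bump (0 :: real ^ 'd)"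
    using Cc_continuous[OF test_functions_Cc[OF bump_test[where 'a='d]]] by (simp add: continuous_on_eq_continuous_at)
  then have "(\<lambda>j. bump (inverse (real (Suc j)) *\<^sub>R x)) \<longlonglongrightarrow> bump (0 :: real ^ 'd)"
    by (rule isCont_tendsto_compose[where g=bump, OF _ lim])
  then have "(\<lambda>j. (1 / bump (0 :: real ^ 'd)) * bump (inverse (real (Suc j)) *\<^sub>R x)) \<longlonglongrightarrow> (1 / bump (0 :: real ^ 'd)) * bump (0 :: real ^ 'd)"
    by (intro tendsto_intros)
  then show ?thesis using bump_0[where 'a='d] by (simp add: cutoff_def)
qed

text \<open>Stretching the bump by j + 1 divides its derivatives by j + 1; this decay removes the
  error of cutting off before differentiating.\<close>

lemma cutoff_bounds:
  obtains C where "C \<ge> 0" "\<And>j x. \<bar>cutoff j (x :: real ^ 'd::finite)\<bar> \<le> C"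
    "\<And>j \<alpha> x. \<bar>pdiff \<alpha> (cutoff j) (x :: real ^ 'd)\<bar> \<le> inverse (real (Suc j)) * C"
proof -
  let ?b = "bump (0 :: real ^ 'd)"
  have b: "?b > 0" by (rule bump_0)
  obtain C0 where C0: "C0 \<ge> 0" "\<And>x :: real ^ 'd. norm (bump x) \<le> C0"
    using Cc_boundE[OF test_functions_Cc[OF bump_test]] by metis
  have "\<exists>C. C \<ge> 0 \<and> (\<forall>x :: real ^ 'd. norm (pdiff \<alpha> bump x) \<le> C)" for \<alpha>
    using Cc_boundE[OF test_functions_Cc[OF test_functions_pdiff[OF bump_test]]] by metis
  then obtain C1 where C1: "\<And>\<alpha>. C1 \<alpha> \<ge> 0" "\<And>\<alpha> (x :: real ^ 'd). norm (pdiff \<alpha> bump x) \<le> C1 \<alpha>"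
    by metis
  define C where "C = (1 / ?b) * (C0 + (\<Sum>\<alpha>\<in>UNIV. C1 \<alpha>))"
  have le: "C0 \<le> C0 + (\<Sum>\<alpha>\<in>UNIV. C1 \<alpha>)" "C1 \<alpha> \<le> C0 + (\<Sum>\<alpha>\<in>UNIV. C1 \<alpha>)" for \<alpha>
    using C0(1) C1(1) member_le_sum[of \<alpha> UNIV C1] by (auto intro: sum_nonneg add_increasing)
  have "C \<ge> 0" using b C0(1) C1(1) by (auto simp: C_def intro!: divide_nonneg_nonneg add_nonneg_nonneg sum_nonneg)
  moreover have "\<bar>cutoff j x\<bar> \<le> C" for j and x :: "real ^ 'd"
    using order_trans[OF C0(2) le(1)] b by (simp add: cutoff_def C_def abs_mult divide_right_mono)
  moreover have "\<bar>pdiff \<alpha> (cutoff j) x\<bar> \<le> inverse (real (Suc j)) * C" for j \<alpha> and x :: "real ^ 'd"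
  proof -
    have "\<bar>(1 / ?b) * pdiff \<alpha> bump (inverse (real (Suc j)) *\<^sub>R x)\<bar> \<le> C"
      using order_trans[OF C1(2) le(2)] b by (simp add: C_def abs_mult divide_right_mono)
    then have "inverse (real (Suc j)) * \<bar>(1 / ?b) * pdiff \<alpha> bump (inverse (real (Suc j)) *\<^sub>R x)\<bar> \<le> inverse (real (Suc j)) * C"
      by (intro mult_left_mono) auto
    then show ?thesis unfolding pdiff_cutoff abs_mult[of "inverse (real (Suc j))"] by simp
  qed
  ultimately show ?thesis using that by blast
qed

text \<open>A square integrable majorant dominates both the squares and the pairings with a fixed
  \<open>P\<close> in \<open>L2\<close>.\<close>

lemma L2_dominated:
  fixes H :: "nat \<Rightarrow> real ^ 'd::finite \<Rightarrow> 'b::euclidean_space" and W :: "real ^ 'd \<Rightarrow> real"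
  assumes m: "\<And>j. H j \<in> borel_measurable lebesgue" "H' \<in> borel_measurable lebesgue" and W: "W \<in> L2"
    and lim: "\<And>x. (\<lambda>j. H j x) \<longlonglongrightarrow> H' x" and le: "\<And>j x. norm (H j x) \<le> W x"
  shows "(\<lambda>j. norm_L2 (H j)) \<longlonglongrightarrow> norm_L2 H'" "P \<in> L2 \<Longrightarrow> (\<lambda>j. ip_L2 P (H j)) \<longlonglongrightarrow> ip_L2 P H'"
proof -
  have "(\<lambda>j. \<integral>x. (norm (H j x))\<^sup>2 \<partial>lebesgue) \<longlonglongrightarrow> (\<integral>x. (norm (H' x))\<^sup>2 \<partial>lebesgue)"
  proof (rule integral_dominated_convergence[where w="\<lambda>x. (norm (W x))\<^sup>2"])
    show "AE x in lebesgue. norm ((norm (H j x))\<^sup>2) \<le> (norm (W x))\<^sup>2" for j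
      using le by (intro AE_I2) (auto intro!: power_mono intro: order_trans[OF _ abs_ge_self])
    show "AE x in lebesgue. (\<lambda>j. (norm (H j x))\<^sup>2) \<longlonglongrightarrow> (norm (H' x))\<^sup>2"
      by (intro AE_I2 tendsto_intros lim)
  qed (use m L2_integrable_power2[OF W] in auto)
  then show "(\<lambda>j. norm_L2 (H j)) \<longlonglongrightarrow> norm_L2 H'"
    unfolding norm_L2_def by (rule tendsto_real_sqrt)
  assume P: "P \<in> L2"
  show "(\<lambda>j. ip_L2 P (H j)) \<longlonglongrightarrow> ip_L2 P H'"
    unfolding ip_L2_def
  proof (rule integral_dominated_convergence[where w="\<lambda>x. norm (P x) * norm (W x)"])
    show "AE x in lebesgue. norm (P x \<bullet> H j x) \<le> norm (P x) * norm (W x)" for j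
    proof (intro AE_I2)
      fix x
      have "norm (P x \<bullet> H j x) \<le> norm (P x) * norm (H j x)" by (simp add: Cauchy_Schwarz_ineq2)
      also have "\<dots> \<le> norm (P x) * norm (W x)"
        using le[of j x] by (intro mult_left_mono) auto
      finally show "norm (P x \<bullet> H j x) \<le> norm (P x) * norm (W x)" .
    qed
    show "AE x in lebesgue. (\<lambda>j. P x \<bullet> H j x) \<longlonglongrightarrow> P x \<bullet> H' x"
      by (intro AE_I2 tendsto_intros lim)
  qed (use m L2_measurable[OF P] L2_norm_mult_integrable[OF P W] in auto)
qed

lemma L2_norm_real: "F \<in> L2 \<Longrightarrow> (\<lambda>x. norm (F x)) \<in> L2" "norm_L2 (\<lambda>x. norm (F x)) = norm_L2 F"
  by (auto simp: L2_def norm_L2_def)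

text \<open>The gradient of the cut-off function is the cut-off gradient plus an error
  \<open>E\<close>, the derivative of the cutoff times \<open>z\<close>. The error is of order
  \<open>norm (z x)\<close> / j, so it is square integrability of \<open>z\<close> itself that
  provides the majorant.\<close>

lemma cutoff_approximation:
  fixes z :: "real ^ 'd::finite \<Rightarrow> 'b::euclidean_space"
  assumes smooth: "\<And>k. z \<in> C_k k" and L2: "z \<in> L2" "grad z \<in> L2"
  shows "(\<lambda>x. cutoff j x *\<^sub>R z x) \<in> test_functions"
    "(\<lambda>j. norm_L2 (grad (\<lambda>x. cutoff j x *\<^sub>R z x))) \<longlonglongrightarrow> norm_L2 (grad z)"
    "P \<in> L2 \<Longrightarrow> (\<lambda>j. ip_L2 P (grad (\<lambda>x. cutoff j x *\<^sub>R z x))) \<longlonglongrightarrow> ip_L2 P (grad z)"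
proof -
  show test: "(\<lambda>x. cutoff j x *\<^sub>R z x) \<in> test_functions" for j
    by (intro bounded_bilinear.test_functions_bilinear[OF bounded_bilinear_scaleR] cutoff_test smooth)
  obtain C where C: "C \<ge> 0" "\<And>j x. \<bar>cutoff j (x :: real ^ 'd)\<bar> \<le> C"
    "\<And>j \<alpha> x. \<bar>pdiff \<alpha> (cutoff j) (x :: real ^ 'd)\<bar> \<le> inverse (real (Suc j)) * C"
    using cutoff_bounds by metis
  define E where "E j x = (\<chi> \<alpha>. pdiff \<alpha> (cutoff j) x *\<^sub>R z x)" for j x
  have g: "grad (\<lambda>x. cutoff j x *\<^sub>R z x) x = cutoff j x *\<^sub>R grad z x + E j x" for j x
    using pdiff_scaleR[OF C_k_SucD(1)[OF test_functions_C_k[of "cutoff j" "Suc 0", OF cutoff_test]]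
        C_k_SucD(1)[OF smooth[of "Suc 0"]]]
    by (simp add: grad_def E_def vec_eq_iff)
  have E: "norm (E j x) \<le> inverse (real (Suc j)) * (real CARD('d) * C * norm (z x))" for j x
  proof -
    have "norm (E j x) \<le> (\<Sum>\<alpha>\<in>(UNIV :: 'd set). norm (axis \<alpha> (pdiff \<alpha> (cutoff j) x *\<^sub>R z x) :: 'b ^ 'd))"
      unfolding E_def vec_lambda_eq_sum_axis by (rule norm_sum)
    also have "\<dots> \<le> (\<Sum>\<alpha>\<in>(UNIV :: 'd set). (inverse (real (Suc j)) * C) * norm (z x))"
      unfolding norm_axis norm_scaleR by (intro sum_mono mult_right_mono C) auto
    finally show ?thesis by (simp add: mult_ac)
  qed
  have E': "norm (E j x) \<le> real CARD('d) * C * norm (z x)" for j x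
  proof (rule order_trans[OF E])
    show "inverse (real (Suc j)) * (real CARD('d) * C * norm (z x)) \<le> real CARD('d) * C * norm (z x)"
      using C(1) by (intro mult_left_le_one_le) (auto simp: inverse_le_1_iff)
  qed
  have "(\<lambda>j. E j x) \<longlonglongrightarrow> 0" for x
  proof (rule tendsto_norm_zero_cancel, rule tendsto_sandwich[OF _ _ tendsto_const])
    show "(\<lambda>j. inverse (real (Suc j)) * (real CARD('d) * C * norm (z x))) \<longlonglongrightarrow> 0"
      by (intro tendsto_mult_left_zero LIMSEQ_inverse_real_of_nat)
  qed (use E in auto)
  then have lim: "(\<lambda>j. grad (\<lambda>x. cutoff j x *\<^sub>R z x) x) \<longlonglongrightarrow> grad z x" for x
    unfolding g by (rule tendsto_eq_rhs[OF tendsto_add[OF tendsto_scaleR[OF cutoff_tendsto tendsto_const]]]) simp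
  let ?W = "\<lambda>x. C *\<^sub>R norm (grad z x) + (real CARD('d) * C) *\<^sub>R norm (z x)"
  have W: "?W \<in> L2"
    by (intro L2_add L2_scaleR L2_norm_real L2)
  have le: "norm (grad (\<lambda>x. cutoff j x *\<^sub>R z x) x) \<le> ?W x" for j x
    unfolding g using E'[of j x] mult_right_mono[OF C(2), of "norm (grad z x)" j x]
    by (intro order_trans[OF norm_triangle_ineq]) auto
  have m: "grad (\<lambda>x. cutoff j x *\<^sub>R z x) \<in> borel_measurable lebesgue" "grad z \<in> borel_measurable lebesgue" for j
    using L2_measurable[OF L2(2)] continuous_imp_measurable_lebesgue[OF Cc_continuous[OF test_functions_grad_Cc[OF test]]] by auto
  show "(\<lambda>j. norm_L2 (grad (\<lambda>x. cutoff j x *\<^sub>R z x))) \<longlonglongrightarrow> norm_L2 (grad z)"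
    by (rule L2_dominated(1)[OF m W lim le])
  show "P \<in> L2 \<Longrightarrow> (\<lambda>j. ip_L2 P (grad (\<lambda>x. cutoff j x *\<^sub>R z x))) \<longlonglongrightarrow> ip_L2 P (grad z)"
    by (rule L2_dominated(2)[OF m W lim le])
qed

section \<open>The mollified equation and second derivatives\<close>

lemma pdiff_eta_odd: "pdiff \<alpha> (eta n) (- x) = - pdiff \<alpha> (eta n) x"
proof -
  have e: "(\<lambda>x. eta n (0 + (- 1) *\<^sub>R x)) = eta n" by (simp add: eta_even fun_eq_iff)
  show ?thesis
    using pdiff_affine(1)[where F="eta n" and t=0 and c="-1" and x=x and \<alpha>=\<alpha>,
        OF C_k_SucD(1)[OF test_functions_C_k[of "eta n" "Suc 0", OF eta_test]]]
    unfolding e by simp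
qed

lemma conv_minus_kernel: "conv (\<lambda>z. - k z) F x = - conv k F x"
  by (simp add: conv_def)

lemma conv_vec_nth:
  assumes "k \<in> Cc" "F \<in> L1_loc"
  shows "conv k F x $ \<beta> = conv k (\<lambda>y. F y $ \<beta>) x"
  using integral_bounded_linear[OF bounded_linear_vec_nth conv_integrable[OF assms]] by (simp add: conv_def)

lemma grad_conv:
  assumes "is_weak_grad w W" "k \<in> test_functions"
  shows "grad (conv k w) = conv k W"
proof (rule ext)
  fix x
  have w: "is_weak_pdiff \<beta> w (\<lambda>x. W x $ \<beta>)" for \<beta> using assms by (simp add: is_weak_grad_def)
  then show "grad (conv k w) x = conv k W x"
    using conv_C_k(2)[OF assms(2) is_weak_pdiff_L1_loc(1)[OF w]] conv_weak_pdiff[OF assms(2) w]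
      conv_vec_nth[OF test_functions_Cc[OF assms(2)] is_weak_grad_L1_loc[OF assms(1)]]
    by (simp add: grad_def vec_eq_iff)
qed

text \<open>The contraction of the coefficient tensor with a gradient is abstracted to a bilinear
  map \<open>h\<close>, which hides the four indices. Coercivity is asked for smooth
  \<open>z\<close> with \<open>z\<close> and \<open>grad z\<close> in \<open>L2\<close>, as
  mollified derivatives of a solution are.\<close>

locale elliptic_coefficients = euclidean_bilinear h
  for h :: "'c::euclidean_space \<Rightarrow> 'b::euclidean_space ^ 'd::finite \<Rightarrow> 'b ^ 'd" +
  fixes A :: "real ^ 'd \<Rightarrow> 'c" and c\<^sub>0 K a N :: real
  assumes K: "\<And>p y. norm (h p y) \<le> K * norm p * norm y" "K \<ge> 0"
    and A_C_1: "A \<in> C_k 1"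
    and A_bound: "\<And>x. norm (A x) \<le> a"
    and dA_bound: "\<And>\<alpha> x. norm (pdiff \<alpha> A x) \<le> N"
    and c\<^sub>0: "c\<^sub>0 > 0"
    and coercive: "\<And>z. (\<And>k. z \<in> C_k k) \<Longrightarrow> z \<in> L2 \<Longrightarrow> grad z \<in> L2 \<Longrightarrow>
      c\<^sub>0 * (norm_L2 (grad z))\<^sup>2 \<le> ip_L2 (\<lambda>x. h (A x) (grad z x)) (grad z)"
begin

lemma a_nonneg: "a \<ge> 0"
  using order_trans[OF norm_ge_zero A_bound] .

lemma N_nonneg: "N \<ge> 0"
  using order_trans[OF norm_ge_zero dA_bound] .

lemma continuous_A: "continuous_on UNIV A"
  by (rule C_k_continuous[OF A_C_1])

lemma L2_coefficient:
  assumes "G \<in> L2" "continuous_on UNIV B" "\<And>x. norm (B x) \<le> b"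
  shows "(\<lambda>x. h (B x) (G x)) \<in> L2" "norm_L2 (\<lambda>x. h (B x) (G x)) \<le> (K * b) * norm_L2 G"
proof -
  have b: "b \<ge> 0" using order_trans[OF norm_ge_zero assms(3)] .
  have m: "(\<lambda>x. h (B x) (G x)) \<in> borel_measurable lebesgue"
    by (rule borel_measurable_bilinear[OF continuous_imp_measurable_lebesgue[OF assms(2)] L2_measurable[OF assms(1)]])
  have "norm (h (B x) (G x)) \<le> (K * b) * norm (G x)" for x
    by (rule order_trans[OF K(1)]) (intro mult_right_mono mult_left_mono assms K norm_ge_zero)
  then have ae: "AE x in lebesgue. norm (h (B x) (G x)) \<le> (K * b) * norm (G x)" by simp
  show "(\<lambda>x. h (B x) (G x)) \<in> L2" "norm_L2 (\<lambda>x. h (B x) (G x)) \<le> (K * b) * norm_L2 G"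
    using L2_bound[OF m assms(1) _ ae] K(2) b by auto
qed

text \<open>\<open>z\<close> need not have compact support, so it is inserted as the limit of its
  cut-off versions. Coercivity then bounds the square of the gradient norm by \<open>M\<close> times
  that norm, which is divided out.\<close>

lemma energy_bound:
  assumes smooth: "\<And>k. z \<in> C_k k" and L2: "z \<in> L2" "grad z \<in> L2"
    and bound: "\<And>v. v \<in> test_functions \<Longrightarrow> \<bar>ip_L2 (\<lambda>x. h (A x) (grad z x)) (grad v)\<bar> \<le> M * norm_L2 (grad v)"
    and M: "M \<ge> 0"
  shows "c\<^sub>0 * norm_L2 (grad z) \<le> M"
proof -
  let ?P = "\<lambda>x. h (A x) (grad z x)"
  have P: "?P \<in> L2" by (rule L2_coefficient[OF L2(2) continuous_A A_bound])
  have "ip_L2 ?P (grad z) \<le> M * norm_L2 (grad z)"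
  proof (rule LIMSEQ_le)
    show "(\<lambda>j. ip_L2 ?P (grad (\<lambda>x. cutoff j x *\<^sub>R z x))) \<longlonglongrightarrow> ip_L2 ?P (grad z)"
      by (rule cutoff_approximation(3)[OF smooth L2 P])
    show "(\<lambda>j. M * norm_L2 (grad (\<lambda>x. cutoff j x *\<^sub>R z x))) \<longlonglongrightarrow> M * norm_L2 (grad z)"
      by (intro tendsto_intros cutoff_approximation(2)[OF smooth L2])
    show "\<exists>n. \<forall>j\<ge>n. ip_L2 ?P (grad (\<lambda>x. cutoff j x *\<^sub>R z x)) \<le> M * norm_L2 (grad (\<lambda>x. cutoff j x *\<^sub>R z x))"
      using abs_le_D1[OF bound[OF cutoff_approximation(1)[OF smooth L2]]] by blast
  qed
  then have "c\<^sub>0 * (norm_L2 (grad z))\<^sup>2 \<le> M * norm_L2 (grad z)"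
    using coercive[OF smooth L2] by simp
  then have "norm_L2 (grad z) * (c\<^sub>0 * norm_L2 (grad z)) \<le> norm_L2 (grad z) * M"
    by (simp add: power2_eq_square mult_ac)
  then show ?thesis
    using M norm_L2_nonneg[of "grad z"] by (cases "norm_L2 (grad z) = 0") (auto simp: mult_le_cancel_left)
qed

text \<open>In \<open>R\<close> the kernel derivative at x - y multiplies A x - A y. The Lipschitz
  bound on \<open>A\<close> contributes a factor norm (x - y), so that \<open>R\<close> is dominated
  by a convolution of |W| with the kernel whose mass \<open>eta_moment\<close> controls.\<close>

lemma commutator_bound:
  fixes W :: "real ^ 'd \<Rightarrow> 'b ^ 'd" and \<gamma> :: 'd and n :: nat
  assumes W: "W \<in> L2"
  defines "R \<equiv> \<lambda>x. h (A x) (conv (pdiff \<gamma> (eta n)) W x) - conv (pdiff \<gamma> (eta n)) (\<lambda>y. h (A y) (W y)) x"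
  shows "R \<in> L2" "norm_L2 (R) \<le> (K * (real CARD('d) * N)) * (eta_const TYPE('d) * norm_L2 W)"
proof -
  let ?k = "pdiff \<gamma> (eta n) :: real ^ 'd \<Rightarrow> real"
  let ?\<kappa> = "\<lambda>x. norm x * \<bar>?k x\<bar>"
  let ?L = "real CARD('d) * N"
  note kt = test_functions_pdiff[OF eta_test]
  have kC: "?k \<in> Cc" by (rule test_functions_Cc[OF kt])
  have \<kappa>C: "?\<kappa> \<in> Cc"
    using bounded_bilinear.Cc_bilinear_right[OF bounded_bilinear_mult Cc_norm[OF kC], of norm]
    by (simp add: continuous_on_norm)
  have \<Phi>: "(\<lambda>y. h (A y) (W y)) \<in> L2" by (rule L2_coefficient[OF W continuous_A A_bound])
  note WL = L2_imp_L1_loc[OF W] and \<Phi>L = L2_imp_L1_loc[OF \<Phi>]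
  have nW: "(\<lambda>y. norm (W y)) \<in> L2" by (rule L2_norm_real(1)[OF W])
  have "R \<in> borel_measurable lebesgue"
    unfolding R_def using C_k_continuous[OF conv_C_k(1)[where n=0, OF kt WL]] C_k_continuous[OF conv_C_k(1)[where n=0, OF kt \<Phi>L]]
    by (intro continuous_imp_measurable_lebesgue continuous_on_diff continuous_on continuous_A)
  moreover have "norm (R x) \<le> (K * ?L) * norm (conv ?\<kappa> (\<lambda>y. norm (W y)) x)" for x
  proof -
    have i: "integrable lebesgue (\<lambda>y. ?k (x - y) *\<^sub>R W y)" "integrable lebesgue (\<lambda>y. ?k (x - y) *\<^sub>R h (A y) (W y))"
      "integrable lebesgue (\<lambda>y. ?\<kappa> (x - y) *\<^sub>R norm (W y))"
      by (intro conv_integrable kC \<kappa>C WL \<Phi>L L2_imp_L1_loc nW)+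
    have "h (A x) (conv ?k W x) = (\<integral>y. h (A x) (?k (x - y) *\<^sub>R W y) \<partial>lebesgue)"
      unfolding conv_def by (rule integral_bounded_linear[OF bounded_linear_right i(1), symmetric])
    then have "R x = (\<integral>y. h (A x) (?k (x - y) *\<^sub>R W y) - ?k (x - y) *\<^sub>R h (A y) (W y) \<partial>lebesgue)"
      unfolding R_def conv_def[of ?k "\<lambda>y. h (A y) (W y)"]
      using i(2) integrable_bounded_linear[OF bounded_linear_right i(1)] by simp
    also have "\<dots> = (\<integral>y. ?k (x - y) *\<^sub>R h (A x - A y) (W y) \<partial>lebesgue)"
      by (simp add: scaleR_right diff_left scaleR_diff_right)
    also have "norm \<dots> \<le> (\<integral>y. (K * ?L) * (?\<kappa> (x - y) *\<^sub>R norm (W y)) \<partial>lebesgue)"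
    proof (rule order_trans[OF integral_norm_bound integral_mono])
      have "integrable lebesgue (\<lambda>y. h (A x) (?k (x - y) *\<^sub>R W y) - ?k (x - y) *\<^sub>R h (A y) (W y))"
        by (intro Bochner_Integration.integrable_diff i integrable_bounded_linear[OF bounded_linear_right])
      then show "integrable lebesgue (\<lambda>y. norm (?k (x - y) *\<^sub>R h (A x - A y) (W y)))"
        by (intro integrable_norm) (simp add: scaleR_right diff_left scaleR_diff_right)
      show "integrable lebesgue (\<lambda>y. (K * ?L) * (?\<kappa> (x - y) *\<^sub>R norm (W y)))"
        by (intro integrable_mult_right i)
      fix y
      have "norm (?k (x - y) *\<^sub>R h (A x - A y) (W y)) \<le> \<bar>?k (x - y)\<bar> * (K * (?L * norm (x - y)) * norm (W y))"
        unfolding norm_scaleR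
        by (intro mult_left_mono order_trans[OF K(1)] mult_right_mono K(2) C_1_lipschitz[OF A_C_1 dA_bound]) auto
      then show "norm (?k (x - y) *\<^sub>R h (A x - A y) (W y)) \<le> (K * ?L) * (?\<kappa> (x - y) *\<^sub>R norm (W y))"
        by (simp add: mult_ac)
    qed
    also have "\<dots> = (K * ?L) * conv ?\<kappa> (\<lambda>y. norm (W y)) x"
      by (simp add: conv_def)
    also have "\<dots> \<le> (K * ?L) * norm (conv ?\<kappa> (\<lambda>y. norm (W y)) x)"
      using K(2) N_nonneg by (intro mult_left_mono) auto
    finally show ?thesis .
  qed
  then have "AE x in lebesgue. norm (R x) \<le> (K * ?L) * norm (conv ?\<kappa> (\<lambda>y. norm (W y)) x)" by simp
  ultimately have b: "R \<in> L2" "norm_L2 (R) \<le> (K * ?L) * norm_L2 (conv ?\<kappa> (\<lambda>y. norm (W y)))"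
    using L2_bound[OF _ conv_L2(1)[OF \<kappa>C nW], of "R" "K * ?L"] K(2) N_nonneg by auto
  show "R \<in> L2" by fact
  have "norm_L2 (conv ?\<kappa> (\<lambda>y. norm (W y))) \<le> (\<integral>x. \<bar>?\<kappa> x\<bar> \<partial>lebesgue) * norm_L2 (\<lambda>y. norm (W y))"
    by (rule conv_L2(2)[OF \<kappa>C nW])
  also have "\<dots> \<le> eta_const TYPE('d) * norm_L2 W"
    using eta_moment[of \<gamma> n] by (simp add: L2_norm_real abs_mult mult_right_mono)
  finally have "(K * ?L) * norm_L2 (conv ?\<kappa> (\<lambda>y. norm (W y))) \<le> (K * ?L) * (eta_const TYPE('d) * norm_L2 W)"
    using K(2) N_nonneg by (intro mult_left_mono) auto
  with b(2) show "norm_L2 (R) \<le> (K * (real CARD('d) * N)) * (eta_const TYPE('d) * norm_L2 W)"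
    by simp
qed

text \<open>The convolution is moved from the flux onto v, and the result is again a test function
  for the original equation. Paired with \<open>f\<close>, it is rewritten as the mollification of
  \<partial>v, so that \<open>f\<close> enters undifferentiated and the gradient norm of v comes
  out.\<close>

lemma mollified_energy_bound:
  fixes w f :: "real ^ 'd \<Rightarrow> 'b"
  assumes wW: "is_weak_grad w W" and W: "W \<in> L2" and f: "f \<in> L2"
    and eq: "\<And>v. v \<in> test_functions \<Longrightarrow> ip_L2 (\<lambda>x. h (A x) (W x)) (grad v) = ip_L2 f v"
  shows "c\<^sub>0 * norm_L2 (conv (pdiff \<gamma> (eta n)) W)
    \<le> norm_L2 f + (K * (real CARD('d) * N)) * (eta_const TYPE('d) * norm_L2 W)"
proof -
  let ?k = "pdiff \<gamma> (eta n) :: real ^ 'd \<Rightarrow> real"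
  let ?\<Phi> = "\<lambda>y. h (A y) (W y)"
  define R where "R x = h (A x) (conv ?k W x) - conv ?k ?\<Phi> x" for x
  let ?M = "norm_L2 f + (K * (real CARD('d) * N)) * (eta_const TYPE('d) * norm_L2 W)"
  note kt = test_functions_pdiff[OF eta_test]
  have kC: "?k \<in> Cc" by (rule test_functions_Cc[OF kt])
  have \<Phi>: "?\<Phi> \<in> L2" by (rule L2_coefficient[OF W continuous_A A_bound])
  have R: "R \<in> L2" "norm_L2 R \<le> (K * (real CARD('d) * N)) * (eta_const TYPE('d) * norm_L2 W)"
    unfolding R_def[abs_def] by (rule commutator_bound[OF W])+
  have wL: "w \<in> L1_loc" using wW by (auto simp: is_weak_grad_def is_weak_pdiff_def)
  have w\<gamma>: "is_weak_pdiff \<gamma> w (\<lambda>x. W x $ \<gamma>)" using wW by (simp add: is_weak_grad_def)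
  have gz: "grad (conv ?k w) = conv ?k W" by (rule grad_conv[OF wW kt])
  \<comment> \<open>Square integrability is known only for the gradient of \<open>w\<close>, so the
    derivative is taken off the kernel.\<close>
  have "conv ?k w = conv (eta n) (\<lambda>x. W x $ \<gamma>)" by (rule conv_weak_pdiff[OF eta_test w\<gamma>])
  then have zL2: "conv ?k w \<in> L2"
    using conv_L2(1)[OF eta_Cc L2_norm_components(1)[OF W]] by simp
  have gzL2: "grad (conv ?k w) \<in> L2" unfolding gz by (rule conv_L2(1)[OF kC W])
  have "c\<^sub>0 * norm_L2 (grad (conv ?k w)) \<le> ?M"
  proof (rule energy_bound[OF conv_C_k(1)[OF kt wL] zL2 gzL2])
    show "?M \<ge> 0" using order_trans[OF norm_L2_nonneg R(2)] by simp
    fix v :: "real ^ 'd \<Rightarrow> 'b" assume v: "v \<in> test_functions"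
    have vL: "v \<in> L1_loc" by (intro continuous_imp_L1_loc Cc_continuous test_functions_Cc v)
    have gv: "grad v \<in> L2" by (intro Cc_L2 test_functions_grad_Cc v)
    have v1: "v \<in> C_k 1" by (rule test_functions_C_k[OF v])
    have kv: "conv ?k v \<in> test_functions" by (intro conv_test_functions kt test_functions_Cc v)
    have "ip_L2 (conv ?k ?\<Phi>) (grad v) = ip_L2 ?\<Phi> (conv (\<lambda>z. ?k (- z)) (grad v))"
      unfolding ip_L2_def
      by (rule integral_conv_swap[OF kC L2_imp_L1_loc[OF \<Phi>] test_functions_grad_Cc[OF v]])
    \<comment> \<open>The derivative of the even mollifier is odd, hence the adjoint carries a minus
      sign.\<close>
    also have "\<dots> = - ip_L2 ?\<Phi> (grad (conv ?k v))"
      unfolding grad_conv[OF C_1_is_weak_grad[OF v1] kt] pdiff_eta_odd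
      by (simp add: ip_L2_def conv_minus_kernel)
    also have "\<dots> = - ip_L2 f (conv ?k v)"
      by (simp only: eq[OF kv])
    also have "\<dots> = - ip_L2 f (conv (eta n) (pdiff \<gamma> v))"
      by (simp only: conv_weak_pdiff[OF eta_test C_1_is_weak_pdiff[OF v1]])
    finally have e1: "ip_L2 (conv ?k ?\<Phi>) (grad v) = - ip_L2 f (conv (eta n) (pdiff \<gamma> v))" .
    have dv: "pdiff \<gamma> v \<in> L2" by (intro test_functions_L2 test_functions_pdiff v)
    have "norm_L2 (conv (eta n) (pdiff \<gamma> v)) \<le> (\<integral>x. \<bar>eta n (x :: real ^ 'd)\<bar> \<partial>lebesgue) * norm_L2 (pdiff \<gamma> v)"
      by (rule conv_L2(2)[OF eta_Cc dv])
    also have "\<dots> = norm_L2 (pdiff \<gamma> v)" by (simp add: abs_of_nonneg[OF eta_nonneg] eta_integral)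
    also have "\<dots> \<le> norm_L2 (grad v)"
      using L2_norm_components(2)[OF gv, of \<gamma>] by (simp add: grad_def)
    finally have e2: "norm_L2 (conv (eta n) (pdiff \<gamma> v)) \<le> norm_L2 (grad v)" .
    have "ip_L2 (\<lambda>x. h (A x) (grad (conv ?k w) x)) (grad v) = ip_L2 (\<lambda>x. conv ?k ?\<Phi> x + R x) (grad v)"
      by (simp add: gz R_def)
    also have "\<dots> = ip_L2 (conv ?k ?\<Phi>) (grad v) + ip_L2 R (grad v)"
      by (intro ip_L2_add_left conv_L2(1) kC \<Phi> R gv)
    finally have "\<bar>ip_L2 (\<lambda>x. h (A x) (grad (conv ?k w) x)) (grad v)\<bar>
        \<le> \<bar>ip_L2 f (conv (eta n) (pdiff \<gamma> v))\<bar> + \<bar>ip_L2 R (grad v)\<bar>"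
      unfolding e1 by simp
    also have "\<dots> \<le> norm_L2 f * norm_L2 (conv (eta n) (pdiff \<gamma> v)) + norm_L2 R * norm_L2 (grad v)"
      by (intro add_mono abs_ip_L2_le f conv_L2(1) eta_Cc dv R gv)
    also have "\<dots> \<le> norm_L2 f * norm_L2 (grad v) + ((K * (real CARD('d) * N)) * (eta_const TYPE('d) * norm_L2 W)) * norm_L2 (grad v)"
      by (intro add_mono mult_left_mono mult_right_mono e2 R norm_L2_nonneg)
    finally show "\<bar>ip_L2 (\<lambda>x. h (A x) (grad (conv ?k w) x)) (grad v)\<bar> \<le> ?M * norm_L2 (grad v)"
      by (simp add: distrib_right)
  qed
  then show ?thesis by (simp add: gz)
qed

lemma second_derivatives:
  fixes w f :: "real ^ 'd \<Rightarrow> 'b"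
  assumes wW: "is_weak_grad w W" and W: "W \<in> L2" and f: "f \<in> L2"
    and eq: "\<And>v. v \<in> test_functions \<Longrightarrow> ip_L2 (\<lambda>x. h (A x) (W x)) (grad v) = ip_L2 f v"
  obtains G where "G \<in> L2" "is_weak_pdiff \<gamma> W G"
    "c\<^sub>0 * norm_L2 G \<le> norm_L2 f + (K * (real CARD('d) * N)) * (eta_const TYPE('d) * norm_L2 W)"
proof -
  let ?M = "norm_L2 f + (K * (real CARD('d) * N)) * (eta_const TYPE('d) * norm_L2 W)"
  let ?k = "\<lambda>n. pdiff \<gamma> (eta n) :: real ^ 'd \<Rightarrow> real"
  \<comment> \<open>The distributional derivative of \<open>W\<close> in direction \<gamma>, as a
    functional on vector-valued test functions.\<close>
  define T where "T \<phi> = - ip_L2 W (pdiff \<gamma> \<phi>)" for \<phi> :: "real ^ 'd \<Rightarrow> 'b ^ 'd"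
  have M: "?M / c\<^sub>0 \<ge> 0"
    using K(2) N_nonneg c\<^sub>0 eta_const_nonneg[where 'd='d] by (intro divide_nonneg_pos add_nonneg_nonneg mult_nonneg_nonneg) auto
  note kt = test_functions_pdiff[OF eta_test]
  have dL2: "pdiff \<gamma> \<phi> \<in> L2" if "\<phi> \<in> test_functions" for \<phi> :: "real ^ 'd \<Rightarrow> 'b ^ 'd"
    by (intro test_functions_L2 test_functions_pdiff that)
  have diff: "\<phi> differentiable (at x)" if "\<phi> \<in> test_functions" for \<phi> :: "real ^ 'd \<Rightarrow> 'b ^ 'd" and x
    using C_k_SucD(1)[OF test_functions_C_k[OF that, of "Suc 0"]] .
  have "\<bar>T \<phi>\<bar> \<le> (?M / c\<^sub>0) * norm_L2 \<phi>" if \<phi>: "\<phi> \<in> test_functions" for \<phi>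
  proof -
    \<comment> \<open>The mollifier is shifted onto \<phi>, which makes the limit an instance of
      \<open>conv_eta_weak_limit\<close> and carries the uniform bound over to
      \<open>T\<close>.\<close>
    have T: "ip_L2 (conv (?k n) W) \<phi> = - (\<integral>x. conv (eta n) (pdiff \<gamma> \<phi>) x \<bullet> W x \<partial>lebesgue)" for n
    proof -
      have "ip_L2 (conv (?k n) W) \<phi> = ip_L2 W (conv (\<lambda>z. ?k n (- z)) \<phi>)"
        unfolding ip_L2_def
        by (rule integral_conv_swap[OF test_functions_Cc[OF kt] L2_imp_L1_loc[OF W] test_functions_Cc[OF \<phi>]])
      also have "\<dots> = - ip_L2 (conv (?k n) \<phi>) W"
        unfolding pdiff_eta_odd by (simp add: ip_L2_def conv_minus_kernel inner_commute)
      also have "conv (?k n) \<phi> = conv (eta n) (pdiff \<gamma> \<phi>)"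
        by (intro conv_weak_pdiff eta_test C_1_is_weak_pdiff test_functions_C_k \<phi>)
      finally show ?thesis by (simp add: ip_L2_def)
    qed
    have "(\<lambda>n. \<integral>x. conv (eta n) (pdiff \<gamma> \<phi>) x \<bullet> W x \<partial>lebesgue) \<longlonglongrightarrow> (\<integral>x. pdiff \<gamma> \<phi> x \<bullet> W x \<partial>lebesgue)"
      by (intro euclidean_bilinear.conv_eta_weak_limit[OF euclidean_bilinear_inner] L2_imp_L1_loc W
          test_functions_Cc test_functions_pdiff \<phi>)
    then have lim: "(\<lambda>n. \<bar>ip_L2 (conv (?k n) W) \<phi>\<bar>) \<longlonglongrightarrow> \<bar>T \<phi>\<bar>"
      unfolding T T_def by (simp add: ip_L2_def inner_commute tendsto_rabs)
    have bd: "\<bar>ip_L2 (conv (?k n) W) \<phi>\<bar> \<le> (?M / c\<^sub>0) * norm_L2 \<phi>" for n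
    proof -
      have "norm_L2 (conv (?k n) W) \<le> ?M / c\<^sub>0"
        using mollified_energy_bound[OF wW W f eq, of \<gamma> n] c\<^sub>0 by (simp add: field_simps)
      then show ?thesis
        using abs_ip_L2_le[OF conv_L2(1)[OF test_functions_Cc[OF kt] W] test_functions_L2[OF \<phi>]]
        by (meson mult_right_mono norm_L2_nonneg order_trans)
    qed
    show ?thesis by (rule LIMSEQ_le_const2[OF lim]) (use bd in blast)
  qed
  then obtain G where G: "G \<in> L2" "norm_L2 G \<le> ?M / c\<^sub>0" "\<And>\<phi>. \<phi> \<in> test_functions \<Longrightarrow> T \<phi> = ip_L2 G \<phi>"
  proof (rule L2_riesz_test_functions[where T=T, rotated 2])
    fix \<phi> \<psi> :: "real ^ 'd \<Rightarrow> 'b ^ 'd" and c :: real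
    assume \<phi>: "\<phi> \<in> test_functions"
    have "pdiff \<gamma> (\<lambda>x. c *\<^sub>R \<phi> x) x = c *\<^sub>R pdiff \<gamma> \<phi> x" for x
      by (rule bounded_linear.pdiff_linear[OF bounded_linear_scaleR_right diff[OF \<phi>]])
    then show "T (\<lambda>x. c *\<^sub>R \<phi> x) = c * T \<phi>"
      by (simp add: T_def ip_L2_def)
    assume \<psi>: "\<psi> \<in> test_functions"
    have "pdiff \<gamma> (\<lambda>x. \<phi> x + \<psi> x) = (\<lambda>x. pdiff \<gamma> \<phi> x + pdiff \<gamma> \<psi> x)"
      by (intro ext pdiff_add diff \<phi> \<psi>)
    then show "T (\<lambda>x. \<phi> x + \<psi> x) = T \<phi> + T \<psi>"
      by (simp add: T_def ip_L2_add_right dL2 \<phi> \<psi> W)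
  qed (use M in auto)
  have "(\<integral>x. W x \<bullet> pdiff \<gamma> \<phi> x \<partial>lebesgue) = - (\<integral>x. G x \<bullet> \<phi> x \<partial>lebesgue)"
    if "\<phi> \<in> test_functions" for \<phi>
    using G(3)[OF that] unfolding T_def ip_L2_def by linarith
  then have "is_weak_pdiff \<gamma> W G"
    by (intro is_weak_pdiff_innerI L2_imp_L1_loc W G)
  moreover have "c\<^sub>0 * norm_L2 G \<le> ?M" using G(2) c\<^sub>0 by (simp add: field_simps)
  ultimately show ?thesis using that G(1) by blast
qed

end

section \<open>Essential suprema and Landau's inequality\<close>

lemma L_inf_bounds:
  assumes "G \<in> L_inf"
  shows "0 \<le> norm_Linf G" "AE x in lebesgue. norm (G x) \<le> norm_Linf G"
proof -
  let ?s = "esssup lebesgue (\<lambda>x. ereal (norm (G x)))"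
  have ae: "AE x in lebesgue. ereal (norm (G x)) \<le> ?s" by (rule esssup_AE)
  \<comment> \<open>The space is not a null set, so some point satisfies the almost everywhere
    bound; this excludes the value -\<infinity>, which \<open>real_of_ereal\<close> would
    hide.\<close>
  have "ae_filter (lebesgue :: (real ^ 'a) measure) \<noteq> bot"
    by (simp add: ae_filter_eq_bot_iff emeasure_lborel_UNIV)
  then obtain x where "ereal (norm (G x)) \<le> ?s"
    using eventually_happens'[OF _ ae] by blast
  then have "?s \<ge> 0"
    by (rule order_trans[rotated]) simp
  moreover have "?s < \<infinity>" using assms by (simp add: L_inf_def)
  ultimately have s: "?s = ereal (norm_Linf G)" "0 \<le> norm_Linf G"
    unfolding norm_Linf_def by (cases ?s; simp)+
  show "0 \<le> norm_Linf G" by fact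
  show "AE x in lebesgue. norm (G x) \<le> norm_Linf G" using ae unfolding s(1) by simp
qed

text \<open>A closed set of full measure is the whole space, so for a continuous function the almost
  everywhere bound holds at every point.\<close>

lemma continuous_le_norm_Linf:
  assumes "G \<in> L_inf" "AE x in lebesgue. F x = G x" "continuous_on UNIV F"
  shows "norm (F x) \<le> norm_Linf G"
proof -
  have "AE x in lebesgue. x \<in> {x. norm (F x) \<le> norm_Linf G}"
    using L_inf_bounds(2)[OF assms(1)] assms(2) by eventually_elim simp
  moreover have "closed {x. norm (F x) \<le> norm_Linf G}"
    using assms(3) by (intro closed_Collect_le continuous_intros)
  ultimately show ?thesis using mem_closed_if_AE_lebesgue by blast
qed

text \<open>The choice t = p / (2 L) leaves p^2 / (4 L) \<le> 2 a, whence the constant 8. If L = 0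
  and p > 0, the choice t = (2 a + 1) / p is contradictory.\<close>

lemma landau_quadratic:
  fixes p a L :: real
  assumes "p \<ge> 0" "a \<ge> 0" "L \<ge> 0" "\<And>t. t > 0 \<Longrightarrow> t * p \<le> 2 * a + L * t\<^sup>2"
  shows "p\<^sup>2 \<le> 8 * a * L"
proof (cases "p = 0")
  case False
  then have p: "p > 0" using assms(1) by simp
  show ?thesis
  proof (cases "L = 0")
    case True
    have "(2 * a + 1) / p * p \<le> 2 * a" using assms(4)[of "(2 * a + 1) / p"] True p assms(2) by simp
    then show ?thesis using p by simp
  next
    case False
    then have L: "L > 0" using assms(3) by simp
    have "p / (2 * L) * p \<le> 2 * a + L * (p / (2 * L))\<^sup>2" using assms(4)[of "p / (2 * L)"] L p by simp
    then show ?thesis using L by (simp add: field_simps power2_eq_square)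
  qed
qed (use assms in simp)

text \<open>A first order expansion along the axis over a distance t: the two values of
  \<open>A\<close> contribute 2 a, and the Lipschitz bound of the derivative gives a remainder L
  t^2. The distance is then optimised by \<open>landau_quadratic\<close>.\<close>

lemma landau_pdiff:
  fixes A :: "real ^ 'd::finite \<Rightarrow> 'b::euclidean_space"
  assumes A: "A \<in> C_k 2" and a: "\<And>x. norm (A x) \<le> a"
    and M: "\<And>\<alpha> \<beta> x. norm (pdiff \<beta> (pdiff \<alpha> A) x) \<le> M"
  shows "norm (pdiff \<alpha> A x) \<le> sqrt (8 * a * (real CARD('d) * M))"
proof -
  let ?p = "pdiff \<alpha> A x" and ?L = "real CARD('d) * M"
  let ?e = "axis \<alpha> 1 :: real ^ 'd"
  have nonneg: "a \<ge> 0" "M \<ge> 0"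
    using order_trans[OF norm_ge_zero a] order_trans[OF norm_ge_zero M] by auto
  have A1: "A \<in> C_k 1" "pdiff \<alpha> A \<in> C_k 1"
    using C_k_mono[OF A, of 1] C_k_SucD(2)[of A 1 \<alpha>] A by (auto simp: numeral_2_eq_2 simp del: C_k.simps)
  have lip: "norm (pdiff \<alpha> A (x + s *\<^sub>R ?e) - ?p) \<le> ?L * \<bar>s\<bar>" for s
    using C_1_lipschitz[OF A1(2) M, of "x + s *\<^sub>R ?e" x] by simp
  have "t * norm ?p \<le> 2 * a + ?L * t\<^sup>2" if t: "t > 0" for t
  proof -
    have der: "((\<lambda>s. A (x + s *\<^sub>R ?e)) has_vector_derivative pdiff \<alpha> A (x + s *\<^sub>R ?e)) (at s within {0..t})" for s
    proof -
      have dA: "(A has_derivative frechet_derivative A (at (x + s *\<^sub>R ?e))) (at (x + s *\<^sub>R ?e))"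
        using A1(1) frechet_derivative_works by auto
      have "((\<lambda>s. A (x + s *\<^sub>R ?e)) has_derivative (\<lambda>h. frechet_derivative A (at (x + s *\<^sub>R ?e)) (h *\<^sub>R ?e))) (at s)"
        by (rule has_derivative_compose[where f="\<lambda>s. x + s *\<^sub>R ?e", OF _ dA])
           (auto intro!: derivative_eq_intros)
      moreover have "bounded_linear (frechet_derivative A (at (x + s *\<^sub>R ?e)))"
        by (rule has_derivative_bounded_linear[OF dA])
      ultimately have "((\<lambda>s. A (x + s *\<^sub>R ?e)) has_derivative (\<lambda>h. h *\<^sub>R pdiff \<alpha> A (x + s *\<^sub>R ?e))) (at s)"
        by (simp add: pdiff_def linear_simps)
      then show ?thesis
        unfolding has_vector_derivative_def by (rule has_derivative_at_withinI)
    qed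
    have "norm (A (x + t *\<^sub>R ?e) - A (x + 0 *\<^sub>R ?e) - (t - 0) *\<^sub>R pdiff \<alpha> A (x + 0 *\<^sub>R ?e)) \<le> norm (t - 0) * (?L * t)"
    proof (rule vector_differentiable_bound_linearization[where S="{0..t}", OF der])
      show "norm (pdiff \<alpha> A (x + s *\<^sub>R ?e) - pdiff \<alpha> A (x + 0 *\<^sub>R ?e)) \<le> ?L * t" if "s \<in> {0..t}" for s
      proof -
        have "?L * \<bar>s\<bar> \<le> ?L * t" using that nonneg by (intro mult_left_mono) auto
        from order_trans[OF lip[of s] this] show ?thesis by simp
      qed
    qed (use t in \<open>auto simp: closed_segment_eq_real_ivl\<close>)
    then have "norm (t *\<^sub>R ?p) \<le> norm (A (x + t *\<^sub>R ?e)) + norm (A x) + ?L * t\<^sup>2"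
      using t norm_triangle_ineq4[of "A (x + t *\<^sub>R ?e) - A x" "A (x + t *\<^sub>R ?e) - A x - t *\<^sub>R ?p"]
        norm_triangle_ineq4[of "A (x + t *\<^sub>R ?e)" "A x"]
      by (simp add: power2_eq_square mult_ac)
    then show ?thesis using a[of "x + t *\<^sub>R ?e"] a[of x] t by simp
  qed
  from landau_quadratic[OF norm_ge_zero _ _ this] nonneg
  have "(norm ?p)\<^sup>2 \<le> 8 * a * ?L" by simp
  then show ?thesis by (rule real_le_rsqrt)
qed

section \<open>Interpolation of a derivative between a function and its second derivative\<close>

lemma ip_L2_axis: "ip_L2 (\<lambda>x. axis \<gamma> (F x)) (G :: real ^ 'd::finite \<Rightarrow> 'b::euclidean_space ^ 'n::finite) = ip_L2 F (\<lambda>x. G x $ \<gamma>)"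
proof -
  have "axis \<gamma> y \<bullet> z = y \<bullet> z $ \<gamma>" for y :: 'b and z :: "'b ^ 'n"
    by (simp add: inner_vec_def axis_def if_distrib[of "\<lambda>y. y \<bullet> _"] sum.delta cong: if_cong)
  then show ?thesis by (simp add: ip_L2_def)
qed

lemma L2_axis: "F \<in> L2 \<Longrightarrow> (\<lambda>x. axis \<gamma> (F x) :: 'b::euclidean_space ^ 'n::finite) \<in> L2"
  by (rule L2_bound(1)[of _ F 1])
     (auto simp: norm_axis intro!: measurable_compose[OF L2_measurable
        borel_measurable_continuous_onI[OF linear_continuous_on[OF bounded_linear_axis]]])

text \<open>The squared norm of the derivative is minus the inner product of \<open>z\<close> with
  its second derivative, to which Cauchy-Schwarz applies. Cutoffs justify this integration by parts
  on the whole space.\<close>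

lemma interpolation_smooth:
  fixes z :: "real ^ 'd::finite \<Rightarrow> 'b::euclidean_space"
  assumes smooth: "\<And>k. z \<in> C_k k" and L2: "z \<in> L2" "grad z \<in> L2" "pdiff \<gamma> (pdiff \<gamma> z) \<in> L2"
  shows "(norm_L2 (pdiff \<gamma> z))\<^sup>2 \<le> norm_L2 z * norm_L2 (pdiff \<gamma> (pdiff \<gamma> z))"
proof -
  let ?v = "\<lambda>j x. cutoff j x *\<^sub>R z x"
  let ?d = "pdiff \<gamma> z" and ?dd = "pdiff \<gamma> (pdiff \<gamma> z)"
  have d1: "?d \<in> C_k 1" using C_k_SucD(2)[OF smooth[of "Suc 1"]] .
  have dL2: "?d \<in> L2" using L2_norm_components(1)[OF L2(2), of \<gamma>] by (simp add: grad_def)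
  note test = cutoff_approximation(1)[OF smooth L2(1,2)]
  \<comment> \<open>\<open>axis \<gamma>\<close> singles out one partial derivative inside the full
    gradient, for which the limit of cut-off functions is available.\<close>
  have eq: "ip_L2 (\<lambda>x. axis \<gamma> (?d x)) (grad (?v j)) = - ip_L2 ?dd (?v j)" for j
    using weak_pdiff_integral_inner[OF C_1_is_weak_pdiff[OF d1, of \<gamma>] test[of j]]
    by (simp add: ip_L2_axis ip_L2_def grad_def)
  have "(\<lambda>j. ip_L2 (\<lambda>x. axis \<gamma> (?d x)) (grad (?v j))) \<longlonglongrightarrow> ip_L2 (\<lambda>x. axis \<gamma> (?d x)) (grad z)"
    by (rule cutoff_approximation(3)[OF smooth L2(1,2) L2_axis[OF dL2]])
  then have l1: "(\<lambda>j. - ip_L2 ?dd (?v j)) \<longlonglongrightarrow> (norm_L2 ?d)\<^sup>2"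
    unfolding eq by (simp add: ip_L2_axis grad_def ip_L2_self)
  obtain C where C: "C \<ge> 0" "\<And>j x. \<bar>cutoff j (x :: real ^ 'd)\<bar> \<le> C"
    using cutoff_bounds by metis
  have l2: "(\<lambda>j. ip_L2 ?dd (?v j)) \<longlonglongrightarrow> ip_L2 ?dd z"
  proof (rule L2_dominated(2)[where W="\<lambda>x. C *\<^sub>R norm (z x)", OF _ _ _ _ _ L2(3)])
    show "?v j \<in> borel_measurable lebesgue" for j
      by (rule L2_measurable[OF test_functions_L2[OF test]])
    show "z \<in> borel_measurable lebesgue" by (rule L2_measurable[OF L2(1)])
    show "(\<lambda>x. C *\<^sub>R norm (z x)) \<in> L2" by (intro L2_scaleR(1) L2_norm_real(1) L2)
    show "(\<lambda>j. ?v j x) \<longlonglongrightarrow> z x" for x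
      by (rule tendsto_eq_rhs[OF tendsto_scaleR[OF cutoff_tendsto tendsto_const]]) simp
    show "norm (?v j x) \<le> C *\<^sub>R norm (z x)" for j x
      using mult_right_mono[OF C(2)] by simp
  qed
  have "(norm_L2 ?d)\<^sup>2 = - ip_L2 ?dd z"
    by (rule LIMSEQ_unique[OF l1 tendsto_minus[OF l2]])
  also have "\<dots> \<le> norm_L2 ?dd * norm_L2 z"
    using abs_ip_L2_le[OF L2(3,1)] by simp
  finally show ?thesis by (simp add: mult.commute)
qed

text \<open>Takes the place of density of test functions in \<open>L2\<close>: the Riesz
  representative of the pairing with \<open>G\<close> has norm at most \<open>C\<close>, and being a
  weak derivative of \<open>W\<close> as well it agrees with \<open>G\<close> almost
  everywhere.\<close>

lemma norm_L2_le_if_ip_test_le: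
  fixes G :: "real ^ 'd::finite \<Rightarrow> 'b::euclidean_space"
  assumes WG: "is_weak_pdiff \<gamma> W G" and G: "G \<in> L2" and C: "C \<ge> 0"
    and le: "\<And>\<phi>. \<phi> \<in> test_functions \<Longrightarrow> \<bar>ip_L2 G \<phi>\<bar> \<le> C * norm_L2 \<phi>"
  shows "norm_L2 G \<le> C"
proof -
  obtain F where F: "F \<in> L2" "norm_L2 F \<le> C" "\<And>\<phi>. \<phi> \<in> test_functions \<Longrightarrow> ip_L2 G \<phi> = ip_L2 F \<phi>"
    by (rule L2_riesz_test_functions[where T="ip_L2 G" and C=C])
       (auto simp: ip_L2_add_right ip_L2_scaleR_right G test_functions_L2 le C)
  have "is_weak_pdiff \<gamma> W F"
    using weak_pdiff_integral_inner[OF WG] F(3) is_weak_pdiff_L1_loc(1)[OF WG]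
    by (intro is_weak_pdiff_innerI L2_imp_L1_loc[OF F(1)]) (auto simp: ip_L2_def)
  then have "AE x in lebesgue. F x = G x"
    using WG is_weak_pdiff_unique by blast
  then show ?thesis using L2_cong_AE(2)[OF F(1) _ L2_measurable[OF G]] F(2) by simp
qed

text \<open>Mollification reduces to the smooth case, with Young's inequality controlling the
  right-hand side. The left-hand side is recovered by duality, pairing with test functions, rather
  than by convergence in norm.\<close>

lemma interpolation:
  fixes W :: "real ^ 'd::finite \<Rightarrow> 'b::euclidean_space"
  assumes W: "W \<in> L2" "is_weak_grad W H" "H \<in> L2" and J: "is_weak_pdiff \<gamma> (\<lambda>x. H x $ \<gamma>) J" "J \<in> L2"
  shows "(norm_L2 (\<lambda>x. H x $ \<gamma>))\<^sup>2 \<le> norm_L2 W * norm_L2 J"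
proof -
  let ?G = "\<lambda>x. H x $ \<gamma>"
  have G: "?G \<in> L2" by (rule L2_norm_components(1)[OF W(3)])
  have WG: "is_weak_pdiff \<gamma> W ?G" using W(2) by (simp add: is_weak_grad_def)
  have young: "conv (eta n) F \<in> L2" "norm_L2 (conv (eta n) F) \<le> norm_L2 F" if "F \<in> L2" for n and F :: "real ^ 'd \<Rightarrow> 'b"
    using conv_L2[OF eta_Cc that, of n] by (simp_all add: abs_of_nonneg[OF eta_nonneg] eta_integral)
  have pd: "pdiff \<gamma> (conv (eta n) W) = conv (eta n) ?G" "pdiff \<gamma> (conv (eta n) ?G) = conv (eta n) J" for n
    using conv_C_k(2)[OF eta_test L2_imp_L1_loc] conv_weak_pdiff[OF eta_test] W G WG J by metis+
  have smooth: "(norm_L2 (conv (eta n) ?G))\<^sup>2 \<le> norm_L2 W * norm_L2 J" for n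
  proof -
    have "grad (conv (eta n) W) \<in> L2"
      unfolding grad_conv[OF W(2) eta_test] by (rule conv_L2(1)[OF eta_Cc W(3)])
    from interpolation_smooth[OF conv_C_k(1)[OF eta_test L2_imp_L1_loc[OF W(1)]] young(1)[OF W(1)] this, where \<gamma>=\<gamma>]
    have "(norm_L2 (conv (eta n) ?G))\<^sup>2 \<le> norm_L2 (conv (eta n) W) * norm_L2 (conv (eta n) J)"
      by (simp add: pd young J)
    also have "\<dots> \<le> norm_L2 W * norm_L2 J"
      by (intro mult_mono young W J norm_L2_nonneg)
    finally show ?thesis .
  qed
  have "norm_L2 ?G \<le> sqrt (norm_L2 W * norm_L2 J)"
  proof (rule norm_L2_le_if_ip_test_le[OF WG G])
    fix \<phi> :: "real ^ 'd \<Rightarrow> 'b" assume \<phi>: "\<phi> \<in> test_functions"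
    have "ip_L2 (conv (eta n) ?G) \<phi> = (\<integral>x. conv (eta n) \<phi> x \<bullet> ?G x \<partial>lebesgue)" for n
      unfolding ip_L2_def integral_conv_swap[OF eta_Cc L2_imp_L1_loc[OF G] test_functions_Cc[OF \<phi>]]
      by (simp add: eta_even inner_commute)
    moreover have "(\<lambda>n. \<integral>x. conv (eta n) \<phi> x \<bullet> ?G x \<partial>lebesgue) \<longlonglongrightarrow> (\<integral>x. \<phi> x \<bullet> ?G x \<partial>lebesgue)"
      by (intro euclidean_bilinear.conv_eta_weak_limit[OF euclidean_bilinear_inner] L2_imp_L1_loc G test_functions_Cc \<phi>)
    ultimately have lim: "(\<lambda>n. \<bar>ip_L2 (conv (eta n) ?G) \<phi>\<bar>) \<longlonglongrightarrow> \<bar>ip_L2 ?G \<phi>\<bar>"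
      by (simp add: ip_L2_def inner_commute tendsto_rabs)
    have bd: "\<bar>ip_L2 (conv (eta n) ?G) \<phi>\<bar> \<le> sqrt (norm_L2 W * norm_L2 J) * norm_L2 \<phi>" for n
      by (rule order_trans[OF abs_ip_L2_le[OF young(1)[OF G] test_functions_L2[OF \<phi>]]])
         (intro mult_right_mono real_le_rsqrt smooth norm_L2_nonneg)
    show "\<bar>ip_L2 ?G \<phi>\<bar> \<le> sqrt (norm_L2 W * norm_L2 J) * norm_L2 \<phi>"
      by (rule LIMSEQ_le_const2[OF lim]) (use bd in blast)
  qed simp
  then have "(norm_L2 ?G)\<^sup>2 \<le> (sqrt (norm_L2 W * norm_L2 J))\<^sup>2"
    by (intro power_mono) auto
  then show ?thesis by simp
qed

section \<open>The differentiated equation and third derivatives\<close>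

lemma grad_test_functions:
  fixes v :: "real ^ 'd::finite \<Rightarrow> 'b::euclidean_space"
  assumes v: "v \<in> test_functions"
  shows "grad v \<in> test_functions"
proof -
  have "(\<lambda>x. \<Sum>\<alpha>\<in>UNIV. axis \<alpha> (pdiff \<alpha> v x)) \<in> C_k k" for k
    by (intro C_k_sum bounded_linear.C_k_linear[OF bounded_linear_axis] test_functions_C_k test_functions_pdiff v)
  then show ?thesis
    using test_functions_grad_Cc[OF v] unfolding grad_def[abs_def] vec_lambda_eq_sum_axis
    by (auto simp: test_functions_iff Cc_def simp del: C_k.simps)
qed

lemma pdiff_grad:
  fixes v :: "real ^ 'd::finite \<Rightarrow> 'b::euclidean_space"
  assumes v: "v \<in> test_functions"
  shows "pdiff \<gamma> (grad v) = grad (pdiff \<gamma> v)"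
proof (rule ext)
  fix x
  have d: "grad v differentiable (at x)"
    using C_k_SucD(1)[OF test_functions_C_k[OF grad_test_functions[OF v], of "Suc 0"]] .
  have "pdiff \<gamma> (grad v) x $ \<alpha> = pdiff \<alpha> (pdiff \<gamma> v) x" for \<alpha>
    using bounded_linear.pdiff_linear[OF bounded_linear_vec_nth d, of \<gamma> \<alpha>] pdiff_commute[OF v, of \<alpha> \<gamma>]
    by (simp add: grad_def)
  then show "pdiff \<gamma> (grad v) x = grad (pdiff \<gamma> v) x" by (simp add: grad_def vec_eq_iff)
qed

text \<open>Symmetry of second weak derivatives, inherited from test functions. It exhibits
  \<open>\<partial>\<^sub>\<gamma> u\<close> as a function whose weak gradient is
  \<open>\<partial>\<^sub>\<gamma>\<close> of the gradient, the form in which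
  \<open>second_derivatives\<close> takes its input.\<close>

lemma is_weak_grad_component:
  assumes uW: "is_weak_grad u W" and G: "is_weak_pdiff \<gamma> W G"
  shows "is_weak_grad (\<lambda>x. W x $ \<gamma>) G"
  unfolding is_weak_grad_def
proof
  fix \<beta>
  have u: "is_weak_pdiff \<alpha> u (\<lambda>x. W x $ \<alpha>)" for \<alpha> using uW by (simp add: is_weak_grad_def)
  note G\<beta> = is_weak_pdiff_vec_nth[OF G, of \<beta>]
  show "is_weak_pdiff \<beta> (\<lambda>x. W x $ \<gamma>) (\<lambda>x. G x $ \<beta>)"
  proof (rule is_weak_pdiff_innerI)
    fix \<phi> :: "real ^ 'a \<Rightarrow> 'b" assume \<phi>: "\<phi> \<in> test_functions"
    note d = test_functions_pdiff[OF \<phi>]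
    show "(\<integral>x. W x $ \<gamma> \<bullet> pdiff \<beta> \<phi> x \<partial>lebesgue) = - (\<integral>x. G x $ \<beta> \<bullet> \<phi> x \<partial>lebesgue)"
      using weak_pdiff_integral_inner[OF u d, of \<gamma> \<beta>] weak_pdiff_integral_inner[OF u d, of \<beta> \<gamma>]
        weak_pdiff_integral_inner[OF G\<beta> \<phi>] pdiff_commute[OF \<phi>, of \<beta> \<gamma>] by simp
  qed (use u G\<beta> is_weak_pdiff_L1_loc in blast)+
qed

text \<open>Each \<open>y i\<close> is bounded by \<epsilon> S + P / (4 \<epsilon>), with \<epsilon>
  so small that after summation half of c S remains on the left.\<close>

lemma absorb_square_roots:
  fixes y :: "'n::finite \<Rightarrow> real"
  assumes "c > 0" "B \<ge> 0" "P \<ge> 0" "S \<ge> 0"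
    and y: "\<And>i. (y i)\<^sup>2 \<le> P * S" and le: "c * S \<le> X + B * (\<Sum>i\<in>UNIV. y i)"
  shows "S \<le> 2 / c * X + (B * real CARD('n) + 1)\<^sup>2 / c\<^sup>2 * P"
proof -
  \<comment> \<open>The summand 1 keeps the denominator of \<epsilon> positive when \<open>B\<close>
    is 0.\<close>
  define B1 where "B1 = B * real CARD('n) + 1"
  have B1: "B1 > 0" using assms by (simp add: B1_def add_nonneg_pos)
  define \<epsilon> where "\<epsilon> = c / (2 * B1)"
  have \<epsilon>: "\<epsilon> > 0" using assms B1 by (simp add: \<epsilon>_def)
  have "y i \<le> \<epsilon> * S + P / (4 * \<epsilon>)" for i
  proof (rule power2_le_imp_le)
    have "P * S \<le> (\<epsilon> * S + P / (4 * \<epsilon>))\<^sup>2"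
    proof -
      have "(\<epsilon> * S + P / (4 * \<epsilon>))\<^sup>2 - P * S = (\<epsilon> * S - P / (4 * \<epsilon>))\<^sup>2"
        using \<epsilon> by (simp add: power2_eq_square field_simps)
      then show ?thesis using zero_le_power2[of "\<epsilon> * S - P / (4 * \<epsilon>)"] by linarith
    qed
    then show "(y i)\<^sup>2 \<le> (\<epsilon> * S + P / (4 * \<epsilon>))\<^sup>2" using y[of i] by linarith
  qed (use assms \<epsilon> in simp)
  then have "(\<Sum>i\<in>UNIV. y i) \<le> (\<Sum>i\<in>(UNIV :: 'n set). \<epsilon> * S + P / (4 * \<epsilon>))"
    by (intro sum_mono)
  then have "B * (\<Sum>i\<in>UNIV. y i) \<le> B * (real CARD('n) * (\<epsilon> * S + P / (4 * \<epsilon>)))"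
    using assms by (intro mult_left_mono) auto
  also have "\<dots> \<le> B1 * (\<epsilon> * S + P / (4 * \<epsilon>))"
    using assms \<epsilon> by (simp add: B1_def distrib_right mult.assoc)
  also have "\<dots> = c / 2 * S + B1\<^sup>2 / (2 * c) * P"
    using B1 \<open>c > 0\<close> by (simp add: \<epsilon>_def field_simps power2_eq_square)
  finally have "c / 2 * S \<le> X + B1\<^sup>2 / (2 * c) * P" using le by linarith
  then have "2 / c * (c / 2 * S) \<le> 2 / c * (X + B1\<^sup>2 / (2 * c) * P)"
    using \<open>c > 0\<close> by (intro mult_left_mono) auto
  also have "2 / c * (X + B1\<^sup>2 / (2 * c) * P) = 2 / c * X + B1\<^sup>2 / c\<^sup>2 * P"
    using \<open>c > 0\<close> by (simp add: field_simps power2_eq_square)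
  finally show ?thesis using \<open>c > 0\<close> by (simp add: B1_def)
qed

context elliptic_coefficients
begin

text \<open>The equation is tested with the derivative of v. Besides the new principal part, the
  product rule leaves the flux \<Theta> made of \<partial>A and \<open>W\<close>; a further
  integration by parts turns it into a right-hand side in \<open>L2\<close>, at the price of second
  derivatives of \<open>A\<close> and of products of \<partial>A with \<open>G\<close>.\<close>

lemma differentiated_equation:
  fixes u f :: "real ^ 'd \<Rightarrow> 'b" and G :: "'d \<Rightarrow> real ^ 'd \<Rightarrow> 'b ^ 'd"
  assumes A2: "A \<in> C_k 2" and M: "\<And>\<alpha> \<beta> x. norm (pdiff \<beta> (pdiff \<alpha> A) x) \<le> M"
    and W: "W \<in> L2" and f': "is_weak_pdiff \<gamma> f f'" "f' \<in> L2"
    and G: "\<And>\<beta>. G \<beta> \<in> L2" "\<And>\<beta>. is_weak_pdiff \<beta> W (G \<beta>)"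
    and eq: "\<And>v. v \<in> test_functions \<Longrightarrow> ip_L2 (\<lambda>x. h (A x) (W x)) (grad v) = ip_L2 f v"
  obtains F where "F \<in> L2"
    "norm_L2 F \<le> norm_L2 f' + real CARD('d) * (K * M * norm_L2 W) + K * N * (\<Sum>\<beta>\<in>UNIV. norm_L2 (G \<beta>))"
    "\<And>v. v \<in> test_functions \<Longrightarrow> ip_L2 (\<lambda>x. h (A x) (G \<gamma> x)) (grad v) = ip_L2 F v"
proof -
  have A1: "pdiff \<alpha> A \<in> C_k 1" for \<alpha>
    using C_k_SucD(2)[of A 1 \<alpha>] A2 by (simp add: numeral_2_eq_2 del: C_k.simps)
  have cont: "continuous_on UNIV (pdiff \<alpha> A)" "continuous_on UNIV (pdiff \<beta> (pdiff \<alpha> A))" for \<alpha> \<beta>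
    using C_k_continuous[OF A1] C_k_SucD(2)[of "pdiff \<alpha> A" 0 \<beta>] A1 by auto
  define \<Theta> where "\<Theta> x = h (pdiff \<gamma> A x) (W x)" for x
  define \<Theta>' where "\<Theta>' \<beta> x = h (pdiff \<beta> (pdiff \<gamma> A) x) (W x) + h (pdiff \<gamma> A x) (G \<beta> x)" for \<beta> x
  have \<Theta>w: "is_weak_pdiff \<beta> \<Theta> (\<Theta>' \<beta>)" for \<beta>
    unfolding \<Theta>_def[abs_def] \<Theta>'_def[abs_def] by (rule is_weak_pdiff_bilinear[OF A1 G(2)])
  have \<Theta>L2: "\<Theta> \<in> L2" unfolding \<Theta>_def[abs_def] by (rule L2_coefficient(1)[OF W cont(1) dA_bound])
  note t1 = L2_coefficient[OF W cont(2) M] and t2 = L2_coefficient[OF G(1) cont(1) dA_bound]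
  have \<Theta>'L2: "\<Theta>' \<beta> \<in> L2" for \<beta>
    unfolding \<Theta>'_def[abs_def] by (intro L2_add t1(1) t2(1))
  have \<Theta>'n: "norm_L2 (\<Theta>' \<beta>) \<le> K * M * norm_L2 W + K * N * norm_L2 (G \<beta>)" for \<beta>
    unfolding \<Theta>'_def[abs_def] by (rule order_trans[OF norm_L2_triangle[OF t1(1) t2(1)] add_mono[OF t1(2) t2(2)]])
  note \<Theta>c = L2_norm_components[OF \<Theta>'L2]
  define F where "F x = f' x + (\<Sum>\<beta>\<in>UNIV. \<Theta>' \<beta> x $ \<beta>)" for x
  have sL2: "(\<lambda>x. \<Sum>\<beta>\<in>UNIV. \<Theta>' \<beta> x $ \<beta>) \<in> L2" by (intro L2_sum \<Theta>c)
  have FL2: "F \<in> L2" unfolding F_def[abs_def] by (intro L2_add f' sL2)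
  have "norm_L2 F \<le> norm_L2 f' + (\<Sum>\<beta>\<in>UNIV. norm_L2 (\<lambda>x. \<Theta>' \<beta> x $ \<beta>))"
    unfolding F_def[abs_def]
    by (intro order_trans[OF norm_L2_triangle[OF f'(2) sL2]] add_left_mono norm_L2_sum \<Theta>c)
  also have "\<dots> \<le> norm_L2 f' + (\<Sum>\<beta>\<in>UNIV. K * M * norm_L2 W + K * N * norm_L2 (G \<beta>))"
    by (intro add_left_mono sum_mono order_trans[OF \<Theta>c(2) \<Theta>'n])
  also have "\<dots> = norm_L2 f' + real CARD('d) * (K * M * norm_L2 W) + K * N * (\<Sum>\<beta>\<in>UNIV. norm_L2 (G \<beta>))"
    by (simp add: sum.distrib sum_distrib_left)
  finally have Fn: "norm_L2 F \<le> norm_L2 f' + real CARD('d) * (K * M * norm_L2 W) + K * N * (\<Sum>\<beta>\<in>UNIV. norm_L2 (G \<beta>))" .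
  have "ip_L2 (\<lambda>x. h (A x) (G \<gamma> x)) (grad v) = ip_L2 F v" if v: "v \<in> test_functions" for v
  proof -
    note dv = test_functions_pdiff[OF v, of \<gamma>]
    have gv: "grad v \<in> L2" and vL2: "v \<in> L2" by (intro test_functions_L2 grad_test_functions v)+
    have hG: "(\<lambda>x. h (A x) (G \<gamma> x)) \<in> L2" by (rule L2_coefficient(1)[OF G(1) continuous_A A_bound])
    have "is_weak_pdiff \<gamma> (\<lambda>x. h (A x) (W x)) (\<lambda>x. \<Theta> x + h (A x) (G \<gamma> x))"
      unfolding \<Theta>_def by (rule is_weak_pdiff_bilinear[OF A_C_1 G(2)])
    from weak_pdiff_integral_inner[OF this grad_test_functions[OF v]]
    have "ip_L2 (\<lambda>x. h (A x) (W x)) (grad (pdiff \<gamma> v)) = - (ip_L2 \<Theta> (grad v) + ip_L2 (\<lambda>x. h (A x) (G \<gamma> x)) (grad v))"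
      unfolding pdiff_grad[OF v] by (simp add: ip_L2_def[symmetric] ip_L2_add_left \<Theta>L2 hG gv)
    moreover have "ip_L2 f (pdiff \<gamma> v) = - ip_L2 f' v"
      using weak_pdiff_integral_inner[OF f'(1) v] by (simp add: ip_L2_def)
    ultimately have e: "ip_L2 (\<lambda>x. h (A x) (G \<gamma> x)) (grad v) = ip_L2 f' v - ip_L2 \<Theta> (grad v)"
      using eq[OF dv] by linarith
    have "ip_L2 \<Theta> (grad v) = (\<integral>x. (\<Sum>\<beta>\<in>UNIV. \<Theta> x $ \<beta> \<bullet> pdiff \<beta> v x) \<partial>lebesgue)"
      by (simp add: ip_L2_def inner_vec_def grad_def)
    also have "\<dots> = (\<Sum>\<beta>\<in>UNIV. \<integral>x. \<Theta> x $ \<beta> \<bullet> pdiff \<beta> v x \<partial>lebesgue)"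
      by (intro Bochner_Integration.integral_sum L2_inner_integrable L2_norm_components \<Theta>L2
          test_functions_L2 test_functions_pdiff v)
    also have "\<dots> = - (\<Sum>\<beta>\<in>UNIV. \<integral>x. \<Theta>' \<beta> x $ \<beta> \<bullet> v x \<partial>lebesgue)"
      unfolding weak_pdiff_integral_inner[OF is_weak_pdiff_vec_nth[OF \<Theta>w] v] by (simp add: sum_negf)
    also have "(\<Sum>\<beta>\<in>UNIV. \<integral>x. \<Theta>' \<beta> x $ \<beta> \<bullet> v x \<partial>lebesgue) = (\<integral>x. (\<Sum>\<beta>\<in>UNIV. \<Theta>' \<beta> x $ \<beta> \<bullet> v x) \<partial>lebesgue)"
      by (intro Bochner_Integration.integral_sum[symmetric] L2_inner_integrable \<Theta>c vL2)
    also have "\<dots> = ip_L2 (\<lambda>x. \<Sum>\<beta>\<in>UNIV. \<Theta>' \<beta> x $ \<beta>) v"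
      by (simp add: ip_L2_def inner_sum_left)
    finally show ?thesis
      unfolding e F_def[abs_def] by (simp add: ip_L2_add_left f' sL2 vL2)
  qed
  then show ?thesis using that FL2 Fn by blast
qed

text \<open>The bound for a single third derivative involves second derivatives in all directions,
  each controlled only through another third derivative. Hence nothing is absorbed until all
  directions have been summed into \<open>S\<close>.\<close>

lemma third_derivatives:
  fixes u f :: "real ^ 'd \<Rightarrow> 'b" and G :: "'d \<Rightarrow> real ^ 'd \<Rightarrow> 'b ^ 'd"
  assumes A2: "A \<in> C_k 2" and M: "\<And>\<alpha> \<beta> x. norm (pdiff \<beta> (pdiff \<alpha> A) x) \<le> M"
    and NM: "N\<^sup>2 \<le> 8 * a * (real CARD('d) * M)"
    and uW: "is_weak_grad u W" and W: "W \<in> L2"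
    and f': "\<And>\<gamma>. is_weak_pdiff \<gamma> f (f' \<gamma>)" "\<And>\<gamma>. f' \<gamma> \<in> L2"
    and G: "\<And>\<beta>. G \<beta> \<in> L2" "\<And>\<beta>. is_weak_pdiff \<beta> W (G \<beta>)"
    and eq: "\<And>v. v \<in> test_functions \<Longrightarrow> ip_L2 (\<lambda>x. h (A x) (W x)) (grad v) = ip_L2 f v"
  defines "D \<equiv> real CARD('d)" and "B \<equiv> (real CARD('d))\<^sup>2 * K * (1 + eta_const TYPE('d))"
  obtains J where "\<And>\<gamma> \<delta>. J \<gamma> \<delta> \<in> L2" "\<And>\<gamma> \<delta>. is_weak_pdiff \<delta> (G \<gamma>) (J \<gamma> \<delta>)"
    "(\<Sum>\<gamma>\<in>UNIV. \<Sum>\<delta>\<in>UNIV. norm_L2 (J \<gamma> \<delta>)) \<le> 2 / c\<^sub>0 * (D * (\<Sum>\<gamma>\<in>UNIV. norm_L2 (f' \<gamma>)) + D ^ 3 * K * M * norm_L2 W)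
      + (B * D + 1)\<^sup>2 / c\<^sub>0\<^sup>2 * (8 * a * D * M * norm_L2 W)"
proof -
  define g where "g = (\<Sum>\<beta>\<in>UNIV. norm_L2 (G \<beta>))"
  have M0: "M \<ge> 0" using order_trans[OF norm_ge_zero M] .
  have "\<exists>J. J \<in> L2 \<and> is_weak_pdiff \<delta> (G \<gamma>) J \<and> c\<^sub>0 * norm_L2 J \<le> (norm_L2 (f' \<gamma>) + D * (K * M * norm_L2 W) + K * N * g)
      + (K * (D * N)) * (eta_const TYPE('d) * norm_L2 (G \<gamma>))" for \<gamma> \<delta>
  proof -
    obtain F where F: "F \<in> L2" "norm_L2 F \<le> norm_L2 (f' \<gamma>) + D * (K * M * norm_L2 W) + K * N * g"
      "\<And>v. v \<in> test_functions \<Longrightarrow> ip_L2 (\<lambda>x. h (A x) (G \<gamma> x)) (grad v) = ip_L2 F v"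
      unfolding D_def g_def using differentiated_equation[OF A2 M W f' G eq] by blast
    obtain J where "J \<in> L2" "is_weak_pdiff \<delta> (G \<gamma>) J"
      "c\<^sub>0 * norm_L2 J \<le> norm_L2 F + (K * (D * N)) * (eta_const TYPE('d) * norm_L2 (G \<gamma>))"
      unfolding D_def using second_derivatives[OF is_weak_grad_component[OF uW G(2)] G(1) F(1,3)] by blast
    then show ?thesis using F(2) by (intro exI[of _ J]) linarith
  qed
  then have "\<forall>\<gamma>. \<exists>J. \<forall>\<delta>. J \<delta> \<in> L2 \<and> is_weak_pdiff \<delta> (G \<gamma>) (J \<delta>)
      \<and> c\<^sub>0 * norm_L2 (J \<delta>) \<le> (norm_L2 (f' \<gamma>) + D * (K * M * norm_L2 W) + K * N * g)
      + (K * (D * N)) * (eta_const TYPE('d) * norm_L2 (G \<gamma>))"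
    by (intro allI choice) blast
  from choice[OF this] obtain J where J: "\<And>\<gamma> \<delta>. J \<gamma> \<delta> \<in> L2" "\<And>\<gamma> \<delta>. is_weak_pdiff \<delta> (G \<gamma>) (J \<gamma> \<delta>)"
    "\<And>\<gamma> \<delta>. c\<^sub>0 * norm_L2 (J \<gamma> \<delta>) \<le> (norm_L2 (f' \<gamma>) + D * (K * M * norm_L2 W) + K * N * g)
      + (K * (D * N)) * (eta_const TYPE('d) * norm_L2 (G \<gamma>))"
    by blast
  define S where "S = (\<Sum>\<gamma>\<in>UNIV. \<Sum>\<delta>\<in>UNIV. norm_L2 (J \<gamma> \<delta>))"
  have S0: "S \<ge> 0" unfolding S_def by (intro sum_nonneg norm_L2_nonneg)
  have "c\<^sub>0 * S \<le> (\<Sum>\<gamma>\<in>UNIV. \<Sum>\<delta>\<in>(UNIV :: 'd set). (norm_L2 (f' \<gamma>) + D * (K * M * norm_L2 W) + K * N * g)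
      + (K * (D * N)) * (eta_const TYPE('d) * norm_L2 (G \<gamma>)))"
    unfolding S_def sum_distrib_left by (intro sum_mono J)
  \<comment> \<open>There are D^2 pairs of directions. Each contributes \<open>K * N * g\<close>
    from the right-hand side, and the commutator term, which has its own factor D, occurs once for
    each \<delta>; together they make up \<open>B\<close>.\<close>
  also have "\<dots> = (D * (\<Sum>\<gamma>\<in>UNIV. norm_L2 (f' \<gamma>)) + D ^ 3 * K * M * norm_L2 W)
      + B * (\<Sum>\<gamma>\<in>UNIV. N * norm_L2 (G \<gamma>))"
    by (simp add: sum.distrib g_def B_def flip: sum_distrib_left D_def)
       (simp add: power2_eq_square power3_eq_cube algebra_simps)
  finally have cS: "c\<^sub>0 * S \<le> (D * (\<Sum>\<gamma>\<in>UNIV. norm_L2 (f' \<gamma>)) + D ^ 3 * K * M * norm_L2 W)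
      + B * (\<Sum>\<gamma>\<in>UNIV. N * norm_L2 (G \<gamma>))" .
  have y: "(N * norm_L2 (G \<gamma>))\<^sup>2 \<le> (8 * a * D * M * norm_L2 W) * S" for \<gamma>
  proof -
    \<comment> \<open>Interpolation in direction \<gamma> involves only the repeated derivative
      \<open>J \<gamma> \<gamma>\<close>, one summand of \<open>S\<close>.\<close>
    have "(norm_L2 (G \<gamma>))\<^sup>2 \<le> norm_L2 W * norm_L2 (J \<gamma> \<gamma>)"
    proof -
      let ?H = "\<lambda>x. \<chi> \<beta>. G \<beta> x"
      have "is_weak_grad W ?H" "?H \<in> L2"
        using G by (auto simp: is_weak_grad_def intro!: L2_vec)
      from interpolation[OF W this, of \<gamma> "J \<gamma> \<gamma>"] J show ?thesis by simp
    qed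
    also have "\<dots> \<le> norm_L2 W * S"
    proof (intro mult_left_mono norm_L2_nonneg)
      have "norm_L2 (J \<gamma> \<gamma>) \<le> (\<Sum>\<delta>\<in>UNIV. norm_L2 (J \<gamma> \<delta>))"
        by (rule member_le_sum) auto
      also have "\<dots> \<le> S"
        unfolding S_def by (rule member_le_sum[where f="\<lambda>\<gamma>. \<Sum>\<delta>\<in>UNIV. norm_L2 (J \<gamma> \<delta>)"]) (auto intro: sum_nonneg)
      finally show "norm_L2 (J \<gamma> \<gamma>) \<le> S" .
    qed
    finally have "N\<^sup>2 * (norm_L2 (G \<gamma>))\<^sup>2 \<le> (8 * a * (D * M)) * (norm_L2 W * S)"
      using NM a_nonneg M0 by (intro mult_mono) (auto simp: D_def)
    then show ?thesis by (simp add: power_mult_distrib mult_ac)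
  qed
  have "B \<ge> 0" "8 * a * D * M * norm_L2 W \<ge> 0"
    using a_nonneg M0 K(2) eta_const_nonneg[where 'd='d] by (auto simp: B_def D_def intro!: mult_nonneg_nonneg)
  from absorb_square_roots[OF c\<^sub>0 this S0 y cS]
  show ?thesis using that[of J] J unfolding S_def by (simp add: D_def)
qed

end

section \<open>The system in coordinates\<close>

text \<open>The contraction of the coefficient with the gradient, indexed like a gradient with the
  differentiation index outermost, so that the integrand of \<open>elliptic_form\<close> becomes an
  inner product with \<open>wgrad v x\<close>.\<close>

definition flux :: "real ^ 'd ^ 'm ^ 'd ^ 'm \<Rightarrow> (real ^ 'm) ^ 'd \<Rightarrow> (real ^ 'm::finite) ^ 'd::finite"
  where "flux P y = (\<chi> \<beta> j. \<Sum>i\<in>UNIV. \<Sum>\<alpha>\<in>UNIV. P $ i $ \<alpha> $ j $ \<beta> * y $ \<alpha> $ i)"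

lemma bounded_bilinear_flux: "bounded_bilinear flux"
proof -
  have "bilinear (flux :: real ^ 'd::finite ^ 'm::finite ^ 'd ^ 'm \<Rightarrow> _)"
    unfolding bilinear_def
    by (auto intro!: linearI simp: flux_def vec_eq_iff algebra_simps sum.distrib sum_distrib_left)
  then show ?thesis by (simp add: bilinear_conv_bounded_bilinear)
qed

text \<open>Adjacent swaps reorder the four sums from i, \<alpha>, j, \<beta> to \<beta>, j, i,
  \<alpha>.\<close>

lemma flux_inner:
  "flux P y \<bullet> z = (\<Sum>i\<in>UNIV. \<Sum>\<alpha>\<in>UNIV. \<Sum>j\<in>UNIV. \<Sum>\<beta>\<in>UNIV. P $ i $ \<alpha> $ j $ \<beta> * y $ \<alpha> $ i * z $ \<beta> $ j)"
proof -
  let ?F = "\<lambda>i \<alpha> j \<beta>. P $ i $ \<alpha> $ j $ \<beta> * y $ \<alpha> $ i * z $ \<beta> $ j"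
  have "(\<Sum>i\<in>UNIV. \<Sum>\<alpha>\<in>UNIV. \<Sum>j\<in>UNIV. \<Sum>\<beta>\<in>UNIV. ?F i \<alpha> j \<beta>) = (\<Sum>i\<in>UNIV. \<Sum>\<alpha>\<in>UNIV. \<Sum>\<beta>\<in>UNIV. \<Sum>j\<in>UNIV. ?F i \<alpha> j \<beta>)"
    by (rule sum.cong[OF refl], rule sum.cong[OF refl], rule sum.swap)
  also have "\<dots> = (\<Sum>i\<in>UNIV. \<Sum>\<beta>\<in>UNIV. \<Sum>\<alpha>\<in>UNIV. \<Sum>j\<in>UNIV. ?F i \<alpha> j \<beta>)"
    by (rule sum.cong[OF refl], rule sum.swap)
  also have "\<dots> = (\<Sum>\<beta>\<in>UNIV. \<Sum>i\<in>UNIV. \<Sum>\<alpha>\<in>UNIV. \<Sum>j\<in>UNIV. ?F i \<alpha> j \<beta>)"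
    by (rule sum.swap)
  also have "\<dots> = (\<Sum>\<beta>\<in>UNIV. \<Sum>i\<in>UNIV. \<Sum>j\<in>UNIV. \<Sum>\<alpha>\<in>UNIV. ?F i \<alpha> j \<beta>)"
    by (rule sum.cong[OF refl], rule sum.cong[OF refl], rule sum.swap)
  also have "\<dots> = (\<Sum>\<beta>\<in>UNIV. \<Sum>j\<in>UNIV. \<Sum>i\<in>UNIV. \<Sum>\<alpha>\<in>UNIV. ?F i \<alpha> j \<beta>)"
    by (rule sum.cong[OF refl], rule sum.swap)
  also have "\<dots> = flux P y \<bullet> z"
    by (simp add: flux_def inner_vec_def sum_distrib_right)
  finally show ?thesis by simp
qed

text \<open>\<open>wgrad\<close> is a choice; any other weak gradients give the same integral
  because they agree with it almost everywhere.\<close>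

lemma elliptic_form_eq_ip_L2:
  assumes u: "is_weak_grad u U" and v: "is_weak_grad v V"
    and A: "A \<in> borel_measurable lebesgue"
  shows "elliptic_form A u v = ip_L2 (\<lambda>x. flux (A x) (U x)) V"
proof -
  have eb: "euclidean_bilinear flux" by (simp add: euclidean_bilinear_def bounded_bilinear_flux)
  have m: "(\<lambda>x. flux (A x) (X x) \<bullet> Y x) \<in> borel_measurable lebesgue"
    if "X \<in> borel_measurable lebesgue" "Y \<in> borel_measurable lebesgue" for X Y
    by (intro borel_measurable_inner euclidean_bilinear.borel_measurable_bilinear[OF eb] A that)
  have "AE x in lebesgue. flux (A x) (wgrad u x) \<bullet> wgrad v x = flux (A x) (U x) \<bullet> V x"
    using wgrad_AE[OF u] wgrad_AE[OF v] by eventually_elim simp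
  then show ?thesis
    unfolding elliptic_form_def ip_L2_def flux_inner[symmetric]
    by (intro integral_cong_AE m wgrad_measurable[OF u] wgrad_measurable[OF v]
        L1_loc_measurable is_weak_grad_L1_loc[OF u] is_weak_grad_L1_loc[OF v])
qed

lemma Hdot1I:
  assumes "z \<in> L2" "is_weak_grad z Z" "Z \<in> L2"
  shows "z \<in> Hdot1"
  using assms wgrad_L2(1)[OF assms(2,3)] L2_imp_L2_loc[OF assms(1)] L2_imp_L2_loc[OF wgrad_L2(1)[OF assms(2,3)]]
  by (auto simp: Hdot1_def W12_loc_def weakly_differentiable_def)

lemma is_weak_grad_Hdot1:
  assumes "u \<in> Hdot1"
  shows "is_weak_grad u (wgrad u)" "wgrad u \<in> L2"
  using assms is_weak_grad_wgrad by (auto simp: Hdot1_def W12_loc_def weakly_differentiable_def)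

text \<open>Coercivity on \<open>Hdot1\<close> is specialised to smooth functions, for which
  \<open>wgrad\<close> may be replaced by \<open>grad\<close>.\<close>

lemma flux_elliptic_coefficients:
  fixes A :: "real ^ 'd::finite \<Rightarrow> real ^ 'd ^ 'm::finite ^ 'd ^ 'm"
  assumes K: "\<And>(P :: real ^ 'd ^ 'm ^ 'd ^ 'm) y. norm (flux P y) \<le> K * norm P * norm y" "K \<ge> 0"
    and A: "A \<in> C_k 1" "\<And>x. norm (A x) \<le> a" "\<And>\<alpha> x. norm (pdiff \<alpha> A x) \<le> N"
    and c\<^sub>0: "c\<^sub>0 > 0" "coercive_form c\<^sub>0 (elliptic_form A)"
  shows "elliptic_coefficients flux A c\<^sub>0 K a N"
proof -
  have "c\<^sub>0 * (norm_L2 (grad z))\<^sup>2 \<le> ip_L2 (\<lambda>x. flux (A x) (grad z x)) (grad z)"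
    if z: "\<And>k. z \<in> C_k k" "z \<in> L2" "grad z \<in> L2" for z
  proof -
    note w = C_1_is_weak_grad[OF z(1)]
    have "c\<^sub>0 * (norm_L2 (wgrad z))\<^sup>2 \<le> elliptic_form A z z"
      using c\<^sub>0(2) Hdot1I[OF z(2) w z(3)] by (simp add: coercive_form_def)
    then show ?thesis
      using elliptic_form_eq_ip_L2[OF w w continuous_imp_measurable_lebesgue[OF C_k_continuous[OF A(1)]]]
        wgrad_L2(2)[OF w z(3)] by simp
  qed
  then show ?thesis
    using assms bounded_bilinear_flux
    by (simp add: elliptic_coefficients_def elliptic_coefficients_axioms_def euclidean_bilinear_def del: C_k.simps)
qed

lemma weak_equation:
  assumes A: "A \<in> borel_measurable lebesgue" and u: "u \<in> Hdot1" and l: "load_functional f l"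
    and eq: "\<forall>v\<in>test_functions. elliptic_form A u v = l v" and v: "v \<in> test_functions"
  shows "ip_L2 (\<lambda>x. flux (A x) (wgrad u x)) (grad v) = ip_L2 f v"
  using elliptic_form_eq_ip_L2[OF is_weak_grad_Hdot1(1)[OF u] C_1_is_weak_grad[OF test_functions_C_k[OF v]] A]
    eq l v by (simp add: load_functional_def ip_L2_def)

lemma sobolev_1I:
  assumes "F \<in> L2" "\<And>\<alpha>. is_weak_pdiff \<alpha> F (G \<alpha>)" "\<And>\<alpha>. G \<alpha> \<in> L2"
  shows "F \<in> sobolev 1"
  using assms by auto

lemma is_weak_grad_vec:
  "(\<And>\<alpha>. is_weak_pdiff \<alpha> F (G \<alpha>)) \<Longrightarrow> is_weak_grad F (\<lambda>x. \<chi> \<alpha>. G \<alpha> x)"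
  by (simp add: is_weak_grad_def)

lemma norm_pdiff_le_Linf:
  fixes A :: "real ^ 'd::finite \<Rightarrow> 'b::euclidean_space"
  assumes "A \<in> C_k 1" "wgrad A \<in> L_inf"
  shows "norm (pdiff \<alpha> A x) \<le> norm_Linf (wgrad A)"
proof -
  have "norm (pdiff \<alpha> A x) \<le> norm (grad A x)"
    using Finite_Cartesian_Product.norm_nth_le[of "grad A x" \<alpha>] by (simp add: grad_def)
  also have "\<dots> \<le> norm_Linf (wgrad A)"
    by (rule continuous_le_norm_Linf[OF assms(2) wgrad_AE[OF C_1_is_weak_grad[OF assms(1)]] continuous_grad[OF assms(1)]])
  finally show ?thesis .
qed

lemma norm_pdiff_pdiff_le_Linf:
  fixes A :: "real ^ 'd::finite \<Rightarrow> 'b::euclidean_space"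
  assumes A: "A \<in> C_k 2" and L: "wgrad (wgrad A) \<in> L_inf"
  shows "norm (pdiff \<beta> (pdiff \<alpha> A) x) \<le> norm_Linf (wgrad (wgrad A))"
proof -
  let ?H = "\<lambda>x. \<chi> \<beta>. \<chi> \<alpha>. pdiff \<beta> (pdiff \<alpha> A) x"
  have A1: "A \<in> C_k 1" "pdiff \<alpha> A \<in> C_k 1" for \<alpha>
    using C_k_mono[OF A, of 1] C_k_SucD(2)[of A 1 \<alpha>] A by (auto simp: numeral_2_eq_2 simp del: C_k.simps)
  note w = C_1_is_weak_grad[OF A1(1)]
  have "is_weak_grad (grad A) ?H"
    unfolding grad_def[abs_def] by (intro is_weak_grad_vec is_weak_pdiff_vec C_1_is_weak_pdiff A1)
  \<comment> \<open>\<open>wgrad A\<close> equals \<open>grad A\<close> only almost everywhere,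
    which is enough for both to have the same weak gradient.\<close>
  then have H: "is_weak_grad (wgrad A) ?H"
    using wgrad_AE[OF w] wgrad_measurable[OF w] by (rule is_weak_grad_cong_AE)
  have "norm (pdiff \<beta> (pdiff \<alpha> A) x) \<le> norm (?H x)"
    using Finite_Cartesian_Product.norm_nth_le[of "?H x" \<beta>]
      Finite_Cartesian_Product.norm_nth_le[of "?H x $ \<beta>" \<alpha>] by simp
  also have "continuous_on UNIV ?H"
    using A1(2) by (intro continuous_on_vec_lambda) auto
  then have "norm (?H x) \<le> norm_Linf (wgrad (wgrad A))"
    by (rule continuous_le_norm_Linf[OF L wgrad_AE[OF H]])
  finally show ?thesis .
qed

theorem theorem6:
  fixes c\<^sub>0 c\<^sub>1 :: real
  assumes "c\<^sub>0 > 0"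
  shows "\<exists>K::real. \<forall>(A :: real ^ 'd::finite \<Rightarrow> real ^ 'd ^ 'm::finite ^ 'd ^ 'm)
             (f :: real ^ 'd \<Rightarrow> real ^ 'm) (g :: real ^ 'd \<Rightarrow> real ^ 'd ^ 'm)
             (l :: (real ^ 'd \<Rightarrow> real ^ 'm) \<Rightarrow> real) (u :: real ^ 'd \<Rightarrow> real ^ 'm) (c\<^sub>2 :: real).
     A \<in> L_inf \<longrightarrow> norm_Linf A \<le> c\<^sub>1 \<longrightarrow>
     symmetric_form (elliptic_form A) \<longrightarrow>
     f \<in> L1_loc \<longrightarrow> g \<in> L2 \<longrightarrow> is_weak_div g f \<longrightarrow> load_functional f l \<longrightarrow>
     coercive_form c\<^sub>0 (elliptic_form A) \<longrightarrow>
     u \<in> Hdot1 \<longrightarrow> (\<forall>v \<in> test_functions. elliptic_form A u v = l v) \<longrightarrow>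
     norm_L2 (wgrad u) \<le> c\<^sub>2 \<longrightarrow>
       (A \<in> C_k 1 \<longrightarrow> wgrad A \<in> L_inf \<longrightarrow> f \<in> L2 \<longrightarrow>
          u \<in> Hdot 2 \<and>
          norm_L2 (wgrad (wgrad u)) \<le> K * (norm_L2 f + c\<^sub>2 * norm_Linf (wgrad A))) \<and>
       (A \<in> C_k 2 \<longrightarrow> wgrad (wgrad A) \<in> L_inf \<longrightarrow> wgrad A \<in> L2 \<longrightarrow> f \<in> sobolev 1 \<longrightarrow>
          u \<in> Hdot 3 \<and>
          norm_L2 (wgrad (wgrad (wgrad u))) \<le>
            K * (norm_L2 (wgrad f) + norm_L2 (wgrad A) * norm_L2 (wgrad (wgrad u))
                 + c\<^sub>2 * norm_Linf (wgrad (wgrad A))))"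
proof -
  interpret bounded_bilinear "flux :: real ^ 'd ^ 'm ^ 'd ^ 'm \<Rightarrow> _" by (rule bounded_bilinear_flux)
  obtain K where K0: "K \<ge> 0" and "\<And>(P :: real ^ 'd ^ 'm ^ 'd ^ 'm) y. norm (flux P y) \<le> norm P * norm y * K"
    using nonneg_bounded by metis
  then have K: "\<And>(P :: real ^ 'd ^ 'm ^ 'd ^ 'm) y. norm (flux P y) \<le> K * norm P * norm y"
    by (simp add: mult_ac)
  define D where "D = real CARD('d)"
  define \<eta> where "\<eta> = eta_const TYPE('d)"
  have D: "D \<ge> 0" and \<eta>: "\<eta> \<ge> 0" by (auto simp: D_def \<eta>_def eta_const_nonneg)
  define B where "B = D\<^sup>2 * K * (1 + \<eta>)"
  \<comment> \<open>The sum of the D directional bounds for second derivatives, each divided by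
    \<open>c\<^sub>0\<close>, with the two coefficients enlarged to a common one.\<close>
  define K1 where "K1 = D / c\<^sub>0 * (1 + K * D * \<eta>)"
  \<comment> \<open>The bound of \<open>third_derivatives\<close> with coefficient bound
    \<open>c\<^sub>1\<close>. One more factor D in front of the data arises because each of the D
    derivatives of f is bounded by its full gradient. The absolute value makes \<open>K2\<close>
    nonnegative before any \<open>A\<close> is given.\<close>
  define K2 where "K2 = 2 / c\<^sub>0 * (D\<^sup>2 + D ^ 3 * K) + (B * D + 1)\<^sup>2 / c\<^sub>0\<^sup>2 * (8 * \<bar>c\<^sub>1\<bar> * D)"
  have K1: "K1 \<ge> 0" and K2: "K2 \<ge> 0"
    using assms D \<eta> K0 by (auto simp: K1_def K2_def)
  show ?thesis
  proof (intro exI[of _ "K1 + K2"] allI impI)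
    fix A :: "real ^ 'd \<Rightarrow> real ^ 'd ^ 'm ^ 'd ^ 'm" and f :: "real ^ 'd \<Rightarrow> real ^ 'm"
      and g :: "real ^ 'd \<Rightarrow> real ^ 'd ^ 'm" and l :: "(real ^ 'd \<Rightarrow> real ^ 'm) \<Rightarrow> real"
      and u :: "real ^ 'd \<Rightarrow> real ^ 'm" and c\<^sub>2 :: real
    assume A: "A \<in> L_inf" "norm_Linf A \<le> c\<^sub>1" and l: "load_functional f l"
      and coercive: "coercive_form c\<^sub>0 (elliptic_form A)" and u: "u \<in> Hdot1"
      and eq: "\<forall>v\<in>test_functions. elliptic_form A u v = l v" and c\<^sub>2: "norm_L2 (wgrad u) \<le> c\<^sub>2"
    let ?W = "wgrad u"
    note uW = is_weak_grad_Hdot1(1)[OF u] and W = is_weak_grad_Hdot1(2)[OF u]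
    have Am: "A \<in> borel_measurable lebesgue" using A(1) by (simp add: L_inf_def)
    note weq = weak_equation[OF Am u l eq]
    have c\<^sub>1: "c\<^sub>1 \<ge> 0" using L_inf_bounds(1)[OF A(1)] A(2) by linarith
    have c\<^sub>20: "c\<^sub>2 \<ge> 0" using norm_L2_nonneg c\<^sub>2 order_trans by blast
    have A_bound: "norm (A x) \<le> c\<^sub>1" if "A \<in> C_k 1" for x
      by (rule order_trans[OF continuous_le_norm_Linf[OF A(1) _ C_k_continuous[OF that]] A(2)]) simp
    have "u \<in> Hdot 2 \<and> norm_L2 (wgrad ?W) \<le> (K1 + K2) * (norm_L2 f + c\<^sub>2 * norm_Linf (wgrad A))"
      if A1: "A \<in> C_k 1" and dA: "wgrad A \<in> L_inf" and f: "f \<in> L2"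
    proof -
      let ?N = "norm_Linf (wgrad A)"
      interpret ec: elliptic_coefficients flux A c\<^sub>0 K c\<^sub>1 ?N
        by (rule flux_elliptic_coefficients[OF K K0 A1 A_bound[OF A1] norm_pdiff_le_Linf[OF A1 dA] assms coercive])
      have "\<exists>G. G \<in> L2 \<and> is_weak_pdiff \<gamma> ?W G \<and> c\<^sub>0 * norm_L2 G \<le> norm_L2 f + (K * (D * ?N)) * (\<eta> * norm_L2 ?W)" for \<gamma>
        unfolding D_def \<eta>_def using ec.second_derivatives[OF uW W f weq] by blast
      then obtain G where G: "\<And>\<gamma>. G \<gamma> \<in> L2" "\<And>\<gamma>. is_weak_pdiff \<gamma> ?W (G \<gamma>)"
        "\<And>\<gamma>. c\<^sub>0 * norm_L2 (G \<gamma>) \<le> norm_L2 f + (K * (D * ?N)) * (\<eta> * norm_L2 ?W)"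
        by metis
      have N0: "?N \<ge> 0" by (rule L_inf_bounds(1)[OF dA])
      have "norm_L2 (G \<gamma>) \<le> (norm_L2 f + (K * (D * ?N)) * (\<eta> * c\<^sub>2)) / c\<^sub>0" for \<gamma>
      proof -
        have "(K * (D * ?N)) * (\<eta> * norm_L2 ?W) \<le> (K * (D * ?N)) * (\<eta> * c\<^sub>2)"
          using K0 D N0 \<eta> c\<^sub>2 by (intro mult_left_mono) auto
        then show ?thesis using G(3)[of \<gamma>] assms by (simp add: field_simps)
      qed
      then have "(\<Sum>\<gamma>\<in>UNIV. norm_L2 (G \<gamma>)) \<le> (\<Sum>\<gamma>\<in>(UNIV :: 'd set). (norm_L2 f + (K * (D * ?N)) * (\<eta> * c\<^sub>2)) / c\<^sub>0)"
        by (intro sum_mono)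
      also have "\<dots> = D / c\<^sub>0 * (1 * norm_L2 f + (K * D * \<eta>) * (c\<^sub>2 * ?N))"
        by (simp add: D_def algebra_simps add_divide_distrib)
      also have "\<dots> \<le> D / c\<^sub>0 * ((1 + K * D * \<eta>) * norm_L2 f + (1 + K * D * \<eta>) * (c\<^sub>2 * ?N))"
        using D assms K0 \<eta> c\<^sub>20 N0 by (intro mult_left_mono add_mono mult_right_mono) auto
      also have "\<dots> = K1 * (norm_L2 f + c\<^sub>2 * ?N)"
        by (simp add: K1_def algebra_simps add_divide_distrib)
      also have "\<dots> \<le> (K1 + K2) * (norm_L2 f + c\<^sub>2 * ?N)"
        using K2 c\<^sub>20 N0 by (intro mult_right_mono) auto
      finally have "norm_L2 (wgrad ?W) \<le> (K1 + K2) * (norm_L2 f + c\<^sub>2 * ?N)"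
        using wgrad_L2(2)[OF is_weak_grad_vec[OF G(2)] L2_vec(1)[OF G(1)]] L2_vec(2)[where F=G, OF G(1)] by simp
      moreover have "u \<in> Hdot 2"
        using u sobolev_1I[OF W G(2,1)] by (simp add: Hdot_def del: sobolev.simps)
      ultimately show ?thesis by simp
    qed
    moreover have "u \<in> Hdot 3 \<and> norm_L2 (wgrad (wgrad ?W)) \<le>
        (K1 + K2) * (norm_L2 (wgrad f) + norm_L2 (wgrad A) * norm_L2 (wgrad ?W) + c\<^sub>2 * norm_Linf (wgrad (wgrad A)))"
      if A2: "A \<in> C_k 2" and ddA: "wgrad (wgrad A) \<in> L_inf" and f1: "f \<in> sobolev 1"
    proof -
      let ?M = "norm_Linf (wgrad (wgrad A))"
      \<comment> \<open>Landau's bound serves as the derivative bound of the locale, so that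
        \<open>\<partial>A\<close> enters the estimate only through \<open>c\<^sub>1\<close> and
        \<open>\<partial>\<^sup>2A\<close>.\<close>
      let ?N = "sqrt (8 * c\<^sub>1 * (D * ?M))"
      have A1: "A \<in> C_k 1" by (rule C_k_mono[OF A2]) simp
      have M0: "?M \<ge> 0" by (rule L_inf_bounds(1)[OF ddA])
      note M = norm_pdiff_pdiff_le_Linf[OF A2 ddA]
      interpret ec: elliptic_coefficients flux A c\<^sub>0 K c\<^sub>1 ?N
        by (rule flux_elliptic_coefficients[OF K K0 A1 A_bound[OF A1] _ assms coercive])
           (use landau_pdiff[OF A2 A_bound[OF A1] M] in \<open>simp add: D_def\<close>)
      have f: "f \<in> L2" and "\<forall>\<gamma>. \<exists>f'. f' \<in> L2 \<and> is_weak_pdiff \<gamma> f f'" using f1 by auto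
      then obtain f' where f': "\<And>\<gamma>. is_weak_pdiff \<gamma> f (f' \<gamma>)" "\<And>\<gamma>. f' \<gamma> \<in> L2" by metis
      have "\<exists>G. G \<in> L2 \<and> is_weak_pdiff \<gamma> ?W G" for \<gamma>
        using ec.second_derivatives[OF uW W f weq] by blast
      then obtain G where G: "\<And>\<gamma>. G \<gamma> \<in> L2" "\<And>\<gamma>. is_weak_pdiff \<gamma> ?W (G \<gamma>)" by metis
      have NM: "?N\<^sup>2 \<le> 8 * c\<^sub>1 * (real CARD('d) * ?M)" using c\<^sub>1 D M0 by (simp add: D_def)
      obtain J where J: "\<And>\<gamma> \<delta>. J \<gamma> \<delta> \<in> L2" "\<And>\<gamma> \<delta>. is_weak_pdiff \<delta> (G \<gamma>) (J \<gamma> \<delta>)"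
        and Jn: "(\<Sum>\<gamma>\<in>UNIV. \<Sum>\<delta>\<in>UNIV. norm_L2 (J \<gamma> \<delta>))
          \<le> 2 / c\<^sub>0 * (D * (\<Sum>\<gamma>\<in>UNIV. norm_L2 (f' \<gamma>)) + D ^ 3 * K * ?M * norm_L2 ?W)
            + (B * D + 1)\<^sup>2 / c\<^sub>0\<^sup>2 * (8 * c\<^sub>1 * D * ?M * norm_L2 ?W)"
        unfolding B_def D_def \<eta>_def
        using ec.third_derivatives[OF A2 M NM uW W f' G weq] by blast
      \<comment> \<open>As in \<open>wgrad\<close>, the outermost index belongs to the derivative
        taken last; hence \<delta> stands outside \<gamma>.\<close>
      let ?H = "\<lambda>x. \<chi> \<gamma>. G \<gamma> x" and ?J = "\<lambda>x. \<chi> \<delta>. \<chi> \<gamma>. J \<gamma> \<delta> x"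
      note WH = is_weak_grad_vec[OF G(2)]
      have "is_weak_grad ?H ?J" by (intro is_weak_grad_vec is_weak_pdiff_vec J)
      then have J': "is_weak_grad (wgrad ?W) ?J"
        using wgrad_AE[OF WH] wgrad_measurable[OF WH] by (rule is_weak_grad_cong_AE)
      have JL2: "?J \<in> L2" by (intro L2_vec J)
      have f'n: "(\<Sum>\<gamma>\<in>UNIV. norm_L2 (f' \<gamma>)) \<le> D * norm_L2 (wgrad f)"
      proof -
        have "norm_L2 (f' \<gamma>) \<le> norm_L2 (wgrad f)" for \<gamma>
          using wgrad_L2(2)[OF is_weak_grad_vec[OF f'(1)] L2_vec(1)[where F=f', OF f'(2)]]
            L2_norm_components(2)[OF L2_vec(1)[where F=f', OF f'(2)], of \<gamma>] by simp
        then show ?thesis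
          using sum_bounded_above[of "UNIV :: 'd set" "\<lambda>\<gamma>. norm_L2 (f' \<gamma>)"] by (simp add: D_def)
      qed
      have Ms: "?M * norm_L2 ?W \<le> c\<^sub>2 * ?M"
        by (simp only: mult.commute[of ?M]) (rule mult_right_mono[OF c\<^sub>2 M0])
      have "norm_L2 (wgrad (wgrad ?W)) = norm_L2 ?J" by (rule wgrad_L2(2)[OF J' JL2])
      also have "\<dots> \<le> (\<Sum>\<delta>\<in>UNIV. norm_L2 (\<lambda>x. \<chi> \<gamma>. J \<gamma> \<delta> x))" by (intro L2_vec(2) L2_vec(1) J)
      also have "\<dots> \<le> (\<Sum>\<delta>\<in>UNIV. \<Sum>\<gamma>\<in>UNIV. norm_L2 (J \<gamma> \<delta>))" by (intro sum_mono L2_vec(2) J)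
      also have "\<dots> = (\<Sum>\<gamma>\<in>UNIV. \<Sum>\<delta>\<in>UNIV. norm_L2 (J \<gamma> \<delta>))" by (rule sum.swap)
      also note Jn
      also have "2 / c\<^sub>0 * (D * (\<Sum>\<gamma>\<in>UNIV. norm_L2 (f' \<gamma>)) + D ^ 3 * K * ?M * norm_L2 ?W)
            + (B * D + 1)\<^sup>2 / c\<^sub>0\<^sup>2 * (8 * c\<^sub>1 * D * ?M * norm_L2 ?W)
          \<le> 2 / c\<^sub>0 * (D * (D * norm_L2 (wgrad f)) + D ^ 3 * K * (c\<^sub>2 * ?M))
            + (B * D + 1)\<^sup>2 / c\<^sub>0\<^sup>2 * (8 * c\<^sub>1 * D * (c\<^sub>2 * ?M))"
        unfolding mult.assoc
        by (intro add_mono mult_left_mono f'n Ms) (use assms D K0 c\<^sub>1 in simp_all)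
      also have "\<dots> = (2 / c\<^sub>0 * D\<^sup>2) * norm_L2 (wgrad f)
          + (2 / c\<^sub>0 * (D ^ 3 * K) + (B * D + 1)\<^sup>2 / c\<^sub>0\<^sup>2 * (8 * c\<^sub>1 * D)) * (c\<^sub>2 * ?M)"
        by (simp add: algebra_simps power2_eq_square)
      also have "\<dots> \<le> K2 * norm_L2 (wgrad f) + K2 * (c\<^sub>2 * ?M)"
      proof (intro add_mono mult_right_mono)
        have "2 / c\<^sub>0 * D\<^sup>2 \<ge> 0" "2 / c\<^sub>0 * (D ^ 3 * K) \<ge> 0" "(B * D + 1)\<^sup>2 / c\<^sub>0\<^sup>2 * (8 * c\<^sub>1 * D) \<ge> 0"
          using assms D K0 c\<^sub>1 by auto
        then show "2 / c\<^sub>0 * D\<^sup>2 \<le> K2" "2 / c\<^sub>0 * (D ^ 3 * K) + (B * D + 1)\<^sup>2 / c\<^sub>0\<^sup>2 * (8 * c\<^sub>1 * D) \<le> K2"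
          using c\<^sub>1 by (simp_all add: K2_def distrib_left)
      qed (use c\<^sub>20 M0 in auto)
      also have "\<dots> = K2 * (norm_L2 (wgrad f) + c\<^sub>2 * ?M)" by (simp add: distrib_left)
      also have "\<dots> \<le> (K1 + K2) * (norm_L2 (wgrad f) + norm_L2 (wgrad A) * norm_L2 (wgrad ?W) + c\<^sub>2 * ?M)"
        using K1 K2 c\<^sub>20 M0 by (intro mult_mono) auto
      finally have est: "norm_L2 (wgrad (wgrad ?W)) \<le>
        (K1 + K2) * (norm_L2 (wgrad f) + norm_L2 (wgrad A) * norm_L2 (wgrad ?W) + c\<^sub>2 * ?M)" .
      have "G \<gamma> \<in> sobolev 1" for \<gamma> by (rule sobolev_1I[OF G(1) J(2,1)])
      then have "?W \<in> sobolev (Suc 1)"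
        using W G(2) by (subst sobolev.simps) blast
      then have "?W \<in> sobolev 2" by (simp only: Suc_1)
      then have "u \<in> Hdot 3" using u by (simp add: Hdot_def del: sobolev.simps)
      with est show ?thesis by simp
    qed
    ultimately show "(A \<in> C_k 1 \<longrightarrow> wgrad A \<in> L_inf \<longrightarrow> f \<in> L2 \<longrightarrow>
          u \<in> Hdot 2 \<and>
          norm_L2 (wgrad (wgrad u)) \<le> (K1 + K2) * (norm_L2 f + c\<^sub>2 * norm_Linf (wgrad A))) \<and>
       (A \<in> C_k 2 \<longrightarrow> wgrad (wgrad A) \<in> L_inf \<longrightarrow> wgrad A \<in> L2 \<longrightarrow> f \<in> sobolev 1 \<longrightarrow>
          u \<in> Hdot 3 \<and>
          norm_L2 (wgrad (wgrad (wgrad u))) \<le>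
            (K1 + K2) * (norm_L2 (wgrad f) + norm_L2 (wgrad A) * norm_L2 (wgrad (wgrad u))
                 + c\<^sub>2 * norm_Linf (wgrad (wgrad A))))"
      by blast
  qed
qed

end
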